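(* Let $r,k_1,\ldots,k_r\ge 2$ be integers and let $\zeta,K,\varepsilon>0$ be such that $\varepsilon<1/2$ and $\zeta>t!\,\varepsilon$, where $t:=\max_{2\le i\le r}k_i$. For $i\in[r]$ let $(\mathcal{H}^{(i)}_n)_{n\in\mathbb{N}}$, $\mathcal{H}^{(i)}_n=(H^{(i)}_n,\boldsymbol{\pi}^{(i)}_n)$, be a sequence of $k_i$-uniform ordered hypergraphs such that for every $n$ the hypergraphs $H^{(1)}_n,\ldots,H^{(r)}_n$ are all defined on the vertex set $[n]$. Let $w:[k_1]\to[1,\infty)$ and let $c',C'>0$ be constants. Then there exists $C>0$ such that the following holds for all functions $p:\mathbb{N}\to(0,1]$ with $p(n)\to0$ as $n\to\infty$ and all $\tau:\mathbb{N}\to(0,1)$ with $\tau(n)n\to\infty$. Suppose that (1) the sequence $\big((\mathcal{H}^{(1)}_n,\ldots,\mathcal{H}^{(r)}_n)\big)_{n\in\mathbb{N}}$ is $(r,\zeta)$-Ramsey; (2) $\mathcal{H}^{(1)}_n$ is $K$-tamed for all sufficiently large $n$; (3) $(\mathcal{H}^{(1)}_n)_{n\in\mathbb{N}}$ is $(p,w,\tau)$-properly bounded with constants $c',C'$; (4) $\delta(H^{(i)}_n,\tau)\le \varepsilon/(12\,t!)$ for all $i=2,\ldots,r$ and all sufficiently large $n$. Then, whenever $q:\mathbb{N}\to[0,1]$ satisfies $q(n)\ge Cp(n)$, with probability tending to $1$ as $n\to\infty$ the tuple $(\mathcal{H}^{(1)}_n[V_{n,q}],\ldots,\mathcal{H}^{(r)}_n[V_{n,q}])$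 is $r$-Ramsey.
   Context: Random set: $V_{n,q}=[n]_q$ is the random subset of $[n]$ in which each element is included independently with probability $q=q(n)$. Ordered hypergraphs: a $k$-uniform ordered hypergraph $\mathcal{H}=(H,\boldsymbol{\pi})$ consists of a $k$-uniform hypergraph $H$ and a set $\boldsymbol{\pi}$ of bijections (ordered edges), each $\pi\in\boldsymbol\pi$ being a bijection from $[k]$ onto some edge $\pi([k])\in E(H)$; the edges of $H$ are exactly the sets $\pi([k])$, $\pi\in\boldsymbol\pi$. Write $|\mathcal{H}|=e(\mathcal{H})=|\boldsymbol{\pi}|$. For a vertex subset $U$, $\mathcal{H}[U]$ consists of the ordered edges $\pi$ with $\pi([k])\subseteq U$. For $\emptyset\ne I\subseteq[k]$ the $I$-projection $\mathcal{H}_I$ is the ordered hypergraph on the same vertex set with set of ordered edges $\boldsymbol{\pi}_I=\{\pi|_I:\pi\in\boldsymbol\pi\}$; thus $|\mathcal{H}_I|=|\boldsymbol\pi_I|$. For $\emptyset\neq I\subset W\subseteq[k]$ and $u\in\boldsymbol\pi_I$, $\deg_{\mathcal{H}_W}(u)$ is the number of $\sigma\in\boldsymbol\pi_W$ with $\sigma|_I=u$. $K$-tamed: $\mathcal{H}$ is $K$-tamed if $\deg_{\mathcal{H}_W}(u)\le K|\mathcal{H}_W|/|\mathcal{H}_I|$ for all $\emptyset\ne I\subset W\subseteq[k]$ and all $u\in\boldsymbol\pi_I$. Ramsey: hypergraphs $(\mathcal H_1,\ldots,\mathcal H_r)$ on a common vertex set $V$ are $r$-Ramsey if for every partition $V=U_1\dot\cup\cdots\dot\cup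 U_r$ (parts may be empty) there is $i\in[r]$ with $e(\mathcal{H}_i[U_i])>0$. The sequence $((\mathcal{H}^{(1)}_n,\ldots,\mathcal{H}^{(r)}_n))_n$ is $(r,\zeta)$-Ramsey if for every sufficiently large $n$ and every partition $[n]=U_1\dot\cup\cdots\dot\cup U_r$ there is $i\in[r]$ with $e(\mathcal{H}^{(i)}_n[U_i])>\zeta\, e(\mathcal{H}^{(i)}_n)$. Boundedness: for $w:[k]\to[1,\infty)$ put $w(I)=\sum_{i\in I}w(i)$ for $I\subseteq[k]$. A sequence $(\mathcal{H}_n)_n$ of $k$-uniform ordered hypergraphs is $(p,w,\tau)$-bounded with constants $c',C'$ if for all sufficiently large $n$ $$c'\tau n\le\min_{\emptyset\neq I\subseteq[k]}p^{w(I)}|(\mathcal{H}_n)_I|\le C'\tau n .$$ A nonempty set $W\subseteq[k]$ attaining this minimum is a $w$-minimiser. The function $w$ is proper if for every $i\in[k]$ there is a $w$-minimiser containing $i$ (for all sufficiently large $n$). Properly bounded means bounded with $w$ proper. Co-degree function: for a $k$-uniform hypergraph $H$ on $n$ vertices with average vertex degree $d>0$, let $\deg_H(T)$ be the number of edges containing $T$, and for $2\le j\le k$ and a vertex $v$ let $\deg^{(j)}_H(v)=\max\{\deg_H(T): v\in T\subseteq V(H),\ |T|=j\}$. For $\tau>0$, $$\delta_j(H,\tau)=\frac{\sum_{v\in V(H)}\deg^{(j)}_H(v)}{\tau^{j-1}nd},\qquad \delta(H,\tau)=2^{\binom k2-1}\sum_{j=2}^k2^{-\binom{j-1}{2}}\delta_j(H,\tau).$$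 *)

theory Defs
  imports "HOL-Probability.Probability"
begin

record 'a hypergraph =
  verts :: "'a set"
  edges :: "'a set set"

record 'a ordered_hypergraph = "'a hypergraph" +
  ord_edges :: "(nat \<Rightarrow> 'a) set"

text \<open>
  Ordered edges are bijections from \<open>[k]\<close> onto edges. They are represented by functions that are
  \<^const>\<open>undefined\<close> outside \<open>[k]\<close>, so that equal bijections are equal as HOL functions and counting
  ordered edges (and their restrictions) is meaningful.
\<close>

definition uniform_hypergraph :: "nat \<Rightarrow> ('a, 'b) hypergraph_scheme \<Rightarrow> bool" where
  "uniform_hypergraph k H \<longleftrightarrow> (\<forall>e\<in>edges H. e \<subseteq> verts H \<and> finite e \<and> card e = k)"

definition uniform_ordered_hypergraph :: "nat \<Rightarrow> 'a ordered_hypergraph \<Rightarrow> bool" where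
  "uniform_ordered_hypergraph k H \<longleftrightarrow>
     uniform_hypergraph k H \<and>
     (\<forall>\<pi>\<in>ord_edges H. \<pi> \<in> extensional {1..k} \<and> (\<exists>e\<in>edges H. bij_betw \<pi> {1..k} e)) \<and>
     edges H = (\<lambda>\<pi>. \<pi> ` {1..k}) ` ord_edges H"

definition osize :: "'a ordered_hypergraph \<Rightarrow> nat" where
  "osize H = card (ord_edges H)"

definition induced :: "nat \<Rightarrow> 'a ordered_hypergraph \<Rightarrow> 'a set \<Rightarrow> 'a ordered_hypergraph" where
  "induced k H U =
     \<lparr>verts = U, edges = {e \<in> edges H. e \<subseteq> U}, ord_edges = {\<pi> \<in> ord_edges H. \<pi> ` {1..k} \<subseteq> U}\<rparr>"

definition proj :: "'a ordered_hypergraph \<Rightarrow> nat set \<Rightarrow> 'a ordered_hypergraph" where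
  "proj H I =
     \<lparr>verts = verts H, edges = (\<lambda>\<pi>. \<pi> ` I) ` ord_edges H,
      ord_edges = (\<lambda>\<pi>. restrict \<pi> I) ` ord_edges H\<rparr>"

text \<open>\<open>proj_deg H W I u\<close> is the degree of \<open>u \<in> \<pi>\<^sub>I\<close> in the projection \<open>H\<^sub>W\<close>.\<close>

definition proj_deg ::
  "'a ordered_hypergraph \<Rightarrow> nat set \<Rightarrow> nat set \<Rightarrow> (nat \<Rightarrow> 'a) \<Rightarrow> nat" where
  "proj_deg H W I u = card {\<sigma> \<in> ord_edges (proj H W). restrict \<sigma> I = u}"

definition tamed :: "nat \<Rightarrow> real \<Rightarrow> 'a ordered_hypergraph \<Rightarrow> bool" where
  "tamed k K H \<longleftrightarrow>
     (\<forall>I W. I \<noteq> {} \<and> I \<subset> W \<and> W \<subseteq> {1..k} \<longrightarrow>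
        (\<forall>u\<in>ord_edges (proj H I).
           real (proj_deg H W I u) \<le> K * real (osize (proj H W)) / real (osize (proj H I))))"

definition is_partition :: "nat \<Rightarrow> 'a set \<Rightarrow> (nat \<Rightarrow> 'a set) \<Rightarrow> bool" where
  "is_partition r V U \<longleftrightarrow> disjoint_family_on U {1..r} \<and> (\<Union>i\<in>{1..r}. U i) = V"

definition ramsey ::
  "nat \<Rightarrow> (nat \<Rightarrow> nat) \<Rightarrow> 'a set \<Rightarrow> (nat \<Rightarrow> 'a ordered_hypergraph) \<Rightarrow> bool" where
  "ramsey r k V H \<longleftrightarrow>
     (\<forall>U. is_partition r V U \<longrightarrow> (\<exists>i\<in>{1..r}. osize (induced (k i) (H i) (U i)) > 0))"

definition seq_ramsey ::
  "nat \<Rightarrow> real \<Rightarrow> (nat \<Rightarrow> nat) \<Rightarrow> (nat \<Rightarrow> nat \<Rightarrow> nat ordered_hypergraph) \<Rightarrow> bool" where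
  "seq_ramsey r \<zeta> k H \<longleftrightarrow>
     (\<forall>\<^sub>F n in sequentially. \<forall>U. is_partition r {1..n} U \<longrightarrow>
        (\<exists>i\<in>{1..r}. real (osize (induced (k i) (H i n) (U i))) > \<zeta> * real (osize (H i n))))"

definition weighted_size ::
  "real \<Rightarrow> (nat \<Rightarrow> real) \<Rightarrow> 'a ordered_hypergraph \<Rightarrow> nat set \<Rightarrow> real" where
  "weighted_size p w H I = p powr (\<Sum>i\<in>I. w i) * real (osize (proj H I))"

definition min_weighted_size ::
  "nat \<Rightarrow> real \<Rightarrow> (nat \<Rightarrow> real) \<Rightarrow> 'a ordered_hypergraph \<Rightarrow> real" where
  "min_weighted_size k p w H = Min (weighted_size p w H ` {I. I \<noteq> {} \<and> I \<subseteq> {1..k}})"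

definition minimiser ::
  "nat \<Rightarrow> real \<Rightarrow> (nat \<Rightarrow> real) \<Rightarrow> 'a ordered_hypergraph \<Rightarrow> nat set \<Rightarrow> bool" where
  "minimiser k p w H W \<longleftrightarrow>
     W \<noteq> {} \<and> W \<subseteq> {1..k} \<and> weighted_size p w H W = min_weighted_size k p w H"

definition bounded_seq ::
  "nat \<Rightarrow> (nat \<Rightarrow> real) \<Rightarrow> (nat \<Rightarrow> real) \<Rightarrow> (nat \<Rightarrow> real) \<Rightarrow> real \<Rightarrow> real \<Rightarrow>
     (nat \<Rightarrow> 'a ordered_hypergraph) \<Rightarrow> bool" where
  "bounded_seq k p w \<tau> c' C' H \<longleftrightarrow>
     (\<forall>\<^sub>F n in sequentially.
        c' * \<tau> n * real n \<le> min_weighted_size k (p n) w (H n) \<and>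
        min_weighted_size k (p n) w (H n) \<le> C' * \<tau> n * real n)"

definition proper_weight ::
  "nat \<Rightarrow> (nat \<Rightarrow> real) \<Rightarrow> (nat \<Rightarrow> real) \<Rightarrow> (nat \<Rightarrow> 'a ordered_hypergraph) \<Rightarrow> bool" where
  "proper_weight k p w H \<longleftrightarrow>
     (\<forall>\<^sub>F n in sequentially. \<forall>i\<in>{1..k}. \<exists>W. minimiser k (p n) w (H n) W \<and> i \<in> W)"

definition properly_bounded_seq ::
  "nat \<Rightarrow> (nat \<Rightarrow> real) \<Rightarrow> (nat \<Rightarrow> real) \<Rightarrow> (nat \<Rightarrow> real) \<Rightarrow> real \<Rightarrow> real \<Rightarrow>
     (nat \<Rightarrow> 'a ordered_hypergraph) \<Rightarrow> bool" where
  "properly_bounded_seq k p w \<tau> c' C' H \<longleftrightarrow> bounded_seq k p w \<tau> c' C' H \<and> proper_weight k p w H"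

definition hdeg :: "('a, 'b) hypergraph_scheme \<Rightarrow> 'a set \<Rightarrow> nat" where
  "hdeg H T = card {e \<in> edges H. T \<subseteq> e}"

definition avg_deg :: "('a, 'b) hypergraph_scheme \<Rightarrow> real" where
  "avg_deg H = (\<Sum>v\<in>verts H. real (hdeg H {v})) / real (card (verts H))"

definition max_codeg :: "('a, 'b) hypergraph_scheme \<Rightarrow> nat \<Rightarrow> 'a \<Rightarrow> nat" where
  "max_codeg H j v = Max {hdeg H T | T. v \<in> T \<and> T \<subseteq> verts H \<and> card T = j}"

text \<open>
  The co-degree functions are meant for nonempty hypergraphs with at least \<open>k\<close> vertices; then
  \<^const>\<open>avg_deg\<close> is positive and the maxima range over nonempty sets. They count unordered edges.
\<close>

definition codeg_j :: "('a, 'b) hypergraph_scheme \<Rightarrow> real \<Rightarrow> nat \<Rightarrow> real" where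
  "codeg_j H \<tau> j =
     (\<Sum>v\<in>verts H. real (max_codeg H j v)) / (\<tau> ^ (j - 1) * real (card (verts H)) * avg_deg H)"

definition codeg :: "nat \<Rightarrow> ('a, 'b) hypergraph_scheme \<Rightarrow> real \<Rightarrow> real" where
  "codeg k H \<tau> =
     2 ^ ((k choose 2) - 1) * (\<Sum>j=2..k. codeg_j H \<tau> j / 2 ^ ((j - 1) choose 2))"

definition random_subset :: "nat \<Rightarrow> real \<Rightarrow> nat set pmf" where
  "random_subset n q =
     map_pmf (\<lambda>f. {i \<in> {1..n}. f i}) (Pi_pmf {1..n} False (\<lambda>_. bernoulli_pmf q))"

end

theory Submission
  imports Defs
begin

text \<open>
  Suppose that a colouring \<open>U\<^sub>1, \<dots>, U\<^sub>r\<close> of the random set \<open>V\<close> has no edge of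
  \<open>H\<^sub>i\<close> inside \<open>U\<^sub>i\<close> for any \<open>i\<close>. For \<open>i \<ge> 2\<close> the container theorem
  (\<open>hypergraph_containers\<close>) encloses \<open>U\<^sub>i\<close> in a container that spans at most an
  \<open>\<epsilon>\<close>-fraction of the edges of \<open>H\<^sub>i\<close> and is determined by a fingerprint of
  \<open>O(\<tau>n)\<close> labelled vertices of \<open>U\<^sub>i\<close>. An edge carries at most \<open>t!\<close> ordered edges and
  \<open>\<zeta> > t! \<epsilon>\<close>, so the robust Ramsey property of \<open>[n]\<close>, applied to the partition into the containers and
  the set \<open>R\<close> of vertices left over, forces \<open>R\<close> to span more than a \<open>\<zeta>\<close>-fraction of
  \<open>H\<^sub>1\<close> (\<open>leftover_dense\<close>). But \<open>V \<inter> R \<subseteq> U\<^sub>1\<close> spans no edge of \<open>H\<^sub>1\<close> at all. For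
  a fixed \<open>R\<close> the Janson inequality bounds the probability of this by \<open>exp (- \<Omega>(C\<tau>n))\<close>, where
  \<open>C\<close> is the constant in \<open>q \<ge> C p\<close>.

  It remains to take a union bound over the fingerprints. The number of subsets of \<open>V\<close> of size
  \<open>O(\<tau>n)\<close> is too large by a logarithm in the exponent when \<open>\<tau>\<close> is much smaller than \<open>p\<close>.
  Two devices remove the logarithm.

  \<^item> \<open>V\<close> contains a union \<open>V\<^sub>1 \<union> \<dots> \<union> V\<^sub>k\<close> of independent sparser sets, \<open>V\<^sub>i\<close> having density
    \<open>C\<^sub>0 p\<^bsup>w(i)\<^esup>\<close> (\<open>subset_exp_image_le\<close>), and it suffices to use the edges of \<open>H\<^sub>1\<close> whose
    \<open>i\<close>-th vertex lies in \<open>V\<^sub>i\<close>; call them typed. The number of typed edges in the projection to \<open>I\<close>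
    is about \<open>C\<^sub>0\<^bsup>|I|\<^esup> p\<^bsup>w(I)\<^esup> |H\<^sub>I|\<close>, at least \<open>C\<^sub>0 c' \<tau>n\<close> for every \<open>I\<close> and at most
    \<open>C\<^sub>0\<^bsup>k\<^esup> C' \<tau>n\<close> if \<open>I\<close> is a minimiser.
  \<^item> A vertex that lies in no typed edge may be recoloured with colour \<open>1\<close>. So fingerprints need only
    be taken of vertices of typed edges, and if such a vertex plays the role \<open>j\<close> in a typed edge, it
    is recorded by the restriction of that edge to a minimiser containing \<open>j\<close>
    (\<open>not_ramsey_fingerprint\<close>). There are only \<open>O(\<tau>n)\<close> typed restrictions to choose from.

  Hence the expected number of fingerprints of size \<open>s\<close> is at most \<open>(B \<tau>n)\<^bsup>s\<^esup> / s!\<close> with \<open>B\<close>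
  polynomial in \<open>C\<^sub>0\<close> (\<open>choices_weight\<close>), which for \<open>s = O(\<tau>n)\<close> is \<open>exp (O(\<tau>n log C\<^sub>0))\<close>. This
  expectation is controlled only on the event, of probability tending to \<open>1\<close> by a second moment
  computation, that no projection has more than twice its expected number of typed edges
  (\<open>prob_not_moderate_le\<close>). The events ``the fingerprint is present'' and ``\<open>R\<close> spans no typed edge''
  are respectively increasing and decreasing, so their joint probability is at most the product
  (\<open>subset_exp_superset_antimono\<close>). The Janson exponent is linear in \<open>C\<^sub>0\<close> and beats
  \<open>log C\<^sub>0\<close> once \<open>C\<^sub>0\<close> is large.

  The container theorem is proved by a cascade. Starting from the edges of a \<open>k\<close>-uniform hypergraph,
  each level replaces a multiset of \<open>s\<close>-sets by a multiset of \<open>(s-1)\<close>-sets: it goes through the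
  vertices in a fixed order and, whenever the link of a vertex (restricted to sets whose subsets have
  not yet been saturated) is heavy, selects the vertex and adds the link if the vertex belongs to the
  independent set \<open>I\<close>, and excludes the vertex from the container otherwise. The selected vertices
  form the fingerprint and suffice to replay the algorithm. Either the new multiset is again heavy or
  the excluded vertices carry a constant fraction of the degrees (\<open>run_dichotomy\<close>). At the last
  level each remaining singleton completes selected vertices to an edge, hence avoids \<open>I\<close>. So a
  constant fraction of the edges meets the complement of the container (\<open>single_container\<close>), and
  iterating on the edges inside the container makes the fraction as small as desired.
\<close>

section \<open>Random subsets of a finite set\<close>

text \<open>The expectation of \<open>f\<close> over a random subset of \<open>\<Omega>\<close> that contains each \<open>x\<close> independently with
  probability \<open>q x\<close>. As a finite sum it admits induction on \<open>\<Omega>\<close>, conditioning on one point at a time.\<close>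

definition subset_exp :: "'x set \<Rightarrow> ('x \<Rightarrow> real) \<Rightarrow> ('x set \<Rightarrow> real) \<Rightarrow> real" where
  "subset_exp \<Omega> q f = (\<Sum>A\<in>Pow \<Omega>. (\<Prod>x\<in>A. q x) * (\<Prod>x\<in>\<Omega> - A. 1 - q x) * f A)"

lemma subset_exp_empty [simp]: "subset_exp {} q f = f {}"
  by (simp add: subset_exp_def)

lemma subset_exp_insert:
  assumes "finite \<Omega>" "x \<notin> \<Omega>"
  shows "subset_exp (insert x \<Omega>) q f =
    q x * subset_exp \<Omega> q (\<lambda>A. f (insert x A)) + (1 - q x) * subset_exp \<Omega> q f"
proof -
  let ?g = "\<lambda>A. (\<Prod>y\<in>A. q y) * (\<Prod>y\<in>insert x \<Omega> - A. 1 - q y) * f A"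
  have disj: "Pow \<Omega> \<inter> insert x ` Pow \<Omega> = {}" using assms by auto
  have inj: "inj_on (insert x) (Pow \<Omega>)" using assms by (auto simp: inj_on_def)
  have "subset_exp (insert x \<Omega>) q f = sum ?g (Pow \<Omega>) + sum ?g (insert x ` Pow \<Omega>)"
    unfolding subset_exp_def Pow_insert using assms disj by (subst sum.union_disjoint) auto
  also have "sum ?g (insert x ` Pow \<Omega>) = (\<Sum>A\<in>Pow \<Omega>. ?g (insert x A))"
    using inj by (simp add: sum.reindex)
  also have "\<dots> = q x * subset_exp \<Omega> q (\<lambda>A. f (insert x A))"
    unfolding subset_exp_def sum_distrib_left
  proof (rule sum.cong)
    fix A assume A: "A \<in> Pow \<Omega>"
    have "finite A" "x \<notin> A" "insert x \<Omega> - insert x A = \<Omega> - A"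
      using A assms finite_subset by auto
    then show "?g (insert x A) = q x * (prod q A * (\<Prod>x\<in>\<Omega> - A. 1 - q x) * f (insert x A))"
      by simp
  qed simp
  also have "sum ?g (Pow \<Omega>) = (1 - q x) * subset_exp \<Omega> q f"
    unfolding subset_exp_def sum_distrib_left
  proof (rule sum.cong)
    fix A assume A: "A \<in> Pow \<Omega>"
    have "insert x \<Omega> - A = insert x (\<Omega> - A)" using A assms by auto
    then show "?g A = (1 - q x) * (prod q A * (\<Prod>x\<in>\<Omega> - A. 1 - q x) * f A)"
      using assms by simp
  qed simp
  finally show ?thesis by simp
qed

lemma subset_exp_add: "subset_exp \<Omega> q (\<lambda>A. f A + g A) = subset_exp \<Omega> q f + subset_exp \<Omega> q g"
  by (simp add: subset_exp_def algebra_simps sum.distrib)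

lemma subset_exp_diff: "subset_exp \<Omega> q (\<lambda>A. f A - g A) = subset_exp \<Omega> q f - subset_exp \<Omega> q g"
  by (simp add: subset_exp_def algebra_simps sum_subtractf)

lemma subset_exp_cmult: "subset_exp \<Omega> q (\<lambda>A. c * f A) = c * subset_exp \<Omega> q f"
  by (simp add: subset_exp_def algebra_simps sum_distrib_left)

lemma subset_exp_sum: "subset_exp \<Omega> q (\<lambda>A. \<Sum>i\<in>I. f i A) = (\<Sum>i\<in>I. subset_exp \<Omega> q (f i))"
  unfolding subset_exp_def sum_distrib_left by (rule sum.swap)

lemma subset_exp_cong:
  assumes "\<And>A. A \<subseteq> \<Omega> \<Longrightarrow> f A = g A"
  shows "subset_exp \<Omega> q f = subset_exp \<Omega> q g"
  using assms by (auto simp: subset_exp_def intro!: sum.cong)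

lemma subset_exp_const [simp]:
  assumes "finite \<Omega>"
  shows "subset_exp \<Omega> q (\<lambda>_. c) = c"
  using assms by (induction) (auto simp: subset_exp_insert algebra_simps)

lemma subset_exp_mono:
  assumes "\<And>x. x \<in> \<Omega> \<Longrightarrow> 0 \<le> q x \<and> q x \<le> 1" "\<And>A. A \<subseteq> \<Omega> \<Longrightarrow> f A \<le> g A"
  shows "subset_exp \<Omega> q f \<le> subset_exp \<Omega> q g"
  unfolding subset_exp_def
proof (rule sum_mono)
  fix A assume A: "A \<in> Pow \<Omega>"
  have "0 \<le> (\<Prod>x\<in>A. q x) * (\<Prod>x\<in>\<Omega> - A. 1 - q x)"
    using A assms by (intro mult_nonneg_nonneg prod_nonneg) auto
  then show "(\<Prod>x\<in>A. q x) * (\<Prod>x\<in>\<Omega> - A. 1 - q x) * f A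
     \<le> (\<Prod>x\<in>A. q x) * (\<Prod>x\<in>\<Omega> - A. 1 - q x) * g A"
    using A assms by (intro mult_left_mono) auto
qed

lemma subset_exp_nonneg:
  assumes "finite \<Omega>" "\<And>x. x \<in> \<Omega> \<Longrightarrow> 0 \<le> q x \<and> q x \<le> 1" "\<And>A. A \<subseteq> \<Omega> \<Longrightarrow> 0 \<le> f A"
  shows "0 \<le> subset_exp \<Omega> q f"
  using subset_exp_mono[of \<Omega> q "\<lambda>_. 0" f] assms by simp

text \<open>Conditioning on \<open>B \<subseteq> A\<close> leaves the coordinates outside \<open>B\<close> untouched, so it amounts to
  planting \<open>B\<close> into the random set.\<close>

lemma subset_exp_planting:
  assumes "finite \<Omega>" "B \<subseteq> \<Omega>"
  shows "subset_exp \<Omega> q (\<lambda>A. of_bool (B \<subseteq> A) * f A) = (\<Prod>x\<in>B. q x) * subset_exp \<Omega> q (\<lambda>A. f (A \<union> B))"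
proof -
  have "finite B" using assms finite_subset by auto
  then show ?thesis using assms(2)
  proof (induction B arbitrary: f)
    case empty
    then show ?case by simp
  next
    case (insert x B)
    have x: "x \<in> \<Omega>" using insert by auto
    define \<Omega>' where "\<Omega>' = \<Omega> - {x}"
    have \<Omega>: "\<Omega> = insert x \<Omega>'" "x \<notin> \<Omega>'" "finite \<Omega>'" using x assms by (auto simp: \<Omega>'_def)
    have single: "subset_exp \<Omega> q (\<lambda>A. of_bool (x \<in> A) * h A) = q x * subset_exp \<Omega> q (\<lambda>A. h (insert x A))" for h
    proof -
      have z: "subset_exp \<Omega>' q (\<lambda>A. of_bool (x \<in> A) * h A) = subset_exp \<Omega>' q (\<lambda>A. 0)"
        using \<Omega> by (intro subset_exp_cong) auto
      show ?thesis
        unfolding \<Omega>(1) using \<Omega>(2,3) z by (simp add: subset_exp_insert algebra_simps)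
    qed
    have "subset_exp \<Omega> q (\<lambda>A. of_bool (insert x B \<subseteq> A) * f A)
        = subset_exp \<Omega> q (\<lambda>A. of_bool (x \<in> A) * (of_bool (B \<subseteq> A) * f A))"
      by (intro subset_exp_cong) auto
    also have "\<dots> = q x * subset_exp \<Omega> q (\<lambda>A. of_bool (B \<subseteq> insert x A) * f (insert x A))"
      by (rule single)
    also have "\<dots> = q x * subset_exp \<Omega> q (\<lambda>A. of_bool (B \<subseteq> A) * f (insert x A))"
      using insert(2) by (simp add: subset_insert)
    also have "\<dots> = q x * ((\<Prod>x\<in>B. q x) * subset_exp \<Omega> q (\<lambda>A. f (insert x (A \<union> B))))"
      using insert by auto
    finally show ?case using insert by simp
  qed
qed

lemma subset_exp_superset:
  assumes "finite \<Omega>" "B \<subseteq> \<Omega>"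
  shows "subset_exp \<Omega> q (\<lambda>A. of_bool (B \<subseteq> A)) = (\<Prod>x\<in>B. q x)"
  using subset_exp_planting[OF assms, of q "\<lambda>_. 1"] assms by simp

text \<open>Planting \<open>B\<close> can only decrease a decreasing function of the random set. This is the
  only correlation inequality that the argument needs.\<close>

lemma subset_exp_superset_antimono:
  assumes "finite \<Omega>" "B \<subseteq> \<Omega>" "\<And>x. x \<in> \<Omega> \<Longrightarrow> 0 \<le> q x \<and> q x \<le> 1" "antimono f"
  shows "subset_exp \<Omega> q (\<lambda>A. of_bool (B \<subseteq> A) * f A) \<le> (\<Prod>x\<in>B. q x) * subset_exp \<Omega> q f"
  unfolding subset_exp_planting[OF assms(1,2)] using assms
  by (intro mult_left_mono subset_exp_mono prod_nonneg) (auto dest: antimonoD)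

text \<open>If every point of \<open>N\<close> is hit under \<open>h\<close> with probability at most \<open>Q\<close>, then the image of the
  random subset of \<open>\<Omega>\<close> is dominated by the \<open>Q\<close>-random subset of \<open>N\<close>. In the induction a
  point \<open>x\<close> hands over its share \<open>q x\<close> of the budget \<open>Q (h x)\<close>.\<close>

lemma subset_exp_image_le:
  assumes "finite \<Omega>" "finite N" "h ` \<Omega> \<subseteq> N" "mono f"
    and "\<And>x. x \<in> \<Omega> \<Longrightarrow> 0 \<le> q x" "\<And>v. v \<in> N \<Longrightarrow> Q v \<le> 1"
    and "\<And>v. v \<in> N \<Longrightarrow> (\<Sum>x | x \<in> \<Omega> \<and> h x = v. q x) \<le> Q v"
  shows "subset_exp \<Omega> q (\<lambda>A. f (h ` A)) \<le> subset_exp N Q f"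
  using assms
proof (induction \<Omega> arbitrary: Q f)
  case empty
  have "f {} \<le> f A" for A using empty by (auto dest: monoD)
  then have "subset_exp N Q (\<lambda>_. f {}) \<le> subset_exp N Q f"
    using empty by (intro subset_exp_mono) auto
  then show ?case using empty by simp
next
  case (insert x \<Omega>)
  define v where "v = h x"
  define Q' where "Q' = Q(v := Q v - q x)"
  define N' where "N' = N - {v}"
  have N: "N = insert v N'" "v \<notin> N'" "finite N'" using insert by (auto simp: N'_def v_def)
  have vs: "{y. y \<in> insert x \<Omega> \<and> h y = v} = insert x {y. y \<in> \<Omega> \<and> h y = v}"
    by (auto simp: v_def)
  have ub: "q x + (\<Sum>y | y \<in> \<Omega> \<and> h y = v. q y) \<le> Q v"
  proof -
    have "(\<Sum>y | y \<in> insert x \<Omega> \<and> h y = v. q y) \<le> Q v"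
      using insert.prems(6) N by blast
    then show ?thesis unfolding vs using insert(1,2) by simp
  qed
  have nn: "0 \<le> (\<Sum>y | y \<in> \<Omega> \<and> h y = v. q y)" using insert by (intro sum_nonneg) auto
  have qx: "0 \<le> q x" using insert by auto
  have Q1: "Q v \<le> 1" using insert N by auto
  have Q'b: "(\<Sum>y | y \<in> \<Omega> \<and> h y = u. q y) \<le> Q' u" if "u \<in> N" for u
  proof (cases "u = v")
    case True then show ?thesis using ub by (simp add: Q'_def)
  next
    case False
    then have "{y. y \<in> insert x \<Omega> \<and> h y = u} = {y. y \<in> \<Omega> \<and> h y = u}" by (auto simp: v_def)
    then show ?thesis using insert.prems(6)[OF that] False by (simp add: Q'_def)
  qed
  have Q'1: "Q' u \<le> 1" if "u \<in> N" for u
    using insert.prems(5)[OF that] qx Q1 by (auto simp: Q'_def)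
  have Q'0: "0 \<le> Q' u" if "u \<in> N" for u
    using Q'b[OF that] insert.prems(4) sum_nonneg[of "{y. y \<in> \<Omega> \<and> h y = u}" q] by force
  have IH: "subset_exp \<Omega> q (\<lambda>A. g (h ` A)) \<le> subset_exp N Q' g" if "mono g" for g
    using insert that Q'b Q'1 by (intro insert.IH) auto
  have mono': "mono (\<lambda>A. f (insert v A))"
    by (intro monoI monoD[OF insert.prems(3)] insert_mono) auto
  define a where "a = subset_exp N' Q (\<lambda>A. f (insert v A))"
  define b where "b = subset_exp N' Q f"
  have QQ': "subset_exp N' Q' g = subset_exp N' Q g" for g
    unfolding subset_exp_def
  proof (intro sum.cong refl arg_cong2[where f="(*)"])
    fix A assume "A \<in> Pow N'"
    then show "prod Q' A = prod Q A" "(\<Prod>x\<in>N' - A. 1 - Q' x) = (\<Prod>x\<in>N' - A. 1 - Q x)"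
      using N by (auto simp: Q'_def intro!: prod.cong)
  qed
  have ba: "b \<le> a"
    unfolding a_def b_def using N Q'0 Q'1 insert.prems(3)
    by (subst (1 2) QQ'[symmetric], intro subset_exp_mono) (auto intro!: monoD[OF insert.prems(3)])
  have q01: "q x \<le> 1" using ub nn Q1 by auto
  have "subset_exp (insert x \<Omega>) q (\<lambda>A. f (h ` A)) =
    q x * subset_exp \<Omega> q (\<lambda>A. f (insert v (h ` A))) + (1 - q x) * subset_exp \<Omega> q (\<lambda>A. f (h ` A))"
    using insert by (simp add: subset_exp_insert v_def)
  also have "\<dots> \<le> q x * subset_exp N Q' (\<lambda>A. f (insert v A)) + (1 - q x) * subset_exp N Q' f"
    using IH[OF mono'] IH[OF insert.prems(3)] qx q01 by (intro add_mono mult_left_mono) auto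
  also have "subset_exp N Q' (\<lambda>A. f (insert v A)) = a"
    unfolding N(1) using N by (simp add: subset_exp_insert a_def QQ' algebra_simps)
  also have "subset_exp N Q' f = (Q v - q x) * a + (1 - (Q v - q x)) * b"
    unfolding N(1) using N by (simp add: subset_exp_insert a_def b_def QQ') (simp add: Q'_def)
  also have "q x * a + (1 - q x) * ((Q v - q x) * a + (1 - (Q v - q x)) * b)
     = Q v * a + (1 - Q v) * b - q x * (Q v - q x) * (a - b)"
    by (simp add: algebra_simps)
  also have "\<dots> \<le> Q v * a + (1 - Q v) * b"
    using ba qx ub nn by (simp add: mult_nonneg_nonneg)
  also have "\<dots> = subset_exp N Q f"
    unfolding N(1) using N by (simp add: subset_exp_insert a_def b_def)
  finally show ?case .
qed

lemma prob_random_subset: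
  assumes "0 \<le> q" "q \<le> 1"
  shows "measure_pmf.prob (random_subset n q) {V. P V} = subset_exp {1..n} (\<lambda>_. q) (\<lambda>V. of_bool (P V))"
proof -
  let ?M = "Pi_pmf {1..n} False (\<lambda>_. bernoulli_pmf q)"
  let ?B = "(\<lambda>V i. i \<in> V) ` Pow {1..n}"
  let ?h = "\<lambda>f. {i \<in> {1..n}. f i}"
  have supp: "set_pmf ?M \<subseteq> ?B"
  proof
    fix f assume "f \<in> set_pmf ?M"
    then have "f \<in> PiE_dflt {1..n} False (\<lambda>_. set_pmf (bernoulli_pmf q))"
      using set_Pi_pmf_subset'[of "{1..n}" False "\<lambda>_. bernoulli_pmf q"] by auto
    then have "f = (\<lambda>i. i \<in> ?h f)" unfolding PiE_dflt_def by fastforce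
    then show "f \<in> ?B" by (rule image_eqI) blast
  qed
  have inj: "inj_on (\<lambda>V i. i \<in> V) (Pow {1..n})" by (auto simp: inj_on_def fun_eq_iff)
  have fin: "finite ?B" by simp
  have "measure_pmf.prob (random_subset n q) {V. P V} = measure_pmf.prob ?M {f. P (?h f)}"
    by (simp add: random_subset_def vimage_def)
  also have "\<dots> = measure_pmf.prob ?M ({f. P (?h f)} \<inter> ?B)"
    using supp by (intro measure_pmf.finite_measure_eq_AE) (auto simp: AE_measure_pmf_iff)
  also have "\<dots> = (\<Sum>f\<in>{f. P (?h f)} \<inter> ?B. pmf ?M f)"
    using fin by (subst measure_measure_pmf_finite) auto
  also have "\<dots> = (\<Sum>f\<in>?B. pmf ?M f * of_bool (P (?h f)))"
    using fin by (auto simp: sum.inter_restrict Int_commute intro!: sum.mono_neutral_cong_left)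
  also have "\<dots> = (\<Sum>V\<in>Pow {1..n}. pmf ?M (\<lambda>i. i \<in> V) * of_bool (P (?h (\<lambda>i. i \<in> V))))"
    using sum.reindex[OF inj, of "\<lambda>f. pmf ?M f * of_bool (P (?h f))"] by (simp only: o_def)
  also have "\<dots> = subset_exp {1..n} (\<lambda>_. q) (\<lambda>V. of_bool (P V))"
    unfolding subset_exp_def
  proof (rule sum.cong)
    fix V assume V: "V \<in> Pow {1..n}"
    have 1: "{1..n} = V \<union> ({1..n} - V)" using V by auto
    have "pmf ?M (\<lambda>i. i \<in> V) = (\<Prod>x\<in>{1..n}. pmf (bernoulli_pmf q) (x \<in> V))"
      using V by (subst pmf_Pi') auto
    also have "\<dots> = (\<Prod>x\<in>V \<union> ({1..n} - V). pmf (bernoulli_pmf q) (x \<in> V))"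
      using 1 by simp
    also have "\<dots> = (\<Prod>x\<in>V. pmf (bernoulli_pmf q) (x \<in> V)) * (\<Prod>x\<in>{1..n} - V. pmf (bernoulli_pmf q) (x \<in> V))"
      using V by (intro prod.union_disjoint) (auto intro: finite_subset)
    also have "\<dots> = (\<Prod>x\<in>V. q) * (\<Prod>x\<in>{1..n} - V. 1 - q)"
      using assms by (intro arg_cong2[where f="(*)"] prod.cong) auto
    finally have "pmf ?M (\<lambda>i. i \<in> V) = (\<Prod>x\<in>V. q) * (\<Prod>x\<in>{1..n} - V. 1 - q)" .
    moreover have "?h (\<lambda>i. i \<in> V) = V" using V by auto
    ultimately show "pmf ?M (\<lambda>i. i \<in> V) * of_bool (P (?h (\<lambda>i. i \<in> V)))
      = (\<Prod>x\<in>V. q) * (\<Prod>x\<in>{1..n} - V. 1 - q) * of_bool (P V)" by simp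
  qed simp
  finally show ?thesis .
qed

section \<open>The Janson inequality\<close>

text \<open>The proof of Boppana and Spencer: add the events one by one. Conditionally on the earlier sets
  being absent, \<open>B i\<close> is present with probability at least \<open>P(B i)\<close> minus the sum of
  \<open>P(B i \<union> B j)\<close> over the earlier \<open>j\<close> with \<open>B j\<close> meeting \<open>B i\<close>: the sets disjoint from
  \<open>B i\<close> are independent of it, and each of the others is discarded by a union bound and planting.\<close>

lemma janson_exp:
  fixes B :: "'i \<Rightarrow> 'x set"
  assumes "finite \<Omega>" "\<And>x. x \<in> \<Omega> \<Longrightarrow> 0 \<le> q x \<and> q x \<le> 1"
    and "finite S" "\<And>i. i \<in> S \<Longrightarrow> B i \<subseteq> \<Omega>"
  shows "subset_exp \<Omega> q (\<lambda>A. of_bool (\<forall>i\<in>S. \<not> B i \<subseteq> A)) \<le>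
    exp (- (\<Sum>i\<in>S. \<Prod>x\<in>B i. q x) +
      (\<Sum>(i, j)\<in>{(i, j). i \<in> S \<and> j \<in> S \<and> i \<noteq> j \<and> B i \<inter> B j \<noteq> {}}. \<Prod>x\<in>B i \<union> B j. q x) / 2)"
  using assms(3,4)
proof (induction S)
  case empty
  then show ?case using assms by simp
next
  case (insert i S)
  let ?E = "subset_exp \<Omega> q"
  let ?N = "\<lambda>S A. of_bool (\<forall>i\<in>S. \<not> B i \<subseteq> A) :: real"
  let ?P = "\<lambda>S. {(i, j). i \<in> S \<and> j \<in> S \<and> i \<noteq> j \<and> B i \<inter> B j \<noteq> {}}"
  let ?w = "\<lambda>(i, j). \<Prod>x\<in>B i \<union> B j. q x"
  define D where "D = {j \<in> S. B i \<inter> B j \<noteq> {}}"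
  define S0 where "S0 = S - D"
  define p where "p = (\<Prod>x\<in>B i. q x)"
  define s where "s = (\<Sum>j\<in>D. \<Prod>x\<in>B i \<union> B j. q x)"
  have finD: "finite D" using insert by (auto simp: D_def)
  have Bi: "B i \<subseteq> \<Omega>" using insert by auto
  have nn: "0 \<le> (\<Prod>x\<in>B i \<union> B j. q x)" if "j \<in> S" for j
    using insert that assms(2) by (intro prod_nonneg) blast
  have anti: "antimono (?N S')" for S' :: "'i set"
    by (intro antimonoI) (auto simp: of_bool_def)
  have E0: "0 \<le> ?E (?N S')" for S' :: "'i set" using assms by (intro subset_exp_nonneg) auto
  have "(?N (insert i S)) A = ?N S A - of_bool (B i \<subseteq> A) * ?N S A" for A by auto
  then have rec: "?E (?N (insert i S)) = ?E (?N S) - ?E (\<lambda>A. of_bool (B i \<subseteq> A) * ?N S A)"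
    by (simp add: subset_exp_diff[symmetric])
  have indep: "?E (\<lambda>A. of_bool (B i \<subseteq> A) * ?N S0 A) = p * ?E (?N S0)"
  proof -
    have "?N S0 (A \<union> B i) = ?N S0 A" for A
    proof -
      have "B j \<subseteq> A \<union> B i \<longleftrightarrow> B j \<subseteq> A" if "j \<in> S0" for j
        using that by (auto simp: S0_def D_def)
      then show ?thesis by simp
    qed
    then show ?thesis using subset_exp_planting[OF assms(1) Bi, of q "?N S0"] by (simp add: p_def)
  qed
  have pair: "?E (\<lambda>A. of_bool (B i \<union> B j \<subseteq> A) * ?N S0 A) \<le> (\<Prod>x\<in>B i \<union> B j. q x) * ?E (?N S0)"
    if "j \<in> D" for j
    using that insert assms anti by (intro subset_exp_superset_antimono) (auto simp: D_def)
  \<comment> \<open>If \<open>B i\<close> is present and no \<open>B j\<close> with \<open>j \<in> S0\<close> is, then no \<open>B j\<close> with \<open>j \<in> S\<close> is, unless some \<open>B j\<close> with \<open>j \<in> D\<close> is.\<close>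
  have "of_bool (B i \<subseteq> A) * ?N S0 A - (\<Sum>j\<in>D. of_bool (B i \<union> B j \<subseteq> A) * ?N S0 A)
      \<le> of_bool (B i \<subseteq> A) * ?N S A" for A
  proof (cases "\<exists>j\<in>D. B i \<union> B j \<subseteq> A \<and> ?N S0 A = 1")
    case True
    then obtain j where j: "j \<in> D" "B i \<union> B j \<subseteq> A" by auto
    have "(of_bool (B i \<union> B j \<subseteq> A) * ?N S0 A) \<le> (\<Sum>j\<in>D. of_bool (B i \<union> B j \<subseteq> A) * ?N S0 A)"
      using j finD by (intro member_le_sum) auto
    then show ?thesis using j by (auto simp: of_bool_def split: if_splits)
  next
    case False
    have "(\<Sum>j\<in>D. of_bool (B i \<union> B j \<subseteq> A) * ?N S0 A) \<ge> 0" by (intro sum_nonneg) auto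
    then show ?thesis using False by (auto simp: S0_def)
  qed
  then have "?E (\<lambda>A. of_bool (B i \<subseteq> A) * ?N S0 A - (\<Sum>j\<in>D. of_bool (B i \<union> B j \<subseteq> A) * ?N S0 A))
      \<le> ?E (\<lambda>A. of_bool (B i \<subseteq> A) * ?N S A)"
    using assms by (intro subset_exp_mono) auto
  moreover have "(\<Sum>j\<in>D. ?E (\<lambda>A. of_bool (B i \<union> B j \<subseteq> A) * ?N S0 A)) \<le> s * ?E (?N S0)"
    unfolding s_def sum_distrib_right by (intro sum_mono pair)
  ultimately have low: "(p - s) * ?E (?N S0) \<le> ?E (\<lambda>A. of_bool (B i \<subseteq> A) * ?N S A)"
    by (simp add: subset_exp_diff subset_exp_sum indep algebra_simps)
  have "?E (?N (insert i S)) \<le> ?E (?N S) * (1 - p + s)"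
  proof (cases "p - s \<ge> 0")
    case True
    have "?E (?N S) \<le> ?E (?N S0)"
      using assms by (intro subset_exp_mono) (auto simp: S0_def)
    then have "(p - s) * ?E (?N S) \<le> (p - s) * ?E (?N S0)" using True by (intro mult_left_mono)
    then show ?thesis using rec low by (simp add: algebra_simps)
  next
    case False
    have "0 \<le> ?E (\<lambda>A. of_bool (B i \<subseteq> A) * ?N S A)"
      using assms by (intro subset_exp_nonneg) auto
    moreover have "?E (?N S) * 1 \<le> ?E (?N S) * (1 - p + s)"
      using False E0 by (intro mult_left_mono) auto
    ultimately show ?thesis using rec by simp
  qed
  also have "\<dots> \<le> ?E (?N S) * exp (- p + s)"
    using exp_ge_add_one_self[of "- p + s"] E0[of S] by (intro mult_left_mono) (simp_all add: algebra_simps)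
  also have "\<dots> \<le> exp (- (\<Sum>i\<in>S. \<Prod>x\<in>B i. q x) + sum ?w (?P S) / 2) * exp (- p + s)"
    using insert by (intro mult_right_mono) auto
  also have "\<dots> = exp (- (\<Sum>i\<in>insert i S. \<Prod>x\<in>B i. q x) + (sum ?w (?P S) + 2 * s) / 2)"
    using insert by (simp add: exp_add[symmetric] p_def)
  also have "sum ?w (?P S) + 2 * s = sum ?w (?P (insert i S))"
  proof -
    have eq: "?P (insert i S) = ?P S \<union> ((\<lambda>j. (i, j)) ` D \<union> (\<lambda>j. (j, i)) ` D)"
      using insert by (auto simp: D_def)
    have fP: "finite (?P S)"
      using insert by (intro finite_subset[of "?P S" "S \<times> S"]) auto
    have "sum ?w (?P (insert i S)) = sum ?w (?P S) + (sum ?w ((\<lambda>j. (i, j)) ` D) + sum ?w ((\<lambda>j. (j, i)) ` D))"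
      unfolding eq using insert finD fP
      by (subst sum.union_disjoint; (subst sum.union_disjoint)?) (auto simp: D_def)
    also have "sum ?w ((\<lambda>j. (i, j)) ` D) = s"
      by (subst sum.reindex) (auto simp: inj_on_def s_def)
    also have "sum ?w ((\<lambda>j. (j, i)) ` D) = s"
      by (subst sum.reindex) (auto simp: inj_on_def s_def Un_commute)
    finally show ?thesis by simp
  qed
  finally show ?case .
qed

text \<open>The sum \<open>\<Delta>\<close> includes the diagonal. When \<open>\<Delta>\<close> is large the bound of \<open>janson_exp\<close> is void;
  it is then applied to a subfamily. In a random subfamily of density \<open>\<theta> = \<mu> / \<Delta>\<close> the linear term shrinks
  by \<open>\<theta>\<close> but the pair term by \<open>\<theta>\<^sup>2\<close>, so some subfamily attains the average exponent.\<close>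

lemma janson:
  fixes B :: "'i \<Rightarrow> 'x set"
  assumes "finite \<Omega>" "\<And>x. x \<in> \<Omega> \<Longrightarrow> 0 \<le> q x \<and> q x \<le> 1"
    and "finite S" "\<And>i. i \<in> S \<Longrightarrow> B i \<subseteq> \<Omega>" "\<And>i. i \<in> S \<Longrightarrow> B i \<noteq> {}"
    and \<mu>: "\<mu> = (\<Sum>i\<in>S. \<Prod>x\<in>B i. q x)"
    and \<Delta>: "\<Delta> = (\<Sum>(i, j)\<in>{(i, j). i \<in> S \<and> j \<in> S \<and> B i \<inter> B j \<noteq> {}}. \<Prod>x\<in>B i \<union> B j. q x)"
  shows "subset_exp \<Omega> q (\<lambda>A. of_bool (\<forall>i\<in>S. \<not> B i \<subseteq> A)) \<le> exp (- (\<mu>\<^sup>2 / (2 * \<Delta>)))"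
proof (cases "\<mu> = 0")
  case True
  have "subset_exp \<Omega> q (\<lambda>A. of_bool (\<forall>i\<in>S. \<not> B i \<subseteq> A)) \<le> subset_exp \<Omega> q (\<lambda>A. 1)"
    using assms by (intro subset_exp_mono) auto
  then show ?thesis using True assms(1) by simp
next
  case False
  let ?p = "\<lambda>i. \<Prod>x\<in>B i. q x"
  let ?w = "\<lambda>(i, j). \<Prod>x\<in>B i \<union> B j. q x"
  let ?P = "\<lambda>S. {(i, j). i \<in> S \<and> j \<in> S \<and> i \<noteq> j \<and> B i \<inter> B j \<noteq> {}}"
  have p0: "0 \<le> ?p i" if "i \<in> S" for i
    using assms(2,4) that by (intro prod_nonneg) blast
  have w0: "0 \<le> ?w z" if "z \<in> ?P S" for z
  proof -
    obtain i j where z: "z = (i, j)" "i \<in> S" "j \<in> S" using \<open>z \<in> ?P S\<close> by blast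
    have "0 \<le> q x" if "x \<in> B i \<union> B j" for x
      using assms(2,4) z(2,3) that by blast
    then show ?thesis unfolding z(1) by (auto intro!: prod_nonneg)
  qed
  have fP: "finite (?P S)"
    using assms(3) by (intro finite_subset[of "?P S" "S \<times> S"]) auto
  have split: "\<Delta> = \<mu> + sum ?w (?P S)"
  proof -
    have "{(i, j). i \<in> S \<and> j \<in> S \<and> B i \<inter> B j \<noteq> {}} = (\<lambda>i. (i, i)) ` S \<union> ?P S"
      using assms(5) by auto
    then have "\<Delta> = sum ?w ((\<lambda>i. (i, i)) ` S) + sum ?w (?P S)"
      unfolding \<Delta> using assms(3) fP by (subst sum.union_disjoint[symmetric]) auto
    also have "sum ?w ((\<lambda>i. (i, i)) ` S) = \<mu>"
      by (subst sum.reindex) (auto simp: inj_on_def \<mu>)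
    finally show ?thesis .
  qed
  have \<mu>pos: "\<mu> > 0" using False p0 \<mu> by (metis less_eq_real_def sum_nonneg)
  have W0: "sum ?w (?P S) \<ge> 0" using w0 by (intro sum_nonneg) auto
  define \<theta> where "\<theta> = \<mu> / \<Delta>"
  have \<Delta>pos: "\<Delta> > 0" using split \<mu>pos W0 by linarith
  have \<theta>: "0 \<le> \<theta>" "\<theta> \<le> 1" using \<mu>pos W0 \<Delta>pos by (auto simp: \<theta>_def split)
  define \<phi> where "\<phi> = (\<lambda>S'. - (\<Sum>i\<in>S'. ?p i) + sum ?w (?P S') / 2)"
  \<comment> \<open>A \<open>\<theta>\<close>-random subfamily has the exponent \<open>- \<theta> \<mu> + \<theta>\<^sup>2 (\<Delta> - \<mu>) / 2\<close> on average.\<close>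
  have "subset_exp S (\<lambda>_. \<theta>) \<phi> = subset_exp S (\<lambda>_. \<theta>)
     (\<lambda>S'. (- 1) * (\<Sum>i\<in>S. ?p i * of_bool ({i} \<subseteq> S')) + (1/2) * (\<Sum>z\<in>?P S. ?w z * of_bool ({fst z, snd z} \<subseteq> S')))"
  proof (rule subset_exp_cong)
    fix S' assume S': "S' \<subseteq> S"
    have 1: "(\<Sum>i\<in>S'. ?p i) = (\<Sum>i\<in>S. ?p i * of_bool ({i} \<subseteq> S'))"
      using S' assms(3) by (intro sum.mono_neutral_cong_left) auto
    have 2: "sum ?w (?P S') = (\<Sum>z\<in>?P S. ?w z * of_bool ({fst z, snd z} \<subseteq> S'))"
      using S' fP by (intro sum.mono_neutral_cong_left) auto
    show "\<phi> S' = (- 1) * (\<Sum>i\<in>S. ?p i * of_bool ({i} \<subseteq> S'))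
      + (1/2) * (\<Sum>z\<in>?P S. ?w z * of_bool ({fst z, snd z} \<subseteq> S'))"
      unfolding \<phi>_def 1 2 by simp
  qed
  also have "\<dots> = - (\<Sum>i\<in>S. ?p i * \<theta>) + (\<Sum>z\<in>?P S. ?w z * \<theta>\<^sup>2) / 2"
  proof -
    have 1: "subset_exp S (\<lambda>_. \<theta>) (\<lambda>S'. of_bool ({i} \<subseteq> S')) = \<theta>" if "i \<in> S" for i
      using that assms(3) by (subst subset_exp_superset) auto
    have 2: "subset_exp S (\<lambda>_. \<theta>) (\<lambda>S'. of_bool ({fst z, snd z} \<subseteq> S')) = \<theta>\<^sup>2" if "z \<in> ?P S" for z
      using that assms(3) by (subst subset_exp_superset) (auto simp: power2_eq_square)
    show ?thesis
      unfolding subset_exp_add subset_exp_cmult subset_exp_sum using 1 2 by simp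
  qed
  also have "\<dots> = - \<theta> * \<mu> + \<theta>\<^sup>2 * (\<Delta> - \<mu>) / 2"
    unfolding sum_distrib_right[symmetric] \<mu>[symmetric] split by simp
  also have "\<dots> \<le> - \<theta> * \<mu> + \<theta>\<^sup>2 * \<Delta> / 2" using \<mu>pos by (simp add: algebra_simps)
  also have "\<dots> = - (\<mu>\<^sup>2 / (2 * \<Delta>))"
    using \<Delta>pos by (simp add: \<theta>_def field_simps power2_eq_square)
  finally have avg: "subset_exp S (\<lambda>_. \<theta>) \<phi> \<le> - (\<mu>\<^sup>2 / (2 * \<Delta>))" .
  define m where "m = Min (\<phi> ` Pow S)"
  have "m \<in> \<phi> ` Pow S" unfolding m_def using assms(3) by (intro Min_in) auto
  then obtain S' where S': "S' \<subseteq> S" "\<phi> S' = m" by auto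
  have "subset_exp S (\<lambda>_. \<theta>) (\<lambda>_. m) \<le> subset_exp S (\<lambda>_. \<theta>) \<phi>"
    using \<theta> assms(3) by (intro subset_exp_mono) (auto simp: m_def)
  then have m: "m \<le> - (\<mu>\<^sup>2 / (2 * \<Delta>))" using avg assms(3) by simp
  have "subset_exp \<Omega> q (\<lambda>A. of_bool (\<forall>i\<in>S. \<not> B i \<subseteq> A)) \<le> subset_exp \<Omega> q (\<lambda>A. of_bool (\<forall>i\<in>S'. \<not> B i \<subseteq> A))"
    using S' assms by (intro subset_exp_mono) auto
  also have "\<dots> \<le> exp (\<phi> S')"
    unfolding \<phi>_def using assms(1,2) S' assms(3,4)
    by (intro janson_exp) (auto intro: finite_subset)
  also have "\<dots> \<le> exp (- (\<mu>\<^sup>2 / (2 * \<Delta>)))" using m S' by simp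
  finally show ?thesis .
qed

section \<open>Containers: one level of the algorithm\<close>

text \<open>A multiset of subsets of \<open>V\<close> is given by its multiplicity function \<open>g\<close>. The case \<open>U = {}\<close>
  gives its total size.\<close>

definition wdeg :: "'a set \<Rightarrow> ('a set \<Rightarrow> real) \<Rightarrow> 'a set \<Rightarrow> real" where
  "wdeg V g U = (\<Sum>f | f \<subseteq> V \<and> U \<subseteq> f. g f)"

text \<open>The part of the link of \<open>v\<close> in \<open>g\<close> that avoids the saturated sets, those \<open>U\<close> whose degree
  in the multiset \<open>g'\<close> built so far has reached \<open>\<theta> U\<close>.\<close>

definition link :: "'a set \<Rightarrow> ('a set \<Rightarrow> real) \<Rightarrow> ('a set \<Rightarrow> real) \<Rightarrow> ('a set \<Rightarrow> real) \<Rightarrow> 'a \<Rightarrow> 'a set \<Rightarrow> real" where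
  "link V g \<theta> g' v f =
    (if v \<notin> f \<and> (\<forall>U. U \<noteq> {} \<and> U \<subseteq> f \<longrightarrow> wdeg V g' U < \<theta> U) then g (insert v f) else 0)"

text \<open>One level of the cascade. The result is the new multiset, the set of selected vertices and the set
  of excluded vertices. Membership in \<open>I\<close> is queried only for vertices with heavy links.\<close>

primrec run :: "'a set \<Rightarrow> ('a set \<Rightarrow> real) \<Rightarrow> ('a set \<Rightarrow> real) \<Rightarrow> real \<Rightarrow> 'a set \<Rightarrow> 'a list \<Rightarrow>
    ('a set \<Rightarrow> real) \<Rightarrow> ('a set \<Rightarrow> real) \<times> 'a set \<times> 'a set" where
  "run V g \<theta> h I [] g' = (g', {}, {})"
| "run V g \<theta> h I (v # vs) g' =
    (if wdeg V (link V g \<theta> g' v) {} < h then run V g \<theta> h I vs g'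
     else if v \<in> I then
       (case run V g \<theta> h I vs (\<lambda>f. g' f + link V g \<theta> g' v f) of (g'', T, X) \<Rightarrow> (g'', insert v T, X))
     else (case run V g \<theta> h I vs g' of (g'', T, X) \<Rightarrow> (g'', T, insert v X)))"

text \<open>The part of \<open>g\<close> that is never affected by saturation, judged by the final multiset \<open>g'\<close>.\<close>

definition good_part :: "'a set \<Rightarrow> ('a set \<Rightarrow> real) \<Rightarrow> ('a set \<Rightarrow> real) \<Rightarrow> ('a set \<Rightarrow> real) \<Rightarrow> 'a set \<Rightarrow> real" where
  "good_part V g \<theta> g' f = (if \<forall>U. U \<noteq> {} \<and> U \<subseteq> f \<longrightarrow> wdeg V g' U < \<theta> U then g f else 0)"

lemma wdeg_mono:
  assumes "\<And>f. f \<subseteq> V \<Longrightarrow> g f \<le> g' f"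
  shows "wdeg V g U \<le> wdeg V g' U"
  unfolding wdeg_def using assms by (intro sum_mono) auto

lemma wdeg_nonneg: "(\<And>f. 0 \<le> g f) \<Longrightarrow> 0 \<le> wdeg V g U"
  unfolding wdeg_def by (intro sum_nonneg) auto

lemma wdeg_add: "wdeg V (\<lambda>f. g f + g' f) U = wdeg V g U + wdeg V g' U"
  by (simp add: wdeg_def sum.distrib)

lemma sum_wdeg_vertices:
  assumes "finite V" "\<And>f. g f \<noteq> 0 \<Longrightarrow> card f = s"
  shows "(\<Sum>v\<in>V. wdeg V g {v}) = real s * wdeg V g {}"
proof -
  have fin: "finite {f. f \<subseteq> V}" using assms by simp
  have "(\<Sum>v\<in>V. wdeg V g {v}) = (\<Sum>v\<in>V. \<Sum>f | f \<in> {f. f \<subseteq> V} \<and> v \<in> f. g f)"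
    unfolding wdeg_def by (intro sum.cong) auto
  also have "\<dots> = (\<Sum>f | f \<subseteq> V. \<Sum>v | v \<in> V \<and> v \<in> f. g f)"
    using assms(1) fin by (subst sum.swap_restrict) auto
  also have "\<dots> = (\<Sum>f | f \<subseteq> V. real s * g f)"
  proof (rule sum.cong)
    fix f assume f: "f \<in> {f. f \<subseteq> V}"
    then have "{v \<in> V. v \<in> f} = f" by auto
    then show "(\<Sum>v | v \<in> V \<and> v \<in> f. g f) = real s * g f"
      using assms(2)[of f] by (cases "g f = 0") auto
  qed simp
  also have "\<dots> = real s * wdeg V g {}"
    by (simp add: wdeg_def sum_distrib_left)
  finally show ?thesis .
qed

text \<open>A vertex with a heavy link is answered ``yes'' exactly if it is selected, so every set between
  \<open>T\<close> and \<open>I\<close> produces the same run. In particular \<open>T\<close> determines the run.\<close>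

lemma run_simulate:
  assumes "run V g \<theta> h I vs g' = (g'', T, X)" "T \<subseteq> J" "J \<subseteq> I"
  shows "run V g \<theta> h J vs g' = (g'', T, X)"
  using assms
proof (induction vs arbitrary: g' g'' T X)
  case Nil
  then show ?case by simp
next
  case (Cons v vs)
  show ?case
  proof (cases "wdeg V (link V g \<theta> g' v) {} < h")
    case True
    then show ?thesis using Cons by auto
  next
    case heavy: False
    show ?thesis
    proof (cases "v \<in> I")
      case True
      obtain T' where T': "run V g \<theta> h I vs (\<lambda>f. g' f + link V g \<theta> g' v f) = (g'', T', X)" "T = insert v T'"
        using Cons.prems heavy True by (auto split: prod.splits)
      then have "run V g \<theta> h J vs (\<lambda>f. g' f + link V g \<theta> g' v f) = (g'', T', X)"
        using Cons by auto
      then show ?thesis using heavy T' Cons.prems by auto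
    next
      case False
      obtain X' where X': "run V g \<theta> h I vs g' = (g'', T, X')" "X = insert v X'"
        using Cons.prems heavy False by (auto split: prod.splits)
      then have "run V g \<theta> h J vs g' = (g'', T, X')"
        using Cons by auto
      then show ?thesis using heavy X' Cons.prems False by auto
    qed
  qed
qed

lemma run_sets:
  assumes "run V g \<theta> h I vs g' = (g'', T, X)"
  shows "T \<subseteq> I" "X \<inter> I = {}" "T \<subseteq> set vs" "X \<subseteq> set vs"
proof -
  have "T \<subseteq> I \<and> X \<inter> I = {} \<and> T \<subseteq> set vs \<and> X \<subseteq> set vs"
    using assms
  proof (induction vs arbitrary: g' g'' T X)
    case (Cons v vs)
    show ?case
    proof (cases "wdeg V (link V g \<theta> g' v) {} < h")
      case True
      then show ?thesis using Cons.IH[of g' g'' T X] Cons.prems by auto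
    next
      case heavy: False
      show ?thesis
      proof (cases "v \<in> I")
        case True
        obtain T' where "run V g \<theta> h I vs (\<lambda>f. g' f + link V g \<theta> g' v f) = (g'', T', X)" "T = insert v T'"
          using Cons.prems heavy True by (auto split: prod.splits)
        then show ?thesis using Cons.IH True by fastforce
      next
        case False
        obtain X' where "run V g \<theta> h I vs g' = (g'', T, X')" "X = insert v X'"
          using Cons.prems heavy False by (auto split: prod.splits)
        then show ?thesis using Cons.IH False by fastforce
      qed
    qed
  qed simp
  then show "T \<subseteq> I" "X \<inter> I = {}" "T \<subseteq> set vs" "X \<subseteq> set vs" by auto
qed

lemma run_invariant:
  assumes "run V g \<theta> h I vs g' = (g'', T, X)" "P g'"
    and "\<And>g' v. P g' \<Longrightarrow> v \<in> I \<Longrightarrow> v \<in> set vs \<Longrightarrow> P (\<lambda>f. g' f + link V g \<theta> g' v f)"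
  shows "P g''"
  using assms
proof (induction vs arbitrary: g' g'' T X)
  case (Cons v vs)
  show ?case
  proof (cases "wdeg V (link V g \<theta> g' v) {} < h")
    case True
    then show ?thesis using Cons.IH[of g' g'' T X] Cons.prems by auto
  next
    case heavy: False
    show ?thesis
    proof (cases "v \<in> I")
      case True
      obtain T' where T': "run V g \<theta> h I vs (\<lambda>f. g' f + link V g \<theta> g' v f) = (g'', T', X)" "T = insert v T'"
        using Cons.prems heavy True by (auto split: prod.splits)
      have "P (\<lambda>f. g' f + link V g \<theta> g' v f)" using Cons.prems True by auto
      then show ?thesis using Cons.IH[OF T'(1)] Cons.prems(3) by auto
    next
      case False
      obtain X' where X': "run V g \<theta> h I vs g' = (g'', T, X')" "X = insert v X'"
        using Cons.prems heavy False by (auto split: prod.splits)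
      show ?thesis using Cons.IH[OF X'(1)] Cons.prems by auto
    qed
  qed
qed simp

lemma run_increasing:
  assumes "run V g \<theta> h I vs g' = (g'', T, X)" "\<And>f. 0 \<le> g f"
  shows "g' f \<le> g'' f"
proof -
  have "\<forall>f. g' f \<le> g'' f"
    by (rule run_invariant[OF assms(1), of "\<lambda>G. \<forall>f. g' f \<le> G f"])
      (use assms(2) in \<open>auto simp: link_def intro: add_increasing2\<close>)
  then show ?thesis by simp
qed

text \<open>Saturation is monotone in time: a set without saturated subsets at the end had none when
  \<open>v\<close> was treated.\<close>

lemma wdeg_good_part_le_link:
  assumes "finite V" "v \<in> V" "\<And>f. 0 \<le> g f" "\<And>f. g' f \<le> g'' f"
  shows "wdeg V (good_part V g \<theta> g'') {v} \<le> wdeg V (link V g \<theta> g' v) {}"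
proof -
  let ?A = "{f. f \<subseteq> V \<and> {v} \<subseteq> f}"
  have inj: "inj_on (\<lambda>f. f - {v}) ?A" by (auto simp: inj_on_def)
  have l0: "0 \<le> link V g \<theta> g' v f" for f using assms by (auto simp: link_def)
  have le: "good_part V g \<theta> g'' f \<le> link V g \<theta> g' v (f - {v})" if "f \<in> ?A" for f
  proof (cases "\<forall>U. U \<noteq> {} \<and> U \<subseteq> f \<longrightarrow> wdeg V g'' U < \<theta> U")
    case True
    have "wdeg V g' U < \<theta> U" if "U \<noteq> {}" "U \<subseteq> f - {v}" for U
    proof -
      have "wdeg V g' U \<le> wdeg V g'' U" using assms by (intro wdeg_mono)
      moreover have "wdeg V g'' U < \<theta> U" using True that by blast
      ultimately show ?thesis by linarith
    qed
    moreover have "insert v (f - {v}) = f" using that by auto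
    ultimately show ?thesis by (auto simp: link_def good_part_def assms)
  next
    case False
    then show ?thesis using l0 by (auto simp: good_part_def)
  qed
  have "wdeg V (good_part V g \<theta> g'') {v} \<le> (\<Sum>f\<in>?A. link V g \<theta> g' v (f - {v}))"
    unfolding wdeg_def using le by (intro sum_mono) auto
  also have "\<dots> = (\<Sum>f\<in>(\<lambda>f. f - {v}) ` ?A. link V g \<theta> g' v f)"
    using inj by (simp add: sum.reindex)
  also have "\<dots> \<le> wdeg V (link V g \<theta> g' v) {}"
    unfolding wdeg_def using assms l0 by (intro sum_mono2) auto
  finally show ?thesis .
qed

text \<open>Each selected vertex adds its whole current link to the multiset, which is at least \<open>h\<close> and at least
  the good degree of the vertex. A vertex that is neither selected nor excluded had a light link.\<close>

lemma run_accounting: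
  assumes "run V g \<theta> h I vs g' = (g'', T, X)" "distinct vs" "set vs \<subseteq> V" "finite V"
    and "\<And>f. 0 \<le> g f"
  shows "(\<Sum>v\<in>T. wdeg V (good_part V g \<theta> g'') {v}) + wdeg V g' {} \<le> wdeg V g'' {}"
    and "h * real (card T) + wdeg V g' {} \<le> wdeg V g'' {}"
    and "\<forall>v\<in>set vs - T - X. wdeg V (good_part V g \<theta> g'') {v} \<le> h"
proof -
  let ?D = "\<lambda>g'' v. wdeg V (good_part V g \<theta> g'') {v}"
  have "(\<Sum>v\<in>T. ?D g'' v) + wdeg V g' {} \<le> wdeg V g'' {} \<and> h * real (card T) + wdeg V g' {} \<le> wdeg V g'' {}
     \<and> (\<forall>v\<in>set vs - T - X. ?D g'' v \<le> h)"
    using assms(1-3)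
  proof (induction vs arbitrary: g' g'' T X)
    case (Cons v vs)
    have v: "v \<in> V" "v \<notin> set vs" using Cons.prems by auto
    have inc: "g' f \<le> g'' f" for f using run_increasing[OF Cons.prems(1) assms(5)] .
    have D: "?D g'' v \<le> wdeg V (link V g \<theta> g' v) {}"
      using assms(4,5) v inc by (intro wdeg_good_part_le_link)
    show ?case
    proof (cases "wdeg V (link V g \<theta> g' v) {} < h")
      case True
      then have r: "run V g \<theta> h I vs g' = (g'', T, X)" using Cons.prems by auto
      show ?thesis using Cons.IH[OF r] Cons.prems D True by auto
    next
      case heavy: False
      show ?thesis
      proof (cases "v \<in> I")
        case True
        obtain T' where T': "run V g \<theta> h I vs (\<lambda>f. g' f + link V g \<theta> g' v f) = (g'', T', X)" "T = insert v T'"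
          using Cons.prems heavy True by (auto split: prod.splits)
        have "v \<notin> T'" "finite T'" using run_sets[OF T'(1)] v finite_subset[OF _ finite_set] by auto
        then show ?thesis using Cons.IH[OF T'(1)] Cons.prems(2,3) D heavy
          by (auto simp: T'(2) wdeg_add algebra_simps)
      next
        case False
        obtain X' where X': "run V g \<theta> h I vs g' = (g'', T, X')" "X = insert v X'"
          using Cons.prems heavy False by (auto split: prod.splits)
        show ?thesis using Cons.IH[OF X'(1)] Cons.prems(2,3) X'(2) by auto
      qed
    qed
  qed simp
  then show "(\<Sum>v\<in>T. wdeg V (good_part V g \<theta> g'') {v}) + wdeg V g' {} \<le> wdeg V g'' {}"
    and "h * real (card T) + wdeg V g' {} \<le> wdeg V g'' {}"
    and "\<forall>v\<in>set vs - T - X. wdeg V (good_part V g \<theta> g'') {v} \<le> h" by auto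
qed

lemma wdeg_link_le:
  assumes "finite V" "v \<in> V" "\<And>f. 0 \<le> g f"
  shows "wdeg V (link V g \<theta> g' v) U \<le> (if v \<in> U then 0 else wdeg V g (insert v U))"
proof (cases "v \<in> U")
  case True
  then have "wdeg V (link V g \<theta> g' v) U = 0"
    unfolding wdeg_def by (intro sum.neutral) (auto simp: link_def)
  then show ?thesis using True by simp
next
  case False
  let ?A = "{f. f \<subseteq> V \<and> U \<subseteq> f \<and> v \<notin> f}"
  have "wdeg V (link V g \<theta> g' v) U = (\<Sum>f\<in>?A. link V g \<theta> g' v f)"
    unfolding wdeg_def using assms(1) by (intro sum.mono_neutral_right) (auto simp: link_def)
  also have "\<dots> \<le> (\<Sum>f\<in>?A. g (insert v f))"
    using assms(3) by (intro sum_mono) (auto simp: link_def)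
  also have "\<dots> = (\<Sum>f\<in>insert v ` ?A. g f)"
    by (subst sum.reindex) (auto simp: inj_on_def)
  also have "\<dots> \<le> wdeg V g (insert v U)"
    unfolding wdeg_def using assms by (intro sum_mono2) auto
  finally show ?thesis using False by simp
qed

text \<open>Once \<open>U\<close> is saturated its degree stays constant. Before that, a single step increases it by at
  most the degree of \<open>insert v U\<close> in \<open>g\<close>, so it overshoots the threshold by at most this much.\<close>

lemma run_cap:
  assumes "run V g \<theta> h I vs (\<lambda>_. 0) = (g'', T, X)" "set vs \<subseteq> V" "finite V"
    and "\<And>f. 0 \<le> g f" "U \<noteq> {}" "0 \<le> \<theta> U" "\<theta> U \<le> c"
    and "\<And>v. v \<in> V - U \<Longrightarrow> \<theta> U + wdeg V g (insert v U) \<le> c"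
  shows "wdeg V g'' U \<le> c"
proof (rule run_invariant[OF assms(1), of "\<lambda>g'. wdeg V g' U \<le> c"])
  show "wdeg V (\<lambda>_. 0) U \<le> c" using assms(6,7) by (simp add: wdeg_def)
  fix g' v assume g': "wdeg V g' U \<le> c" and v: "v \<in> set vs"
  show "wdeg V (\<lambda>f. g' f + link V g \<theta> g' v f) U \<le> c"
  proof (cases "wdeg V g' U < \<theta> U")
    case True
    have "wdeg V (link V g \<theta> g' v) U \<le> (if v \<in> U then 0 else wdeg V g (insert v U))"
      using assms v by (intro wdeg_link_le) auto
    then show ?thesis using True assms(7) assms(8)[of v] v assms(2) by (auto simp: wdeg_add split: if_splits)
  next
    case False
    have "wdeg V (link V g \<theta> g' v) U = 0"
      unfolding wdeg_def using False assms(5) by (intro sum.neutral) (auto simp: link_def)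
    then show ?thesis using g' by (simp add: wdeg_add)
  qed
qed

lemma run_support:
  assumes "run V g \<theta> h I vs (\<lambda>_. 0) = (g'', T, X)" "g'' f \<noteq> 0"
  shows "\<exists>v\<in>I. v \<notin> f \<and> g (insert v f) \<noteq> 0"
proof -
  let ?P = "\<lambda>G :: 'a set \<Rightarrow> real. \<forall>f. G f \<noteq> 0 \<longrightarrow> (\<exists>v\<in>I. v \<notin> f \<and> g (insert v f) \<noteq> 0)"
  have "?P g''"
  proof (rule run_invariant[OF assms(1), of ?P])
    fix g' v assume P: "?P g'" and v: "v \<in> I"
    show "?P (\<lambda>f. g' f + link V g \<theta> g' v f)"
    proof (intro allI impI)
      fix f assume "g' f + link V g \<theta> g' v f \<noteq> 0"
      then consider "g' f \<noteq> 0" | "link V g \<theta> g' v f \<noteq> 0" by force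
      then show "\<exists>v\<in>I. v \<notin> f \<and> g (insert v f) \<noteq> 0"
      proof cases
        case 2
        then show ?thesis using v unfolding link_def by (metis (full_types))
      qed (use P in blast)
    qed
  qed simp
  then show ?thesis using assms(2) by blast
qed

text \<open>Double counting. A saturated \<open>U\<close> has degree at least \<open>\<theta> U \<ge> \<tau> * wdeg V g U\<close> in \<open>g'\<close>, so
  the degrees in \<open>g\<close> of all saturated sets sum to at most \<open>1/\<tau>\<close> times the sum of all degrees in
  \<open>g'\<close>, and each \<open>s\<close>-set contributes to \<open>2 ^ s\<close> of the latter.\<close>

lemma saturated_weight_le:
  assumes "finite V" "\<And>f. 0 \<le> g f" "\<And>f. 0 \<le> g' f" "\<tau> > 0"
    and "\<And>f. g' f \<noteq> 0 \<Longrightarrow> card f = s"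
    and "\<And>U. U \<noteq> {} \<Longrightarrow> U \<subseteq> V \<Longrightarrow> \<tau> * wdeg V g U \<le> \<theta> U"
  shows "\<tau> * (wdeg V g {} - wdeg V (good_part V g \<theta> g') {}) \<le> 2 ^ s * wdeg V g' {}"
proof -
  define \<Gamma> where "\<Gamma> = {U. U \<noteq> {} \<and> U \<subseteq> V \<and> \<theta> U \<le> wdeg V g' U}"
  have fin\<Gamma>: "finite \<Gamma>" using assms(1) by (auto simp: \<Gamma>_def)
  have fin: "finite {f. f \<subseteq> V}" using assms(1) by simp
  have "wdeg V g {} - wdeg V (good_part V g \<theta> g') {} = (\<Sum>f | f \<subseteq> V. g f - good_part V g \<theta> g' f)"
    by (simp add: wdeg_def sum_subtractf)
  also have "\<dots> \<le> (\<Sum>f | f \<subseteq> V. \<Sum>U | U \<in> \<Gamma> \<and> U \<subseteq> f. g f)"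
  proof (rule sum_mono)
    fix f assume f: "f \<in> {f. f \<subseteq> V}"
    show "g f - good_part V g \<theta> g' f \<le> (\<Sum>U | U \<in> \<Gamma> \<and> U \<subseteq> f. g f)"
    proof (cases "\<forall>U. U \<noteq> {} \<and> U \<subseteq> f \<longrightarrow> wdeg V g' U < \<theta> U")
      case True
      have "0 \<le> (\<Sum>U | U \<in> \<Gamma> \<and> U \<subseteq> f. g f)" by (intro sum_nonneg assms(2))
      moreover have "good_part V g \<theta> g' f = g f" using True unfolding good_part_def by simp
      ultimately show ?thesis by simp
    next
      case False
      then obtain U where U: "U \<noteq> {}" "U \<subseteq> f" "\<not> wdeg V g' U < \<theta> U" by blast
      then have "U \<in> {U. U \<in> \<Gamma> \<and> U \<subseteq> f}" using f by (auto simp: \<Gamma>_def)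
      then have "g f \<le> (\<Sum>U | U \<in> \<Gamma> \<and> U \<subseteq> f. g f)"
        using fin\<Gamma> assms(2) by (intro member_le_sum) auto
      moreover have "good_part V g \<theta> g' f = 0" using False unfolding good_part_def by argo
      ultimately show ?thesis by simp
    qed
  qed
  also have "\<dots> = (\<Sum>U\<in>\<Gamma>. \<Sum>f | f \<in> {f. f \<subseteq> V} \<and> U \<subseteq> f. g f)"
    using fin fin\<Gamma> by (rule sum.swap_restrict)
  also have "\<dots> = (\<Sum>U\<in>\<Gamma>. wdeg V g U)" by (simp add: wdeg_def)
  finally have "\<tau> * (wdeg V g {} - wdeg V (good_part V g \<theta> g') {}) \<le> \<tau> * (\<Sum>U\<in>\<Gamma>. wdeg V g U)"
    using assms(4) by (intro mult_left_mono) auto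
  also have "\<dots> \<le> (\<Sum>U\<in>\<Gamma>. wdeg V g' U)"
    unfolding sum_distrib_left
  proof (rule sum_mono)
    fix U assume "U \<in> \<Gamma>"
    then show "\<tau> * wdeg V g U \<le> wdeg V g' U" using assms(6)[of U] by (auto simp: \<Gamma>_def)
  qed
  also have "\<dots> \<le> (\<Sum>U\<in>Pow V. wdeg V g' U)"
    using assms(1,3) by (intro sum_mono2 wdeg_nonneg) (auto simp: \<Gamma>_def)
  also have "\<dots> = (\<Sum>U\<in>Pow V. \<Sum>f | f \<in> {f. f \<subseteq> V} \<and> U \<subseteq> f. g' f)" by (simp add: wdeg_def)
  also have "\<dots> = (\<Sum>f | f \<subseteq> V. \<Sum>U | U \<in> Pow V \<and> U \<subseteq> f. g' f)"
    using assms(1) fin by (intro sum.swap_restrict) auto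
  also have "\<dots> = (\<Sum>f | f \<subseteq> V. 2 ^ s * g' f)"
  proof (rule sum.cong)
    fix f assume f: "f \<in> {f. f \<subseteq> V}"
    have "{U. U \<in> Pow V \<and> U \<subseteq> f} = Pow f" using f by auto
    moreover have "finite f" using f assms(1) finite_subset by auto
    ultimately show "(\<Sum>U | U \<in> Pow V \<and> U \<subseteq> f. g' f) = 2 ^ s * g' f"
      using assms(5)[of f] by (cases "g' f = 0") (auto simp: card_Pow)
  qed simp
  also have "\<dots> = 2 ^ s * wdeg V g' {}" by (simp add: wdeg_def sum_distrib_left)
  finally show ?thesis .
qed

text \<open>If the new multiset is light, then by \<open>saturated_weight_le\<close> at least half of \<open>g\<close> is good. The
  sum of the good degrees over all vertices is then at least twice the good weight, because the sets have
  at least two elements. The selected vertices account for at most the weight of the light multiset and the vertices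
  with light links for at most \<open>h\<close> each, so the excluded vertices must carry the remainder.\<close>

lemma run_dichotomy:
  assumes r: "run V g \<theta> h I vs (\<lambda>_. 0) = (g'', T, X)" and vs: "distinct vs" "set vs = V"
    and V: "finite V" and g0: "\<And>f. 0 \<le> g f" and \<tau>: "0 < \<tau>" "\<tau> \<le> 1"
    and supp: "\<And>f. g f \<noteq> 0 \<Longrightarrow> card f = Suc s" "s \<ge> 1"
    and \<theta>: "\<And>U. U \<noteq> {} \<Longrightarrow> U \<subseteq> V \<Longrightarrow> \<tau> * wdeg V g U \<le> \<theta> U"
    and h: "h * real (card V) \<le> wdeg V g {} / 4" "0 \<le> h"
    and light: "wdeg V g'' {} \<le> \<tau> * wdeg V g {} / 2 ^ Suc s"
  shows "wdeg V g {} / 2 \<le> (\<Sum>v\<in>X. wdeg V g {v})"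
proof -
  let ?G = "wdeg V g {}"
  let ?gd = "good_part V g \<theta> g''"
  let ?D = "\<lambda>v. wdeg V ?gd {v}"
  have G0: "0 \<le> ?G" using g0 by (intro wdeg_nonneg)
  have g''0: "0 \<le> g'' f" for f using run_increasing[OF r g0, of f] by simp
  have supp'': "card f = s" if f: "g'' f \<noteq> 0" for f
  proof -
    obtain v where v: "v \<notin> f" "g (insert v f) \<noteq> 0" using run_support[OF r f] by auto
    then have c: "card (insert v f) = Suc s" using supp(1) by simp
    then have "finite (insert v f)" by (metis card.infinite nat.distinct(1))
    then show ?thesis using c v(1) by simp
  qed
  have gd_le: "?gd f \<le> g f" "0 \<le> ?gd f" for f using g0 by (auto simp: good_part_def)
  have "\<tau> * (?G - wdeg V ?gd {}) \<le> 2 ^ s * wdeg V g'' {}"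
    using V g0 g''0 \<tau> supp'' \<theta> by (intro saturated_weight_le) auto
  also have "\<dots> \<le> 2 ^ s * (\<tau> * ?G / 2 ^ Suc s)" using light by (intro mult_left_mono) auto
  also have "\<dots> = \<tau> * (?G / 2)" by simp
  finally have gd: "?G / 2 \<le> wdeg V ?gd {}" using \<tau> by simp
  have T: "T \<subseteq> V" "X \<subseteq> V" "finite T" "finite X" "T \<inter> X = {}"
    using run_sets[OF r] vs V finite_subset[OF _ V] by auto
  have "real (Suc s) * wdeg V ?gd {} = (\<Sum>v\<in>V. ?D v)"
    using V supp(1) by (intro sum_wdeg_vertices[symmetric]) (auto simp: good_part_def split: if_splits)
  also have "\<dots> = (\<Sum>v\<in>T. ?D v) + (\<Sum>v\<in>X. ?D v) + (\<Sum>v\<in>V - T - X. ?D v)"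
  proof -
    have "V = T \<union> X \<union> (V - T - X)" using T by auto
    then have "(\<Sum>v\<in>V. ?D v) = (\<Sum>v\<in>T \<union> X \<union> (V - T - X). ?D v)" by simp
    also have "\<dots> = (\<Sum>v\<in>T \<union> X. ?D v) + (\<Sum>v\<in>V - T - X. ?D v)"
      using T V by (intro sum.union_disjoint) auto
    also have "(\<Sum>v\<in>T \<union> X. ?D v) = (\<Sum>v\<in>T. ?D v) + (\<Sum>v\<in>X. ?D v)"
      using T by (intro sum.union_disjoint) auto
    finally show ?thesis .
  qed
  also have "(\<Sum>v\<in>T. ?D v) \<le> ?G / 4"
  proof -
    have "(\<Sum>v\<in>T. ?D v) \<le> wdeg V g'' {}"
      using run_accounting(1)[OF r vs(1) _ V g0] vs(2) by (simp add: wdeg_def)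
    also have "\<dots> \<le> \<tau> * ?G / 2 ^ Suc s" by (rule light)
    also have "\<dots> \<le> ?G / 4"
    proof -
      have "(2::real) ^ 2 \<le> 2 ^ Suc s" using supp(2) by (intro power_increasing) auto
      then show ?thesis using \<tau> G0 by (intro frac_le) (auto simp: mult_left_le_one_le)
    qed
    finally show ?thesis .
  qed
  also have "(\<Sum>v\<in>V - T - X. ?D v) \<le> ?G / 4"
  proof -
    have "(\<Sum>v\<in>V - T - X. ?D v) \<le> (\<Sum>v\<in>V - T - X. h)"
      using run_accounting(3)[OF r vs(1) _ V g0] vs(2) by (intro sum_mono) auto
    also have "\<dots> = h * real (card (V - T - X))" by simp
    also have "\<dots> \<le> h * real (card V)" using V h(2) by (intro mult_left_mono) (auto intro: card_mono)
    finally show ?thesis using h(1) by simp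
  qed
  finally have "real (Suc s) * wdeg V ?gd {} \<le> ?G / 2 + (\<Sum>v\<in>X. ?D v)" by simp
  moreover have "2 * (?G / 2) \<le> real (Suc s) * wdeg V ?gd {}"
    using supp(2) gd G0 by (intro mult_mono) auto
  moreover have "(\<Sum>v\<in>X. ?D v) \<le> (\<Sum>v\<in>X. wdeg V g {v})"
    using gd_le by (intro sum_mono wdeg_mono) auto
  ultimately show ?thesis by simp
qed

section \<open>Containers: the cascade of levels\<close>

text \<open>The maximal degree of an \<open>l\<close>-element extension of \<open>U\<close>. The value \<open>0\<close> is inserted so that the
  maximum makes sense when there is no such extension.\<close>

definition codegree :: "'a set \<Rightarrow> 'a set set \<Rightarrow> nat \<Rightarrow> 'a set \<Rightarrow> nat" where
  "codegree V E l U =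
     Max (insert 0 ((\<lambda>W. card {e \<in> E. W \<subseteq> e}) ` {W. U \<subseteq> W \<and> W \<subseteq> V \<and> card W = card U + l}))"

text \<open>The recursion solved by the degree bounds of the cascade. Passing to the next level multiplies
  the cap of \<open>U\<close> by \<open>\<tau>\<close> (the threshold) and adds the cap of a one-point extension (the
  overshoot); with \<open>m l\<close> bounding the degrees of the \<open>l\<close>-point extensions this is
  \<open>\<Sum>l\<le>i. (i choose l) * \<tau> ^ (i - l) * m l\<close>.\<close>

primrec iter_cap :: "real \<Rightarrow> nat \<Rightarrow> (nat \<Rightarrow> real) \<Rightarrow> real" where
  "iter_cap \<tau> 0 m = m 0"
| "iter_cap \<tau> (Suc i) m = \<tau> * iter_cap \<tau> i m + iter_cap \<tau> i (\<lambda>l. m (Suc l))"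

lemma iter_cap_nonneg: "0 \<le> \<tau> \<Longrightarrow> (\<And>l. 0 \<le> m l) \<Longrightarrow> 0 \<le> iter_cap \<tau> i m"
  by (induction i arbitrary: m) auto

lemma iter_cap_mono: "0 \<le> \<tau> \<Longrightarrow> (\<And>l. m l \<le> m' l) \<Longrightarrow> iter_cap \<tau> i m \<le> iter_cap \<tau> i m'"
  by (induction i arbitrary: m m') (auto intro!: add_mono mult_left_mono)

lemma iter_cap_sum: "(\<Sum>v\<in>X. iter_cap \<tau> i (m v)) = iter_cap \<tau> i (\<lambda>l. \<Sum>v\<in>X. m v l)"
  by (induction i arbitrary: m) (auto simp: sum.distrib sum_distrib_left[symmetric])

lemma iter_cap_le_power:
  assumes "0 \<le> \<tau>" "\<And>l. l \<le> i \<Longrightarrow> m l \<le> a * \<tau> ^ l"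
  shows "iter_cap \<tau> i m \<le> 2 ^ i * a * \<tau> ^ i"
  using assms(2)
proof (induction i arbitrary: m a)
  case (Suc i)
  have "iter_cap \<tau> i m \<le> 2 ^ i * a * \<tau> ^ i" using Suc by auto
  moreover have "iter_cap \<tau> i (\<lambda>l. m (Suc l)) \<le> 2 ^ i * (a * \<tau>) * \<tau> ^ i"
    using Suc.prems[of "Suc l" for l] by (intro Suc.IH) (auto simp: algebra_simps)
  ultimately have "\<tau> * iter_cap \<tau> i m + iter_cap \<tau> i (\<lambda>l. m (Suc l))
      \<le> \<tau> * (2 ^ i * a * \<tau> ^ i) + 2 ^ i * (a * \<tau>) * \<tau> ^ i"
    using assms(1) by (intro add_mono mult_left_mono) auto
  then show ?case by (simp add: algebra_simps)
qed auto

text \<open>The values \<open>m l\<close> with \<open>l \<ge> 1\<close> are co-degrees and are small after scaling by \<open>\<tau> ^ l\<close>, so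
  the leading behaviour is \<open>\<tau> ^ i * m 0\<close>.\<close>

lemma iter_cap_le:
  assumes "0 \<le> \<tau>" "m 0 \<le> x" "\<And>l. 1 \<le> l \<Longrightarrow> l \<le> i \<Longrightarrow> m l \<le> b * \<tau> ^ l" "0 \<le> b"
  shows "iter_cap \<tau> i m \<le> \<tau> ^ i * (x + 2 ^ i * b)"
  using assms(2,3)
proof (induction i arbitrary: m)
  case (Suc i)
  have "iter_cap \<tau> i m \<le> \<tau> ^ i * (x + 2 ^ i * b)" using Suc by auto
  moreover have "iter_cap \<tau> i (\<lambda>l. m (Suc l)) \<le> 2 ^ i * (b * \<tau>) * \<tau> ^ i"
    using Suc.prems(2)[of "Suc l" for l] assms(1) by (intro iter_cap_le_power) (auto simp: algebra_simps)
  ultimately have "\<tau> * iter_cap \<tau> i m + iter_cap \<tau> i (\<lambda>l. m (Suc l))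
      \<le> \<tau> * (\<tau> ^ i * (x + 2 ^ i * b)) + 2 ^ i * (b * \<tau>) * \<tau> ^ i"
    using assms(1) by (intro add_mono mult_left_mono) auto
  then show ?case by (simp add: algebra_simps)
qed (use assms in auto)

lemma codegree_ge:
  assumes "finite V" "U \<subseteq> W" "W \<subseteq> V" "card W = card U + l"
  shows "card {e \<in> E. W \<subseteq> e} \<le> codegree V E l U"
  unfolding codegree_def using assms by (intro Max_ge) auto

lemma codegree_insert:
  assumes "finite V" "U \<subseteq> V" "v \<in> V - U"
  shows "codegree V E l (insert v U) \<le> codegree V E (Suc l) U"
proof -
  have "finite U" using assms finite_subset by auto
  then have "{W. insert v U \<subseteq> W \<and> W \<subseteq> V \<and> card W = card (insert v U) + l}
      \<subseteq> {W. U \<subseteq> W \<and> W \<subseteq> V \<and> card W = card U + Suc l}" using assms by auto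
  then show ?thesis unfolding codegree_def using assms by (intro Max_mono) auto
qed

lemma codegree_0_vertex:
  assumes "finite V" "v \<in> V"
  shows "codegree V E 0 {v} = card {e \<in> E. v \<in> e}"
proof -
  have "{W. {v} \<subseteq> W \<and> W \<subseteq> V \<and> card W = card {v} + 0} = {{v}}"
    using assms by (auto simp: card_1_singleton_iff)
  then show ?thesis by (simp add: codegree_def)
qed

lemma codegree_mono:
  assumes "finite V" "E' \<subseteq> E" "finite E"
  shows "codegree V E' l U \<le> codegree V E l U"
proof -
  let ?W = "{W. U \<subseteq> W \<and> W \<subseteq> V \<and> card W = card U + l}"
  have fin: "finite ?W" using assms by auto
  have "x \<le> codegree V E l U" if x: "x \<in> insert 0 ((\<lambda>W. card {e \<in> E'. W \<subseteq> e}) ` ?W)" for x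
  proof (cases "x = 0")
    case False
    then obtain W where W: "W \<in> ?W" "x = card {e \<in> E'. W \<subseteq> e}" using x by auto
    have "x \<le> card {e \<in> E. W \<subseteq> e}" unfolding W(2) using assms by (intro card_mono) auto
    also have "\<dots> \<le> codegree V E l U" using W assms(1) by (intro codegree_ge) auto
    finally show ?thesis .
  qed simp
  then show ?thesis
    unfolding codegree_def[of V E'] using fin by (subst Max_le_iff) auto
qed

lemma sum_card_incidences:
  assumes "finite X" "finite E"
  shows "(\<Sum>v\<in>X. card {e \<in> E. v \<in> e}) = (\<Sum>e\<in>E. card (e \<inter> X))"
proof -
  have "(\<Sum>v\<in>X. card {e \<in> E. v \<in> e}) = (\<Sum>v\<in>X. \<Sum>e | e \<in> E \<and> v \<in> e. 1)" by simp
  also have "\<dots> = (\<Sum>e\<in>E. \<Sum>v | v \<in> X \<and> v \<in> e. 1)" using assms by (rule sum.swap_restrict)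
  also have "\<dots> = (\<Sum>e\<in>E. card (e \<inter> X))"
    by (intro sum.cong refl) (simp add: Collect_conj_eq Int_commute)
  finally show ?thesis .
qed

text \<open>The map \<open>container\<close> reconstructs, from at most \<open>b\<close> vertices of an independent set \<open>I\<close> with labels
  below \<open>L\<close>, a superset of \<open>I\<close> that spans at most \<open>m\<close> edges.\<close>

definition container_map :: "'a set \<Rightarrow> 'a set set \<Rightarrow> nat \<Rightarrow> real \<Rightarrow> real \<Rightarrow> ((nat \<times> 'a) set \<Rightarrow> 'a set) \<Rightarrow> bool" where
  "container_map V E L b m container \<longleftrightarrow> (\<forall>I. I \<subseteq> V \<and> (\<forall>e\<in>E. \<not> e \<subseteq> I) \<longrightarrow>
     (\<exists>\<Phi>. \<Phi> \<subseteq> {..<L} \<times> I \<and> real (card \<Phi>) \<le> b \<and> I \<subseteq> container \<Phi> \<and>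
       real (card {e \<in> E. e \<subseteq> container \<Phi>}) \<le> m))"

lemma container_mapE:
  assumes "container_map V E L b m container" "I \<subseteq> V" "\<forall>e\<in>E. \<not> e \<subseteq> I"
  obtains \<Phi> where "\<Phi> \<subseteq> {..<L} \<times> I" "real (card \<Phi>) \<le> b" "I \<subseteq> container \<Phi>"
    "real (card {e \<in> E. e \<subseteq> container \<Phi>}) \<le> m"
  using assms(1)[unfolded container_map_def, rule_format, OF conjI[OF assms(2,3)]]
  by (elim exE conjE) (rule that)

text \<open>On every level the co-degrees add an error of at most \<open>card E / 2 ^ (k\<^sup>2 + 2)\<close>, relative to
  \<open>\<tau> ^ i\<close>, to the degrees. The constant is chosen such that this is half of the weight
  \<open>card E / (2 * 2 ^ k\<^sup>2)\<close> that the cascade detects.\<close>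

locale container_cascade =
  fixes V :: "'a set" and E :: "'a set set" and k :: nat and \<tau> :: real and vs :: "'a list"
  assumes finV: "finite V" and uniform: "\<And>e. e \<in> E \<Longrightarrow> e \<subseteq> V \<and> card e = k" and k2: "k \<ge> 2"
    and \<tau>0: "0 < \<tau>" and \<tau>1: "\<tau> \<le> 1" and vs: "set vs = V" "distinct vs" and E_ne: "E \<noteq> {}"
    and codeg: "\<And>l. 1 \<le> l \<Longrightarrow> l < k \<Longrightarrow>
      (\<Sum>v\<in>V. real (codegree V E l {v})) \<le> 1 / 2 ^ (k\<^sup>2 + k + 2) * \<tau> ^ l * real (card E)"
begin

definition cap :: "nat \<Rightarrow> 'a set \<Rightarrow> real" where
  "cap i U = iter_cap \<tau> i (\<lambda>l. real (codegree V E l U))"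

text \<open>A \<open>1 / (4 * card V)\<close> fraction of the lower bound \<open>card E * \<tau> ^ i / 2 ^ (k * i)\<close> for the weight of a
  heavy level \<open>i\<close>, so that all light links together account for at most a quarter of the weight.\<close>

definition threshold :: "nat \<Rightarrow> real" where
  "threshold i = 1 / 2 ^ (k * i) * \<tau> ^ i * real (card E) / (4 * real (card V))"

text \<open>The set \<open>J i\<close> answers the membership queries on level \<open>i\<close>. For an independent set \<open>I\<close> all of them are
  answered by \<open>I\<close>; when the run is replayed, level \<open>i\<close> only knows the vertices with label \<open>i\<close>.\<close>

primrec level :: "(nat \<Rightarrow> 'a set) \<Rightarrow> nat \<Rightarrow> 'a set \<Rightarrow> real" where
  "level J 0 = (\<lambda>f. of_bool (f \<in> E))"
| "level J (Suc i) = fst (run V (level J i) (\<lambda>U. \<tau> * cap i U) (threshold i) (J i) vs (\<lambda>_. 0))"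

definition level_run :: "(nat \<Rightarrow> 'a set) \<Rightarrow> nat \<Rightarrow> ('a set \<Rightarrow> real) \<times> 'a set \<times> 'a set" where
  "level_run J i = run V (level J i) (\<lambda>U. \<tau> * cap i U) (threshold i) (J i) vs (\<lambda>_. 0)"

definition selected :: "(nat \<Rightarrow> 'a set) \<Rightarrow> nat \<Rightarrow> 'a set" where
  "selected J i = fst (snd (level_run J i))"

definition excluded :: "(nat \<Rightarrow> 'a set) \<Rightarrow> nat \<Rightarrow> 'a set" where
  "excluded J i = snd (snd (level_run J i))"

lemma run_level:
  "run V (level J i) (\<lambda>U. \<tau> * cap i U) (threshold i) (J i) vs (\<lambda>_. 0)
    = (level J (Suc i), selected J i, excluded J i)"
  by (simp add: selected_def excluded_def level_run_def)

lemma finE: "finite E"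
  using uniform finV by (intro finite_subset[of E "Pow V"]) auto

lemma card_E_pos: "card E > 0"
  using finE E_ne by (simp add: card_gt_0_iff)

lemma card_V_pos: "card V > 0"
proof -
  obtain e where "e \<in> E" using E_ne by auto
  then have "e \<subseteq> V" "e \<noteq> {}" using uniform k2 by force+
  then show ?thesis using finV by (auto simp: card_gt_0_iff)
qed

lemma threshold_nonneg: "0 \<le> threshold i"
  using \<tau>0 by (simp add: threshold_def)

lemma level_nonneg: "0 \<le> level J i f"
proof (induction i arbitrary: f)
  case (Suc i)
  show ?case using run_increasing[OF run_level Suc] .
qed simp

lemma level_card:
  assumes "level J i f \<noteq> 0" "i \<le> k"
  shows "card f = k - i"
  using assms
proof (induction i arbitrary: f)
  case 0
  then show ?case using uniform by (auto split: if_splits)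
next
  case (Suc i)
  obtain v where v: "v \<notin> f" "level J i (insert v f) \<noteq> 0"
    using run_support[OF run_level Suc.prems(1)] by auto
  then have c: "card (insert v f) = k - i" using Suc by auto
  then have "finite (insert v f)" using Suc.prems by (intro card_ge_0_finite) auto
  then show ?case using c v by auto
qed

text \<open>Passing to a link removes one selected vertex, and all of these lie in \<open>I\<close>.\<close>

lemma level_edge:
  assumes "level (\<lambda>_. I) i f \<noteq> 0"
  shows "\<exists>e\<in>E. f \<subseteq> e \<and> e - f \<subseteq> I"
  using assms
proof (induction i arbitrary: f)
  case 0
  then show ?case by (intro bexI[of _ f]) (auto split: if_splits)
next
  case (Suc i)
  obtain v where v: "v \<in> I" "v \<notin> f" "level (\<lambda>_. I) i (insert v f) \<noteq> 0"
    using run_support[OF run_level Suc.prems] by auto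
  then obtain e where "e \<in> E" "insert v f \<subseteq> e" "e - insert v f \<subseteq> I" using Suc.IH by blast
  then show ?case using v by (intro bexI[of _ e]) auto
qed

lemma cap_nonneg: "0 \<le> cap i U"
  unfolding cap_def using \<tau>0 by (intro iter_cap_nonneg) auto

lemma wdeg_level_le_cap:
  assumes "U \<noteq> {}" "U \<subseteq> V"
  shows "wdeg V (level J i) U \<le> cap i U"
  using assms
proof (induction i arbitrary: U)
  case 0
  have "wdeg V (level J 0) U = real (card {f. f \<subseteq> V \<and> U \<subseteq> f \<and> f \<in> E})"
    using finV by (simp add: wdeg_def sum.If_cases of_bool_def Collect_conj_eq Int_ac)
  also have "{f. f \<subseteq> V \<and> U \<subseteq> f \<and> f \<in> E} = {e \<in> E. U \<subseteq> e}" using uniform by auto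
  also have "real (card {e \<in> E. U \<subseteq> e}) \<le> real (codegree V E 0 U)"
    using 0 finV by (intro of_nat_mono codegree_ge) auto
  finally show ?case by (simp add: cap_def)
next
  case (Suc i)
  have ins: "cap i (insert v U) \<le> iter_cap \<tau> i (\<lambda>l. real (codegree V E (Suc l) U))" if "v \<in> V - U" for v
    unfolding cap_def using finV Suc.prems that \<tau>0 by (intro iter_cap_mono of_nat_mono codegree_insert) auto
  have nn: "0 \<le> iter_cap \<tau> i (\<lambda>l. real (codegree V E (Suc l) U))"
    using \<tau>0 by (intro iter_cap_nonneg) auto
  have eq: "cap (Suc i) U = \<tau> * cap i U + iter_cap \<tau> i (\<lambda>l. real (codegree V E (Suc l) U))"
    by (simp add: cap_def)
  show ?case
  proof (rule run_cap[OF run_level _ finV level_nonneg])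
    fix v assume v: "v \<in> V - U"
    have "wdeg V (level J i) (insert v U) \<le> cap i (insert v U)"
      using v Suc by (intro Suc.IH) auto
    then show "\<tau> * cap i U + wdeg V (level J i) (insert v U) \<le> cap (Suc i) U"
      using ins[OF v] eq by linarith
  qed (use vs Suc.prems eq nn \<tau>0 cap_nonneg[of i U] in auto)
qed

text \<open>The degrees on level \<open>i\<close> are, up to a small error summed over all vertices, at most
  \<open>\<tau> ^ i\<close> times the degrees in the original hypergraph. This turns weight on level \<open>i\<close> into
  degrees and is where the averaged co-degree condition enters.\<close>

lemma sum_wdeg_level_le:
  assumes "X \<subseteq> V" "i < k"
  shows "(\<Sum>v\<in>X. wdeg V (level J i) {v}) \<le>
    \<tau> ^ i * (real (\<Sum>v\<in>X. card {e \<in> E. v \<in> e}) + real (card E) / 2 ^ (k\<^sup>2 + 2))"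
proof -
  let ?b = "1 / 2 ^ (k\<^sup>2 + k + 2) * real (card E)"
  have "(\<Sum>v\<in>X. wdeg V (level J i) {v}) \<le> (\<Sum>v\<in>X. cap i {v})"
    using assms by (intro sum_mono wdeg_level_le_cap) auto
  also have "\<dots> = iter_cap \<tau> i (\<lambda>l. \<Sum>v\<in>X. real (codegree V E l {v}))"
    unfolding cap_def by (rule iter_cap_sum)
  also have "\<dots> \<le> \<tau> ^ i * (real (\<Sum>v\<in>X. card {e \<in> E. v \<in> e}) + 2 ^ i * ?b)"
  proof (rule iter_cap_le)
    show "(\<Sum>v\<in>X. real (codegree V E 0 {v})) \<le> real (\<Sum>v\<in>X. card {e \<in> E. v \<in> e})"
      unfolding of_nat_sum using assms finV by (intro sum_mono) (auto simp: codegree_0_vertex)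
    fix l assume l: "1 \<le> l" "l \<le> i"
    have "(\<Sum>v\<in>X. real (codegree V E l {v})) \<le> (\<Sum>v\<in>V. real (codegree V E l {v}))"
      using assms finV by (intro sum_mono2) auto
    also have "\<dots> \<le> ?b * \<tau> ^ l" using codeg[of l] l assms by (simp add: mult_ac)
    finally show "(\<Sum>v\<in>X. real (codegree V E l {v})) \<le> ?b * \<tau> ^ l" .
  qed (use \<tau>0 in auto)
  also have "2 ^ i * ?b \<le> 2 ^ k * ?b" using assms by (intro mult_right_mono power_increasing) auto
  also have "2 ^ k * ?b = real (card E) / 2 ^ (k\<^sup>2 + 2)" by (simp add: power_add)
  finally show ?thesis using \<tau>0 by (simp add: mult_left_mono)
qed

lemma sum_degrees: "(\<Sum>v\<in>V. card {e \<in> E. v \<in> e}) = k * card E"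
proof -
  have "(\<Sum>v\<in>V. card {e \<in> E. v \<in> e}) = (\<Sum>e\<in>E. card (e \<inter> V))"
    using finV finE by (rule sum_card_incidences)
  also have "\<dots> = (\<Sum>e\<in>E. k)" using uniform by (intro sum.cong) (auto simp: Int_absorb2)
  finally show ?thesis by (simp add: mult.commute)
qed

lemma level_total_le:
  assumes "i < k"
  shows "wdeg V (level J i) {} \<le> \<tau> ^ i * real (k + 1) * real (card E)"
proof -
  have "1 * wdeg V (level J i) {} \<le> real (k - i) * wdeg V (level J i) {}"
    using assms level_nonneg by (intro mult_right_mono wdeg_nonneg) auto
  also have "\<dots> = (\<Sum>v\<in>V. wdeg V (level J i) {v})"
    using finV level_card assms by (intro sum_wdeg_vertices[symmetric]) auto
  also have "\<dots> \<le> \<tau> ^ i * (real (k * card E) + real (card E) / 2 ^ (k\<^sup>2 + 2))"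
    using sum_wdeg_level_le[OF order_refl assms, of J] by (simp add: sum_degrees)
  also have "\<dots> \<le> \<tau> ^ i * (real (k * card E) + real (card E) / 1)"
  proof -
    have "(1::real) \<le> 2 ^ (k\<^sup>2 + 2)" by (rule one_le_power) simp
    then show ?thesis using \<tau>0 by (intro mult_left_mono add_mono divide_left_mono) auto
  qed
  finally show ?thesis by (simp add: algebra_simps)
qed

text \<open>Every selected vertex contributes at least the threshold to the next level, whose total
  weight is bounded.\<close>

lemma selected_card_le:
  assumes "Suc i < k"
  shows "real (card (selected J i)) \<le> 4 * real (k + 1) * 2 ^ k\<^sup>2 * \<tau> * real (card V)"
proof -
  have "threshold i * real (card (selected J i)) + wdeg V (\<lambda>_. 0) {} \<le> wdeg V (level J (Suc i)) {}"
    using finV level_nonneg vs by (intro run_accounting(2)[OF run_level]) auto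
  also have "\<dots> \<le> \<tau> ^ Suc i * real (k + 1) * real (card E)" by (rule level_total_le[OF assms])
  finally have "threshold i * real (card (selected J i)) \<le> \<tau> ^ Suc i * real (k + 1) * real (card E)"
    by (simp add: wdeg_def)
  then have "real (card (selected J i)) * (\<tau> ^ i * real (card E))
     \<le> (4 * real (k + 1) * 2 ^ (k * i) * \<tau> * real (card V)) * (\<tau> ^ i * real (card E))"
    using card_V_pos by (simp add: threshold_def field_simps)
  then have "real (card (selected J i)) \<le> 4 * real (k + 1) * 2 ^ (k * i) * \<tau> * real (card V)"
    using \<tau>0 card_E_pos by (subst (asm) mult_le_cancel_right) auto
  also have "\<dots> \<le> 4 * real (k + 1) * 2 ^ k\<^sup>2 * \<tau> * real (card V)"
    using \<tau>0 assms
    by (intro mult_right_mono mult_left_mono power_increasing) (auto simp: power2_eq_square)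
  finally show ?thesis .
qed

text \<open>Induction with \<open>run_dichotomy\<close>: weight is lost by at most a factor \<open>\<tau> / 2 ^ k\<close> per level,
  until a level where the excluded vertices carry half of it.\<close>

lemma level_heavy_or_excluded:
  assumes "m < k"
  shows "real (card E) * \<tau> ^ m / 2 ^ (k * m) \<le> wdeg V (level J m) {} \<or>
    (\<exists>i<m. real (card E) * \<tau> ^ i / 2 ^ (k * i) / 2 \<le> (\<Sum>v\<in>excluded J i. wdeg V (level J i) {v}))"
  using assms
proof (induction m)
  case 0
  have "wdeg V (level J 0) {} = real (card {f. f \<subseteq> V \<and> f \<in> E})"
    using finV by (simp add: wdeg_def sum.If_cases of_bool_def Collect_conj_eq Int_ac)
  also have "{f. f \<subseteq> V \<and> f \<in> E} = E" using uniform by auto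
  finally show ?case by simp
next
  case (Suc m)
  let ?b = "\<lambda>m. real (card E) * \<tau> ^ m / 2 ^ (k * m)"
  show ?case
  proof (cases "?b m \<le> wdeg V (level J m) {}")
    case False
    then have "\<exists>i<m. real (card E) * \<tau> ^ i / 2 ^ (k * i) / 2 \<le> (\<Sum>v\<in>excluded J i. wdeg V (level J i) {v})"
      using Suc by auto
    then show ?thesis using less_Suc_eq by blast
  next
    case heavy: True
    define s where "s = k - Suc m"
    have s: "Suc s = k - m" "1 \<le> s" using Suc.prems by (auto simp: s_def)
    show ?thesis
    proof (cases "wdeg V (level J (Suc m)) {} \<le> \<tau> * wdeg V (level J m) {} / 2 ^ Suc s")
      case True
      have "wdeg V (level J m) {} / 2 \<le> (\<Sum>v\<in>excluded J m. wdeg V (level J m) {v})"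
      proof (rule run_dichotomy[OF run_level vs(2,1) finV level_nonneg \<tau>0 \<tau>1 _ s(2) _ _ threshold_nonneg True])
        show "threshold m * real (card V) \<le> wdeg V (level J m) {} / 4"
          using heavy card_V_pos by (simp add: threshold_def field_simps)
        show "card f = Suc s" if "level J m f \<noteq> 0" for f
          using level_card[OF that] Suc.prems s by simp
        show "\<tau> * wdeg V (level J m) U \<le> \<tau> * cap m U" if "U \<noteq> {}" "U \<subseteq> V" for U
          using wdeg_level_le_cap[OF that] \<tau>0 by simp
      qed
      then have "?b m / 2 \<le> (\<Sum>v\<in>excluded J m. wdeg V (level J m) {v})"
        by (rule order_trans[OF divide_right_mono[OF heavy zero_le_numeral]])
      then show ?thesis by blast
    next
      case False
      have "?b (Suc m) = \<tau> * ?b m / 2 ^ k" by (simp add: power_add mult_ac)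
      also have "\<dots> \<le> \<tau> * ?b m / 2 ^ Suc s"
        using \<tau>0 s by (intro divide_left_mono power_increasing mult_nonneg_nonneg) auto
      also have "\<dots> \<le> \<tau> * wdeg V (level J m) {} / 2 ^ Suc s"
        using heavy \<tau>0 by (intro divide_right_mono mult_left_mono) auto
      finally show ?thesis using False by simp
    qed
  qed
qed

text \<open>On the last level the sets are singletons, so the vertices with positive multiplicity carry all
  of its weight; the other case is the level provided by \<open>level_heavy_or_excluded\<close>.\<close>

lemma excluded_degree:
  defines "X \<equiv> (\<lambda>J. (\<Union>i<k-1. excluded J i) \<union> {v \<in> V. level J (k - 1) {v} \<noteq> 0})"
  shows "real (card E) / (4 * 2 ^ k\<^sup>2) \<le> real (\<Sum>v\<in>X J. card {e \<in> E. v \<in> e})"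
proof -
  have XV: "X J \<subseteq> V"
    using run_sets(4)[OF run_level, of J] vs by (auto simp: X_def)
  have "\<exists>i Y. i < k \<and> Y \<subseteq> X J \<and> real (card E) * \<tau> ^ i / 2 ^ (k * i) / 2 \<le> (\<Sum>v\<in>Y. wdeg V (level J i) {v})"
  proof (cases "\<exists>i<k-1. real (card E) * \<tau> ^ i / 2 ^ (k * i) / 2 \<le> (\<Sum>v\<in>excluded J i. wdeg V (level J i) {v})")
    case True
    then obtain i where "i < k - 1" "real (card E) * \<tau> ^ i / 2 ^ (k * i) / 2 \<le> (\<Sum>v\<in>excluded J i. wdeg V (level J i) {v})"
      by blast
    then show ?thesis by (intro exI[of _ i] exI[of _ "excluded J i"]) (auto simp: X_def)
  next
    case False
    let ?Y = "{v \<in> V. level J (k - 1) {v} \<noteq> 0}"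
    let ?b = "real (card E) * \<tau> ^ (k - 1) / 2 ^ (k * (k - 1))"
    have "?b \<le> wdeg V (level J (k - 1)) {}"
      using level_heavy_or_excluded[of "k - 1" J] False k2 by auto
    also have "\<dots> = (\<Sum>v\<in>V. wdeg V (level J (k - 1)) {v})"
      using sum_wdeg_vertices[OF finV, of "level J (k - 1)" 1] level_card[of J "k - 1"] k2 by simp
    also have "\<dots> = (\<Sum>v\<in>?Y. wdeg V (level J (k - 1)) {v})"
    proof (rule sum.mono_neutral_right)
      show "\<forall>v\<in>V - ?Y. wdeg V (level J (k - 1)) {v} = 0"
      proof
        fix v assume v: "v \<in> V - ?Y"
        have "level J (k - 1) f = 0" if f: "v \<in> f" for f
        proof (rule ccontr)
          assume nz: "level J (k - 1) f \<noteq> 0"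
          then have "card f = 1" using level_card[OF nz] k2 by simp
          then have "f = {v}" using f by (auto simp: card_1_singleton_iff)
          then show False using nz v by simp
        qed
        then show "wdeg V (level J (k - 1)) {v} = 0" by (simp add: wdeg_def)
      qed
    qed (use finV in auto)
    finally have b: "?b \<le> (\<Sum>v\<in>?Y. wdeg V (level J (k - 1)) {v})" .
    have "?b \<ge> 0" using \<tau>0 by simp
    moreover have "x / 2 \<le> x" if "0 \<le> x" for x :: real using that by simp
    ultimately have "?b / 2 \<le> ?b" by blast
    then have "?b / 2 \<le> (\<Sum>v\<in>?Y. wdeg V (level J (k - 1)) {v})" using b by (rule order_trans)
    then show ?thesis using k2 by (intro exI[of _ "k - 1"] exI[of _ ?Y]) (auto simp: X_def)
  qed
  then obtain i Y where i: "i < k" and Y: "Y \<subseteq> X J"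
    and le: "real (card E) * \<tau> ^ i / 2 ^ (k * i) / 2 \<le> (\<Sum>v\<in>Y. wdeg V (level J i) {v})" by blast
  have finX: "finite (X J)" using XV finV finite_subset by auto
  have "\<tau> ^ i * (real (card E) / (2 * 2 ^ k\<^sup>2)) \<le> \<tau> ^ i * (real (card E) / (2 * 2 ^ (k * i)))"
    using \<tau>0 i by (intro mult_left_mono divide_left_mono power_increasing mult_pos_pos)
      (auto simp: power2_eq_square)
  also have "\<dots> = real (card E) * \<tau> ^ i / 2 ^ (k * i) / 2" by (simp add: mult_ac)
  also have "\<dots> \<le> (\<Sum>v\<in>Y. wdeg V (level J i) {v})" by (rule le)
  also have "\<dots> \<le> (\<Sum>v\<in>X J. wdeg V (level J i) {v})"
    using Y finX level_nonneg by (intro sum_mono2 wdeg_nonneg) auto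
  also have "\<dots> \<le> \<tau> ^ i * (real (\<Sum>v\<in>X J. card {e \<in> E. v \<in> e}) + real (card E) / 2 ^ (k\<^sup>2 + 2))"
    by (rule sum_wdeg_level_le[OF XV i])
  finally have "real (card E) / (2 * 2 ^ k\<^sup>2)
      \<le> real (\<Sum>v\<in>X J. card {e \<in> E. v \<in> e}) + real (card E) / 2 ^ (k\<^sup>2 + 2)"
    using \<tau>0 by (subst (asm) mult_le_cancel_left_pos) auto
  moreover have "real (card E) / (2 * 2 ^ k\<^sup>2) - real (card E) / 2 ^ (k\<^sup>2 + 2) = real (card E) / (4 * 2 ^ k\<^sup>2)"
    by (simp add: power_add field_simps)
  ultimately show ?thesis by linarith
qed

lemma level_simulate:
  assumes "\<And>i. i < m \<Longrightarrow> selected J i \<subseteq> J' i \<and> J' i \<subseteq> J i"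
  shows "level J' m = level J m"
    and "i < m \<Longrightarrow> selected J' i = selected J i" "i < m \<Longrightarrow> excluded J' i = excluded J i"
proof -
  have "level J' m = level J m \<and> (\<forall>i<m. selected J' i = selected J i \<and> excluded J' i = excluded J i)"
    using assms
  proof (induction m)
    case (Suc m)
    then have IH: "level J' m = level J m" "\<forall>i<m. selected J' i = selected J i \<and> excluded J' i = excluded J i"
      by auto
    have "run V (level J m) (\<lambda>U. \<tau> * cap m U) (threshold m) (J' m) vs (\<lambda>_. 0)
      = (level J (Suc m), selected J m, excluded J m)"
      using Suc.prems[of m] by (intro run_simulate[OF run_level]) auto
    then show ?case using IH run_level[of J' m] by (auto simp: less_Suc_eq)
  qed simp
  then show "level J' m = level J m"
    and "i < m \<Longrightarrow> selected J' i = selected J i" "i < m \<Longrightarrow> excluded J' i = excluded J i" by auto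
qed

text \<open>The fingerprint consists of the selected vertices labelled by their level. An excluded vertex is
  not in \<open>I\<close> by construction, and a singleton of the last level is not in \<open>I\<close> because together with
  selected vertices it would form an edge in \<open>I\<close>.\<close>

lemma single_container:
  "\<exists>cont. container_map V E k (4 * real k * real (k + 1) * 2 ^ k\<^sup>2 * \<tau> * real (card V))
     ((1 - 1 / (4 * real k * 2 ^ k\<^sup>2)) * real (card E)) cont"
proof -
  define X where "X = (\<lambda>J. (\<Union>i<k-1. excluded J i) \<union> {v \<in> V. level J (k - 1) {v} \<noteq> 0})"
  define J where "J = (\<lambda>\<Phi> (i::nat). {v. (i, v) \<in> \<Phi>} :: 'a set)"
  have "\<exists>\<Phi>. \<Phi> \<subseteq> {..<k} \<times> I \<and>
     real (card \<Phi>) \<le> 4 * real k * real (k + 1) * 2 ^ k\<^sup>2 * \<tau> * real (card V) \<and> I \<subseteq> V - X (J \<Phi>) \<and>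
     real (card {e \<in> E. e \<subseteq> V - X (J \<Phi>)}) \<le> (1 - 1 / (4 * real k * 2 ^ k\<^sup>2)) * real (card E)"
    if I: "I \<subseteq> V" "\<forall>e\<in>E. \<not> e \<subseteq> I" for I
  proof -
    let ?I = "\<lambda>_::nat. I"
    define \<Phi> where "\<Phi> = (SIGMA i:{..<k-1}. selected ?I i)"
    have sel: "selected ?I i \<subseteq> I" and exc: "excluded ?I i \<inter> I = {}" for i
      using run_sets[OF run_level, of ?I i] by auto
    have J\<Phi>: "J \<Phi> i = selected ?I i" if "i < k - 1" for i using that by (auto simp: J_def \<Phi>_def)
    have sim: "level (J \<Phi>) (k - 1) = level ?I (k - 1)"
      "i < k - 1 \<Longrightarrow> excluded (J \<Phi>) i = excluded ?I i" for i
      using level_simulate(1,3)[of "k - 1" ?I "J \<Phi>"] sel J\<Phi> by auto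
    have X: "X (J \<Phi>) = X ?I" unfolding X_def sim(1) using sim(2) by auto
    have sub: "\<Phi> \<subseteq> {..<k} \<times> I" using sel by (auto simp: \<Phi>_def)
    have fsel: "finite (selected ?I i)" for i
      using finite_subset[OF sel] finite_subset[OF I(1) finV] by blast
    have "real (card \<Phi>) = (\<Sum>i<k-1. real (card (selected ?I i)))"
      unfolding \<Phi>_def using fsel by (subst card_SigmaI) auto
    also have "\<dots> \<le> (\<Sum>i<k-1. 4 * real (k + 1) * 2 ^ k\<^sup>2 * \<tau> * real (card V))"
      using k2 by (intro sum_mono selected_card_le) auto
    also have "\<dots> = real (k - 1) * (4 * real (k + 1) * 2 ^ k\<^sup>2 * \<tau> * real (card V))" by simp
    also have "\<dots> \<le> real k * (4 * real (k + 1) * 2 ^ k\<^sup>2 * \<tau> * real (card V))"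
      using \<tau>0 by (intro mult_right_mono) auto
    finally have size: "real (card \<Phi>) \<le> 4 * real k * real (k + 1) * 2 ^ k\<^sup>2 * \<tau> * real (card V)"
      by (simp add: mult_ac)
    have "I \<inter> X ?I = {}"
    proof (rule ccontr)
      assume "I \<inter> X ?I \<noteq> {}"
      then obtain v where v: "v \<in> I" "level ?I (k - 1) {v} \<noteq> 0" using exc by (auto simp: X_def)
      then obtain e where "e \<in> E" "e - {v} \<subseteq> I" using level_edge by blast
      then show False using I(2) v(1) by blast
    qed
    then have IX: "I \<subseteq> V - X (J \<Phi>)" using I(1) X by auto
    let ?C = "{e \<in> E. e \<subseteq> V - X ?I}"
    have XV: "X ?I \<subseteq> V"
      using run_sets(4)[OF run_level, of ?I] vs by (auto simp: X_def)
    have finX: "finite (X ?I)" using XV finV finite_subset by auto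
    have "real (card E) / (4 * 2 ^ k\<^sup>2) \<le> real (\<Sum>v\<in>X ?I. card {e \<in> E. v \<in> e})"
      unfolding X_def by (rule excluded_degree)
    also have "(\<Sum>v\<in>X ?I. card {e \<in> E. v \<in> e}) = (\<Sum>e\<in>E. card (e \<inter> X ?I))"
      using finX finE by (rule sum_card_incidences)
    also have "\<dots> \<le> (\<Sum>e\<in>E. if e \<in> ?C then 0 else k)"
    proof (rule sum_mono)
      fix e assume e: "e \<in> E"
      show "card (e \<inter> X ?I) \<le> (if e \<in> ?C then 0 else k)"
      proof (cases "e \<in> ?C")
        case True
        then have "e \<inter> X ?I = {}" by auto
        then show ?thesis by (metis card.empty le0)
      next
        case False
        have "card (e \<inter> X ?I) \<le> card e" using uniform[OF e] finV finite_subset by (intro card_mono) auto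
        then show ?thesis using uniform[OF e] unfolding if_not_P[OF False] by simp
      qed
    qed
    also have "\<dots> = (\<Sum>e\<in>E - ?C. k)"
      using finE by (intro sum.mono_neutral_cong_right) auto
    also have "\<dots> = k * card (E - ?C)" by simp
    also have "card (E - ?C) = card E - card ?C" using finE by (subst card_Diff_subset) auto
    finally have "real (card E) / (4 * 2 ^ k\<^sup>2) \<le> real k * real (card E - card ?C)" by simp
    moreover have "card ?C \<le> card E" using finE by (intro card_mono) auto
    ultimately have "real (card E) / (4 * 2 ^ k\<^sup>2) \<le> real k * (real (card E) - real (card ?C))"
      by (simp add: of_nat_diff)
    then have "real (card ?C) \<le> (1 - 1 / (4 * real k * 2 ^ k\<^sup>2)) * real (card E)"
      using k2 by (simp add: field_simps)
    then show ?thesis using sub size IX X by (intro exI[of _ \<Phi>]) auto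
  qed
  then show ?thesis unfolding container_map_def by (intro exI[of _ "\<lambda>\<Phi>. V - X (J \<Phi>)"]) blast
qed

end

section \<open>Containers: iteration\<close>

text \<open>As long as the current container spans more than \<open>\<epsilon> * card E\<close> edges, these edges satisfy the
  co-degree condition of the cascade with \<open>\<epsilon>\<close> removed, and another round deletes a constant fraction of
  them. The labels \<open>N * k, \<dots>, N * k + k - 1\<close> belong to the round with number \<open>N\<close>.\<close>

lemma iterated_containers:
  fixes E :: "'a set set" and \<tau> \<epsilon> :: real and k :: nat
  defines "c \<equiv> 4 * real k * real (k + 1) * 2 ^ k\<^sup>2"
    and "\<eta> \<equiv> 1 / (4 * real k * 2 ^ k\<^sup>2)"
  assumes finV: "finite V" and uniform: "\<And>e. e \<in> E \<Longrightarrow> e \<subseteq> V \<and> card e = k" and k2: "k \<ge> 2"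
    and \<tau>: "0 < \<tau>" "\<tau> \<le> 1" and \<epsilon>: "0 < \<epsilon>"
    and codeg: "\<And>l. 1 \<le> l \<Longrightarrow> l < k \<Longrightarrow>
      (\<Sum>v\<in>V. real (codegree V E l {v})) \<le> \<epsilon> / 2 ^ (k\<^sup>2 + k + 2) * \<tau> ^ l * real (card E)"
  shows "\<exists>cont. container_map V E (N * k) (real N * (c * \<tau> * real (card V)))
     (max (\<epsilon> * real (card E)) ((1 - \<eta>) ^ N * real (card E))) cont"
proof (induction N)
  case 0
  have "\<exists>\<Phi>. \<Phi> \<subseteq> {..<0 * k} \<times> I \<and> real (card \<Phi>) \<le> real 0 * (c * \<tau> * real (card V)) \<and> I \<subseteq> V \<and>
      real (card {e \<in> E. e \<subseteq> V}) \<le> max (\<epsilon> * real (card E)) ((1 - \<eta>) ^ 0 * real (card E))"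
    if "I \<subseteq> V" for I
  proof -
    have "{e \<in> E. e \<subseteq> V} = E" using uniform by auto
    then show ?thesis using that by (intro exI[of _ "{}"]) auto
  qed
  then show ?case unfolding container_map_def by (intro exI[of _ "\<lambda>_. V"]) blast
next
  case (Suc N)
  have finE: "finite E" using uniform finV by (intro finite_subset[of E "Pow V"]) auto
  have \<eta>: "0 \<le> 1 - \<eta>"
  proof -
    have "(1::real) * 1 * 1 \<le> 4 * real k * 2 ^ k\<^sup>2"
      using k2 by (intro mult_mono) auto
    then show ?thesis unfolding \<eta>_def by simp
  qed
  from Suc obtain cont where cont: "container_map V E (N * k) (real N * (c * \<tau> * real (card V)))
     (max (\<epsilon> * real (card E)) ((1 - \<eta>) ^ N * real (card E))) cont" ..
  define dense where "dense = (\<lambda>E'. E' \<subseteq> E \<and> real (card E') > \<epsilon> * real (card E))"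
  have "\<exists>co. container_map V E' k (c * \<tau> * real (card V)) ((1 - \<eta>) * real (card E')) co"
    (is "\<exists>co. ?shrinks E' co")
    if E': "dense E'" for E'
  proof -
    obtain vs where vs: "set vs = V" "distinct vs" using finite_distinct_list[OF finV] by metis
    have "real (card E') > 0"
      using E' \<epsilon> by (intro le_less_trans[of 0 "\<epsilon> * real (card E)"]) (auto simp: dense_def)
    then have ne: "E' \<noteq> {}" by auto
    have cd: "(\<Sum>v\<in>V. real (codegree V E' l {v})) \<le> 1 / 2 ^ (k\<^sup>2 + k + 2) * \<tau> ^ l * real (card E')"
      if l: "1 \<le> l" "l < k" for l
    proof -
      have "(\<Sum>v\<in>V. real (codegree V E' l {v})) \<le> (\<Sum>v\<in>V. real (codegree V E l {v}))"
        using finV finE E' by (intro sum_mono of_nat_mono codegree_mono) (auto simp: dense_def)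
      also have "\<dots> \<le> \<epsilon> / 2 ^ (k\<^sup>2 + k + 2) * \<tau> ^ l * real (card E)" by (rule codeg[OF l])
      also have "\<dots> = 1 / 2 ^ (k\<^sup>2 + k + 2) * \<tau> ^ l * (\<epsilon> * real (card E))" by simp
      also have "\<dots> \<le> 1 / 2 ^ (k\<^sup>2 + k + 2) * \<tau> ^ l * real (card E')"
        using E' \<tau> by (intro mult_left_mono) (auto simp: dense_def)
      finally show ?thesis .
    qed
    have un: "e \<subseteq> V \<and> card e = k" if "e \<in> E'" for e
      using uniform[of e] that E' unfolding dense_def by blast
    interpret container_cascade V E' k \<tau> vs
      by (rule container_cascade.intro[OF finV un k2 \<tau> vs ne cd])
    show ?thesis using single_container unfolding c_def \<eta>_def .
  qed
  then have "\<forall>E'. \<exists>co. dense E' \<longrightarrow> ?shrinks E' co" by simp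
  then obtain co where "\<forall>E'. dense E' \<longrightarrow> ?shrinks E' (co E')" by (rule choice[THEN exE])
  then have co: "?shrinks E' (co E')" if "dense E'" for E' using that by simp
  define first where "first = (\<lambda>\<Phi>::(nat \<times> 'a) set. cont (\<Phi> \<inter> {..<N * k} \<times> UNIV))"
  define rest where "rest = (\<lambda>\<Phi>. {(l :: nat, v :: 'a). (N * k + l, v) \<in> \<Phi>})"
  define cont' where "cont' = (\<lambda>\<Phi>. if dense {e \<in> E. e \<subseteq> first \<Phi>}
     then first \<Phi> \<inter> co {e \<in> E. e \<subseteq> first \<Phi>} (rest \<Phi>) else first \<Phi>)"
  have "\<exists>\<Phi>. \<Phi> \<subseteq> {..<Suc N * k} \<times> I \<and>
     real (card \<Phi>) \<le> real (Suc N) * (c * \<tau> * real (card V)) \<and> I \<subseteq> cont' \<Phi> \<and>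
     real (card {e \<in> E. e \<subseteq> cont' \<Phi>}) \<le> max (\<epsilon> * real (card E)) ((1 - \<eta>) ^ Suc N * real (card E))"
    if I: "I \<subseteq> V" "\<forall>e\<in>E. \<not> e \<subseteq> I" for I
  proof -
    obtain \<Phi>1 where \<Phi>1: "\<Phi>1 \<subseteq> {..<N * k} \<times> I" "real (card \<Phi>1) \<le> real N * (c * \<tau> * real (card V))"
      "I \<subseteq> cont \<Phi>1"
      "real (card {e \<in> E. e \<subseteq> cont \<Phi>1}) \<le> max (\<epsilon> * real (card E)) ((1 - \<eta>) ^ N * real (card E))"
      by (rule container_mapE[OF cont I]) (rule that)
    define E' where "E' = {e \<in> E. e \<subseteq> cont \<Phi>1}"
    have c0: "0 \<le> c * \<tau> * real (card V)" using \<tau> by (simp add: c_def)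
    show ?thesis
    proof (cases "dense E'")
      case False
      have first: "first \<Phi>1 = cont \<Phi>1" unfolding first_def using \<Phi>1(1) by (intro arg_cong[of _ _ cont]) auto
      then have eq: "cont' \<Phi>1 = cont \<Phi>1" using False by (simp add: cont'_def E'_def)
      have "real (card E') \<le> \<epsilon> * real (card E)" using False by (auto simp: dense_def E'_def)
      moreover have "real (card \<Phi>1) \<le> real (Suc N) * (c * \<tau> * real (card V))"
        using \<Phi>1(2) c0 by (simp add: algebra_simps)
      moreover have "\<Phi>1 \<subseteq> {..<Suc N * k} \<times> I" using \<Phi>1(1) by auto
      ultimately show ?thesis using \<Phi>1(3)
        by (intro exI[of _ \<Phi>1] conjI) (auto simp: eq E'_def le_max_iff_disj)
    next
      case True
      have I': "\<forall>e\<in>E'. \<not> e \<subseteq> I" using I by (auto simp: E'_def)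
      obtain \<Phi>2 where \<Phi>2: "\<Phi>2 \<subseteq> {..<k} \<times> I" "real (card \<Phi>2) \<le> c * \<tau> * real (card V)"
        "I \<subseteq> co E' \<Phi>2" "real (card {e \<in> E'. e \<subseteq> co E' \<Phi>2}) \<le> (1 - \<eta>) * real (card E')"
        by (rule container_mapE[OF co[OF True] I(1) I']) (rule that)
      define \<Phi> where "\<Phi> = \<Phi>1 \<union> (\<lambda>(l, v). (N * k + l, v)) ` \<Phi>2"
      have "\<Phi> \<inter> {..<N * k} \<times> UNIV = \<Phi>1" using \<Phi>1(1) by (auto simp: \<Phi>_def)
      then have first: "first \<Phi> = cont \<Phi>1" by (simp add: first_def)
      have "rest \<Phi> = \<Phi>2" using \<Phi>1(1) by (force simp: \<Phi>_def rest_def)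
      then have eq: "cont' \<Phi> = cont \<Phi>1 \<inter> co E' \<Phi>2" using True by (simp add: cont'_def first E'_def)
      have sub: "\<Phi> \<subseteq> {..<Suc N * k} \<times> I" using \<Phi>1(1) \<Phi>2(1) by (fastforce simp: \<Phi>_def)
      have fin2: "finite \<Phi>2"
        using \<Phi>2(1) I(1) finV by (meson finite_SigmaI finite_lessThan finite_subset)
      have "card \<Phi> \<le> card \<Phi>1 + card \<Phi>2"
        unfolding \<Phi>_def using card_image_le[OF fin2] by (intro order_trans[OF card_Un_le]) auto
      then have "real (card \<Phi>) \<le> real (Suc N) * (c * \<tau> * real (card V))"
        using \<Phi>1(2) \<Phi>2(2) by (simp add: algebra_simps)
      moreover have "real (card {e \<in> E. e \<subseteq> cont' \<Phi>}) \<le> (1 - \<eta>) ^ Suc N * real (card E)"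
      proof -
        have "{e \<in> E. e \<subseteq> cont' \<Phi>} = {e \<in> E'. e \<subseteq> co E' \<Phi>2}" by (auto simp: eq E'_def)
        then have "real (card {e \<in> E. e \<subseteq> cont' \<Phi>}) \<le> (1 - \<eta>) * real (card E')" using \<Phi>2(4) by simp
        also have "real (card E') \<le> (1 - \<eta>) ^ N * real (card E)"
          using True \<Phi>1(4) by (auto simp: dense_def E'_def)
        finally show ?thesis using \<eta> by (simp add: mult_left_mono mult.assoc)
      qed
      moreover have "I \<subseteq> cont' \<Phi>" using \<Phi>1(3) \<Phi>2(3) eq by auto
      ultimately show ?thesis using sub by (intro exI[of _ \<Phi>]) auto
    qed
  qed
  then show ?case unfolding container_map_def by (intro exI[of _ cont']) blast
qed

text \<open>A constant \<open>D\<close> of any size in the co-degree condition is allowed: replacing \<open>\<tau>\<close> by \<open>A * \<tau>\<close> divides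
  all normalised co-degrees by at least \<open>A\<close>, at the cost of a factor \<open>A\<close> in the size of the
  fingerprints. If \<open>A * \<tau> > 1\<close>, the whole independent set can serve as its own fingerprint.\<close>

theorem hypergraph_containers:
  fixes k :: nat and D \<epsilon> :: real
  assumes k2: "k \<ge> 2" and D: "0 < D" and \<epsilon>: "0 < \<epsilon>"
  shows "\<exists>L c. 0 < c \<and> (\<forall>(V :: 'a set) E \<tau>. finite V \<longrightarrow> (\<forall>e\<in>E. e \<subseteq> V \<and> card e = k) \<longrightarrow> 0 < \<tau> \<longrightarrow>
    (\<forall>l\<in>{1..<k}. (\<Sum>v\<in>V. real (codegree V E l {v})) \<le> D * \<tau> ^ l * real (card E)) \<longrightarrow>
    (\<exists>cont. container_map V E L (c * \<tau> * real (card V)) (\<epsilon> * real (card E)) cont))"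
proof -
  define c where "c = 4 * real k * real (k + 1) * 2 ^ k\<^sup>2"
  define \<eta> where "\<eta> = 1 / (4 * real k * 2 ^ k\<^sup>2)"
  \<comment> \<open>The scaling that turns \<open>D\<close> into the constant \<open>\<epsilon> / 2 ^ (k\<^sup>2 + k + 2)\<close> required for the iteration.\<close>
  define A where "A = max 1 (D * 2 ^ (k\<^sup>2 + k + 2) / \<epsilon>)"
  have "(1::real) * 1 * 1 < 4 * real k * 2 ^ k\<^sup>2"
    using k2 by (intro mult_less_le_imp_less) auto
  then have \<eta>: "0 < \<eta>" "\<eta> < 1" using k2 unfolding \<eta>_def by (auto simp: field_simps)
  obtain N where N: "(1 - \<eta>) ^ N < \<epsilon>" using real_arch_pow_inv[of \<epsilon> "1 - \<eta>"] \<epsilon> \<eta> by auto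
  \<comment> \<open>The summands \<open>1\<close> in \<open>L\<close> and \<open>C\<close> make room for the trivial fingerprint when \<open>A * \<tau> > 1\<close>.\<close>
  define L where "L = N * k + 1"
  define C where "C = (real N * c + 1) * A"
  have A: "A \<ge> 1" "D \<le> A * (\<epsilon> / 2 ^ (k\<^sup>2 + k + 2))"
  proof -
    show "A \<ge> 1" by (simp add: A_def)
    have "D * 2 ^ (k\<^sup>2 + k + 2) / \<epsilon> \<le> A" by (simp add: A_def)
    then show "D \<le> A * (\<epsilon> / 2 ^ (k\<^sup>2 + k + 2))" using \<epsilon> by (simp add: field_simps)
  qed
  have c0: "0 \<le> c" by (simp add: c_def)
  have Cpos: "0 < C" using c0 A by (auto simp: C_def intro!: mult_pos_pos add_nonneg_pos)
  have "\<exists>cont. container_map V E L (C * \<tau> * real (card V)) (\<epsilon> * real (card E)) cont"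
    if finV: "finite V" and unif: "\<forall>e\<in>E. e \<subseteq> V \<and> card e = k" and \<tau>: "0 < \<tau>"
      and codeg: "\<forall>l\<in>{1..<k}. (\<Sum>v\<in>V. real (codegree V E l {v})) \<le> D * \<tau> ^ l * real (card E)"
    for V :: "'a set" and E \<tau>
  proof (cases "A * \<tau> \<le> 1")
    case True
    have "\<exists>cont. container_map V E (N * k) (real N * (c * (A * \<tau>) * real (card V)))
      (max (\<epsilon> * real (card E)) ((1 - \<eta>) ^ N * real (card E))) cont" (is "\<exists>cont. ?contains cont")
      unfolding c_def \<eta>_def
    proof (rule iterated_containers)
      fix l assume l: "1 \<le> l" "l < k"
      have "(\<Sum>v\<in>V. real (codegree V E l {v})) \<le> D * \<tau> ^ l * real (card E)" using codeg l by auto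
      also have "\<dots> \<le> (A * (\<epsilon> / 2 ^ (k\<^sup>2 + k + 2))) * \<tau> ^ l * real (card E)"
        using A \<tau> by (intro mult_right_mono) auto
      also have "\<dots> \<le> (A ^ l * (\<epsilon> / 2 ^ (k\<^sup>2 + k + 2))) * \<tau> ^ l * real (card E)"
        using A \<tau> \<epsilon> l self_le_power[of A l] by (intro mult_right_mono) auto
      finally show "(\<Sum>v\<in>V. real (codegree V E l {v}))
          \<le> \<epsilon> / 2 ^ (k\<^sup>2 + k + 2) * (A * \<tau>) ^ l * real (card E)"
        by (simp add: power_mult_distrib mult_ac)
    qed (use True finV unif k2 \<tau> A \<epsilon> in auto)
    then obtain cont where cont: "?contains cont" ..
    have "\<exists>\<Phi>. \<Phi> \<subseteq> {..<L} \<times> I \<and>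
      real (card \<Phi>) \<le> C * \<tau> * real (card V) \<and> I \<subseteq> cont \<Phi> \<and>
      real (card {e \<in> E. e \<subseteq> cont \<Phi>}) \<le> \<epsilon> * real (card E)" if I: "I \<subseteq> V" "\<forall>e\<in>E. \<not> e \<subseteq> I" for I
    proof -
      obtain \<Phi> where \<Phi>: "\<Phi> \<subseteq> {..<N * k} \<times> I" "real (card \<Phi>) \<le> real N * (c * (A * \<tau>) * real (card V))"
        "I \<subseteq> cont \<Phi>"
        "real (card {e \<in> E. e \<subseteq> cont \<Phi>}) \<le> max (\<epsilon> * real (card E)) ((1 - \<eta>) ^ N * real (card E))"
        by (rule container_mapE[OF cont I]) (rule that)
      have "(1 - \<eta>) ^ N * real (card E) \<le> \<epsilon> * real (card E)" using N by (intro mult_right_mono) auto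
      then have "real (card {e \<in> E. e \<subseteq> cont \<Phi>}) \<le> \<epsilon> * real (card E)" using \<Phi>(4) by simp
      moreover have "real N * (c * (A * \<tau>) * real (card V)) \<le> C * \<tau> * real (card V)"
        using A \<tau> by (simp add: C_def algebra_simps)
      moreover have "\<Phi> \<subseteq> {..<L} \<times> I" using \<Phi>(1) by (auto simp: L_def)
      ultimately show ?thesis using \<Phi>(2,3) by (intro exI[of _ \<Phi>]) auto
    qed
    then show ?thesis unfolding container_map_def by (intro exI[of _ cont]) blast
  next
    case False
    have "\<exists>\<Phi>. \<Phi> \<subseteq> {..<L} \<times> I \<and>
      real (card \<Phi>) \<le> C * \<tau> * real (card V) \<and> I \<subseteq> snd ` \<Phi> \<and>
      real (card {e \<in> E. e \<subseteq> snd ` \<Phi>}) \<le> \<epsilon> * real (card E)" if I: "I \<subseteq> V" "\<forall>e\<in>E. \<not> e \<subseteq> I" for I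
    proof -
      have snd: "snd ` ({0::nat} \<times> I) = I" by force
      have none: "{e \<in> E. e \<subseteq> I} = {}" using I by auto
      have "real (card ({0::nat} \<times> I)) \<le> 1 * real (card V)" using I(1) finV by (simp add: card_mono card_cartesian_product)
      also have "\<dots> \<le> C * \<tau> * real (card V)"
      proof (rule mult_right_mono)
        have "1 * 1 \<le> (real N * c + 1) * (A * \<tau>)"
          using False c0 by (intro mult_mono) auto
        then show "1 \<le> C * \<tau>" by (simp add: C_def mult.assoc)
      qed simp
      finally show ?thesis using \<epsilon> unfolding L_def
        by (intro exI[of _ "{0} \<times> I"]) (auto simp: snd none)
    qed
    then show ?thesis unfolding container_map_def by (intro exI[of _ "\<lambda>\<Phi>. snd ` \<Phi>"]) blast
  qed
  then show ?thesis using Cpos by (intro exI[of _ L] exI[of _ C]) blast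
qed

section \<open>Typed edges in independent random subsets\<close>

text \<open>The set of typed vertices used by an edge: the pair \<open>(i, v)\<close> stands for the vertex \<open>v\<close>
  playing the role \<open>i\<close>.\<close>

definition graph_on :: "nat set \<Rightarrow> (nat \<Rightarrow> 'a) \<Rightarrow> (nat \<times> 'a) set" where
  "graph_on I u = (\<lambda>i. (i, u i)) ` I"

definition restrictions :: "(nat \<Rightarrow> 'a) set \<Rightarrow> nat set \<Rightarrow> (nat \<Rightarrow> 'a) set" where
  "restrictions P I = (\<lambda>\<pi>. restrict \<pi> I) ` P"

lemma mem_graph_on: "(i, v) \<in> graph_on I u \<longleftrightarrow> i \<in> I \<and> v = u i"
  by (auto simp: graph_on_def)

lemma prod_graph_on: "(\<Prod>x\<in>graph_on I u. (q (fst x) :: real)) = (\<Prod>i\<in>I. q i)"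
  unfolding graph_on_def by (subst prod.reindex) (auto simp: inj_on_def)

lemma finite_graph_on [simp]: "finite I \<Longrightarrow> finite (graph_on I u)"
  by (simp add: graph_on_def)

text \<open>The building blocks of a recorded fingerprint: a label \<open>l\<close>, a role \<open>j\<close> and a restriction to
  \<open>Wm j\<close> of an ordered edge, standing for the vertex at position \<open>j\<close> of that edge.\<close>

definition edge_choices :: "(nat \<Rightarrow> 'a) set \<Rightarrow> nat \<Rightarrow> 'l set \<Rightarrow> (nat \<Rightarrow> nat set) \<Rightarrow> ('l \<times> nat \<times> (nat \<Rightarrow> 'a)) set" where
  "edge_choices P k Lab Wm = Lab \<times> (SIGMA j:{1..k}. restrictions P (Wm j))"

definition base :: "(nat \<Rightarrow> nat set) \<Rightarrow> ('l \<times> nat \<times> (nat \<Rightarrow> 'a)) set \<Rightarrow> (nat \<times> 'a) set" where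
  "base Wm F = (\<Union>(l, j, e)\<in>F. graph_on (Wm j) e)"

text \<open>The set \<open>P\<close> holds the ordered edges. A typed vertex \<open>(i, v)\<close> is present with probability \<open>q i\<close>.
  The parameter \<open>m\<close> bounds from below the expected number of typed edges of every projection. The
  case \<open>I = W\<close> is included in the degree condition, which only asks that \<open>K \<ge> 1\<close>.\<close>

locale typed_sampling =
  fixes P :: "(nat \<Rightarrow> 'a) set" and k :: nat and V :: "'a set" and q :: "nat \<Rightarrow> real" and K m :: real
  assumes finV: "finite V" and finP: "finite P" and P_ne: "P \<noteq> {}"
    and P_ext: "\<And>\<pi>. \<pi> \<in> P \<Longrightarrow> \<pi> \<in> extensional {1..k}" and P_V: "\<And>\<pi>. \<pi> \<in> P \<Longrightarrow> \<pi> ` {1..k} \<subseteq> V"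
    and k1: "1 \<le> k"
    and q: "\<And>i. i \<in> {1..k} \<Longrightarrow> 0 < q i \<and> q i \<le> 1" and K1: "1 \<le> K" and m: "0 < m"
    and tame: "\<And>I W \<pi>. I \<noteq> {} \<Longrightarrow> I \<subseteq> W \<Longrightarrow> W \<subseteq> {1..k} \<Longrightarrow> \<pi> \<in> P \<Longrightarrow>
      real (card {\<sigma> \<in> restrictions P W. restrict \<sigma> I = restrict \<pi> I}) * real (card (restrictions P I))
        \<le> K * real (card (restrictions P W))"
    and lower: "\<And>I. I \<noteq> {} \<Longrightarrow> I \<subseteq> {1..k} \<Longrightarrow> m \<le> (\<Prod>i\<in>I. q i) * real (card (restrictions P I))"
begin

definition \<Omega> :: "(nat \<times> 'a) set" where "\<Omega> = {1..k} \<times> V"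

definition Q :: "nat \<times> 'a \<Rightarrow> real" where "Q x = q (fst x)"

abbreviation expectation :: "((nat \<times> 'a) set \<Rightarrow> real) \<Rightarrow> real" where
  "expectation \<equiv> subset_exp \<Omega> Q"

definition qprod :: "nat set \<Rightarrow> real" where "qprod I = (\<Prod>i\<in>I. q i)"

definition mean :: "nat set \<Rightarrow> real" where "mean W = qprod W * real (card (restrictions P W))"

definition typed_count :: "nat set \<Rightarrow> (nat \<times> 'a) set \<Rightarrow> nat" where
  "typed_count W A = card {u \<in> restrictions P W. graph_on W u \<subseteq> A}"

text \<open>The decisive property of the typical random set; it is inherited by subsets, in particular by
  the union of the recorded edges of a fingerprint.\<close>

definition moderate :: "(nat \<times> 'a) set \<Rightarrow> bool" where
  "moderate A \<longleftrightarrow> (\<forall>W. W \<noteq> {} \<and> W \<subseteq> {1..k} \<longrightarrow> real (typed_count W A) \<le> 2 * mean W)"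

lemma fin_\<Omega>: "finite \<Omega>" using finV by (simp add: \<Omega>_def)

lemma Q01: "x \<in> \<Omega> \<Longrightarrow> 0 \<le> Q x \<and> Q x \<le> 1"
  using q by (auto simp: \<Omega>_def Q_def less_imp_le)

lemma fin_restrictions: "finite (restrictions P W)"
  using finP by (simp add: restrictions_def)

lemma card_restrictions_pos: "card (restrictions P W) > 0"
  using fin_restrictions P_ne by (auto simp: card_gt_0_iff restrictions_def)

lemma qprod_pos: "I \<subseteq> {1..k} \<Longrightarrow> 0 < qprod I"
  unfolding qprod_def using q by (intro prod_pos) blast

lemma qprod_Diff: "I \<subseteq> W \<Longrightarrow> W \<subseteq> {1..k} \<Longrightarrow> qprod (W - I) * qprod I = qprod W"
  unfolding qprod_def by (subst prod.subset_diff[of I W]) (auto intro: finite_subset)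

lemma prod_Q_graph_on: "(\<Prod>x\<in>graph_on I u. Q x) = qprod I"
  unfolding Q_def qprod_def by (rule prod_graph_on)

lemma mean_ge: "I \<noteq> {} \<Longrightarrow> I \<subseteq> {1..k} \<Longrightarrow> m \<le> mean I"
  unfolding mean_def qprod_def by (rule lower)

lemma restrictions_full: "restrictions P {1..k} = P"
  using P_ext by (force simp: restrictions_def extensional_restrict image_iff)

lemma restrict_restrictions:
  assumes "u \<in> restrictions P W" "I \<subseteq> W"
  shows "\<exists>\<pi>\<in>P. restrict u I = restrict \<pi> I \<and> (\<forall>i\<in>W. u i = \<pi> i)"
proof -
  obtain \<pi> where "\<pi> \<in> P" "u = restrict \<pi> W" using assms(1) by (auto simp: restrictions_def)
  then show ?thesis using assms(2) by (intro bexI[of _ \<pi>]) (auto simp: restrict_def fun_eq_iff)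
qed

lemma graph_on_\<Omega>:
  assumes "u \<in> restrictions P W" "W \<subseteq> {1..k}"
  shows "graph_on W u \<subseteq> \<Omega>"
  using restrict_restrictions[OF assms(1) order_refl] assms(2) P_V
  by (fastforce simp: graph_on_def \<Omega>_def)

lemma extensions_le:
  assumes "I \<noteq> {}" "I \<subseteq> W" "W \<subseteq> {1..k}" "u \<in> restrictions P W"
  shows "real (card {\<sigma> \<in> restrictions P W. restrict \<sigma> I = restrict u I})
    \<le> K * real (card (restrictions P W)) / real (card (restrictions P I))"
proof -
  obtain \<pi> where "\<pi> \<in> P" "restrict u I = restrict \<pi> I"
    using restrict_restrictions[OF assms(4,2)] by blast
  then show ?thesis using tame[OF assms(1-3)] card_restrictions_pos[of I] by (simp add: field_simps)
qed

text \<open>Classify the pairs by the set \<open>I\<close> of positions where they agree. Such a pair is present with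
  probability \<open>(qprod W)\<^sup>2 / qprod I\<close>, and the degree condition bounds the number of pairs that agree
  on \<open>I\<close>, so each class contributes at most \<open>K * (mean W)\<^sup>2 / mean I\<close>. The bound serves both the second
  moment and the Janson inequality.\<close>

lemma intersecting_pairs:
  assumes W: "W \<noteq> {}" "W \<subseteq> {1..k}"
  defines "R \<equiv> restrictions P W"
  shows "(\<Sum>(u, u')\<in>{(u, u'). u \<in> R \<and> u' \<in> R \<and> graph_on W u \<inter> graph_on W u' \<noteq> {}}.
      \<Prod>x\<in>graph_on W u \<union> graph_on W u'. Q x) \<le> 2 ^ k * K / m * (mean W)\<^sup>2"
proof -
  define agree where "agree = (\<lambda>u u' :: nat \<Rightarrow> 'a. {i \<in> W. u i = u' i})"
  let ?w = "\<lambda>(u, u'). \<Prod>x\<in>graph_on W u \<union> graph_on W u'. Q x"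
  let ?I = "{I. I \<noteq> {} \<and> I \<subseteq> W}"
  have finW: "finite W" using W finite_subset by auto
  have finR: "finite R" unfolding R_def by (rule fin_restrictions)
  have w: "?w (u, u') = (qprod W)\<^sup>2 / qprod (agree u u')" for u u'
  proof -
    have a: "agree u u' \<subseteq> W" by (auto simp: agree_def)
    have "graph_on W u \<union> graph_on W u' = graph_on W u \<union> graph_on (W - agree u u') u'"
      "graph_on W u \<inter> graph_on (W - agree u u') u' = {}"
      by (auto simp: mem_graph_on agree_def)
    then have "?w (u, u') = qprod W * qprod (W - agree u u')"
      using finW by (simp add: prod.union_disjoint prod_Q_graph_on)
    also have "qprod (W - agree u u') = qprod W / qprod (agree u u')"
      using qprod_Diff[OF a W(2)] qprod_pos[OF order_trans[OF a W(2)]] by (simp add: field_simps)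
    also have "qprod W * (qprod W / qprod (agree u u')) = (qprod W)\<^sup>2 / qprod (agree u u')"
      by (simp add: power2_eq_square)
    finally show ?thesis .
  qed
  have "(\<Sum>z\<in>{(u, u'). u \<in> R \<and> u' \<in> R \<and> graph_on W u \<inter> graph_on W u' \<noteq> {}}. ?w z)
     = (\<Sum>z\<in>(\<Union>I\<in>?I. {(u, u'). u \<in> R \<and> u' \<in> R \<and> agree u u' = I}). ?w z)"
  proof (rule sum.cong)
    have "graph_on W u \<inter> graph_on W u' \<noteq> {} \<longleftrightarrow> agree u u' \<noteq> {}" for u u'
      unfolding graph_on_def agree_def by blast
    moreover have "agree u u' \<subseteq> W" for u u' by (auto simp: agree_def)
    ultimately show "{(u, u'). u \<in> R \<and> u' \<in> R \<and> graph_on W u \<inter> graph_on W u' \<noteq> {}}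
      = (\<Union>I\<in>?I. {(u, u'). u \<in> R \<and> u' \<in> R \<and> agree u u' = I})" by auto
  qed simp
  also have "\<dots> = (\<Sum>I\<in>?I. \<Sum>z\<in>{(u, u'). u \<in> R \<and> u' \<in> R \<and> agree u u' = I}. ?w z)"
  proof (intro sum.UNION_disjoint ballI)
    show "finite {(u, u'). u \<in> R \<and> u' \<in> R \<and> agree u u' = I}" for I
      by (rule finite_subset[OF _ finite_cartesian_product[OF finR finR]]) blast
    show "finite ?I" using finW by (rule rev_finite_subset[OF finite_Pow_iff[THEN iffD2]]) blast
  qed blast
  also have "\<dots> \<le> (\<Sum>I\<in>?I. K / m * (mean W)\<^sup>2)"
  proof (rule sum_mono)
    fix I assume "I \<in> ?I"
    then have I: "I \<noteq> {}" "I \<subseteq> W" "I \<subseteq> {1..k}" using W by auto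
    have "(\<Sum>z\<in>{(u, u'). u \<in> R \<and> u' \<in> R \<and> agree u u' = I}. ?w z)
      = (qprod W)\<^sup>2 / qprod I * real (card {(u, u'). u \<in> R \<and> u' \<in> R \<and> agree u u' = I})"
    proof -
      have "?w z = (qprod W)\<^sup>2 / qprod I" if zI: "z \<in> {(u, u'). u \<in> R \<and> u' \<in> R \<and> agree u u' = I}" for z
      proof -
        obtain u u' where z: "z = (u, u')" "agree u u' = I" using zI by blast
        show ?thesis unfolding z(1) w z(2) ..
      qed
      then show ?thesis by simp
    qed
    also have "\<dots> \<le> (qprod W)\<^sup>2 / qprod I * (K * (real (card R))\<^sup>2 / real (card (restrictions P I)))"
    proof (rule mult_left_mono)
      have "card {(u, u'). u \<in> R \<and> u' \<in> R \<and> agree u u' = I}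
        \<le> card (SIGMA u:R. {u' \<in> R. restrict u' I = restrict u I})"
        using finR by (intro card_mono) (auto simp: agree_def restrict_def fun_eq_iff)
      also have "\<dots> = (\<Sum>u\<in>R. card {u' \<in> R. restrict u' I = restrict u I})"
        using finR by (subst card_SigmaI) auto
      finally have "real (card {(u, u'). u \<in> R \<and> u' \<in> R \<and> agree u u' = I})
        \<le> (\<Sum>u\<in>R. real (card {u' \<in> R. restrict u' I = restrict u I}))"
        unfolding of_nat_sum[symmetric] by (rule of_nat_mono)
      also have "\<dots> \<le> (\<Sum>u\<in>R. K * real (card R) / real (card (restrictions P I)))"
        unfolding R_def using I W by (intro sum_mono extensions_le)
      also have "\<dots> = K * (real (card R))\<^sup>2 / real (card (restrictions P I))"
        by (simp add: power2_eq_square)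
      finally show "real (card {(u, u'). u \<in> R \<and> u' \<in> R \<and> agree u u' = I})
        \<le> K * (real (card R))\<^sup>2 / real (card (restrictions P I))" .
    qed (use qprod_pos[OF I(3)] in auto)
    also have "\<dots> = K * (mean W)\<^sup>2 / mean I"
      by (simp add: mean_def R_def power_mult_distrib)
    also have "\<dots> \<le> K * (mean W)\<^sup>2 / m"
      using mean_ge[OF I(1,3)] m K1 by (intro divide_left_mono) auto
    finally show "(\<Sum>z\<in>{(u, u'). u \<in> R \<and> u' \<in> R \<and> agree u u' = I}. ?w z) \<le> K / m * (mean W)\<^sup>2"
      by simp
  qed
  also have "\<dots> = real (card ?I) * (K / m * (mean W)\<^sup>2)" by simp
  also have "\<dots> \<le> 2 ^ k * (K / m * (mean W)\<^sup>2)"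
  proof (rule mult_right_mono)
    have "card ?I \<le> card (Pow {1..k})" using W by (intro card_mono) auto
    then show "real (card ?I) \<le> 2 ^ k" by (simp add: card_Pow)
  qed (use K1 m in auto)
  finally show ?thesis by simp
qed

text \<open>Chebyshev's inequality: only intersecting pairs contribute to the variance.\<close>

lemma prob_typed_count_large_le:
  assumes W: "W \<noteq> {}" "W \<subseteq> {1..k}"
  shows "expectation (\<lambda>A. of_bool (real (typed_count W A) > 2 * mean W)) \<le> 2 ^ k * K / m"
proof -
  define R where "R = restrictions P W"
  have finR: "finite R" unfolding R_def by (rule fin_restrictions)
  have \<mu>: "mean W > 0" using mean_ge[OF W] m by linarith
  let ?X = "\<lambda>A. \<Sum>u\<in>R. of_bool (graph_on W u \<subseteq> A) :: real"
  let ?w = "\<lambda>(u, u'). \<Prod>x\<in>graph_on W u \<union> graph_on W u'. Q x"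
  let ?D = "{(u, u'). u \<in> R \<and> u' \<in> R \<and> graph_on W u \<inter> graph_on W u' \<noteq> {}}"
  have X: "real (typed_count W A) = ?X A" for A
    unfolding typed_count_def R_def[symmetric] using finR by (simp add: Int_def)
  have gR: "graph_on W u \<subseteq> \<Omega>" if "u \<in> R" for u using graph_on_\<Omega> that W by (auto simp: R_def)
  have E1: "expectation ?X = mean W"
  proof -
    have "expectation ?X = (\<Sum>u\<in>R. qprod W)"
      unfolding subset_exp_sum
      by (intro sum.cong) (auto simp: subset_exp_superset[OF fin_\<Omega> gR] prod_Q_graph_on)
    then show ?thesis by (simp add: mean_def R_def)
  qed
  have E2: "expectation (\<lambda>A. (?X A)\<^sup>2) \<le> (mean W)\<^sup>2 + 2 ^ k * K / m * (mean W)\<^sup>2"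
  proof -
    have "(?X A)\<^sup>2 = (\<Sum>u\<in>R. \<Sum>u'\<in>R. of_bool (graph_on W u \<union> graph_on W u' \<subseteq> A))" for A
      unfolding power2_eq_square sum_product by (intro sum.cong) auto
    then have "expectation (\<lambda>A. (?X A)\<^sup>2)
        = (\<Sum>u\<in>R. \<Sum>u'\<in>R. expectation (\<lambda>A. of_bool (graph_on W u \<union> graph_on W u' \<subseteq> A)))"
      by (simp only: subset_exp_sum)
    also have "\<dots> = (\<Sum>u\<in>R. \<Sum>u'\<in>R. ?w (u, u'))"
      unfolding prod.case using gR by (intro sum.cong refl subset_exp_superset[OF fin_\<Omega>]) auto
    also have "\<dots> = (\<Sum>z\<in>R \<times> R. ?w z)" by (simp add: sum.cartesian_product)
    also have "\<dots> = (\<Sum>z\<in>R \<times> R - ?D. ?w z) + (\<Sum>z\<in>?D. ?w z)"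
      using finR by (intro sum.subset_diff) auto
    also have "(\<Sum>z\<in>?D. ?w z) \<le> 2 ^ k * K / m * (mean W)\<^sup>2"
      unfolding R_def by (rule intersecting_pairs[OF W])
    also have "(\<Sum>z\<in>R \<times> R - ?D. ?w z) \<le> (\<Sum>z\<in>R \<times> R. (qprod W)\<^sup>2)"
    proof -
      have "(\<Sum>z\<in>R \<times> R - ?D. ?w z) = (\<Sum>z\<in>R \<times> R - ?D. (qprod W)\<^sup>2)"
      proof (rule sum.cong)
        fix z assume z: "z \<in> R \<times> R - ?D"
        obtain u u' where uu: "z = (u, u')" by (cases z)
        have "finite W" using W finite_subset by auto
        moreover have "graph_on W u \<inter> graph_on W u' = {}" using z uu by auto
        ultimately show "?w z = (qprod W)\<^sup>2"
          by (simp add: uu prod.union_disjoint prod_Q_graph_on power2_eq_square)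
      qed simp
      also have "\<dots> \<le> (\<Sum>z\<in>R \<times> R. (qprod W)\<^sup>2)" using finR by (intro sum_mono2) auto
      finally show ?thesis .
    qed
    also have "(\<Sum>z\<in>R \<times> R. (qprod W)\<^sup>2) = (mean W)\<^sup>2"
      by (simp add: mean_def R_def card_cartesian_product power2_eq_square)
    finally show ?thesis by simp
  qed
  have "expectation (\<lambda>A. of_bool (real (typed_count W A) > 2 * mean W))
      \<le> expectation (\<lambda>A. 1 / (mean W)\<^sup>2 * ((?X A)\<^sup>2 + ((- 2 * mean W) * ?X A + (mean W)\<^sup>2)))"
  proof (rule subset_exp_mono)
    fix A
    have eq: "1 / (mean W)\<^sup>2 * ((?X A)\<^sup>2 + ((- 2 * mean W) * ?X A + (mean W)\<^sup>2))
        = ((?X A - mean W) / mean W)\<^sup>2"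
      by (simp add: power2_eq_square field_simps)
    have "1 \<le> ((?X A - mean W) / mean W)\<^sup>2" if "?X A > 2 * mean W"
      using that \<mu> by (intro one_le_power) (simp add: field_simps)
    then show "of_bool (real (typed_count W A) > 2 * mean W)
      \<le> 1 / (mean W)\<^sup>2 * ((?X A)\<^sup>2 + ((- 2 * mean W) * ?X A + (mean W)\<^sup>2))"
      unfolding X eq by (cases "?X A > 2 * mean W") auto
  qed (use Q01 in auto)
  also have "\<dots> = 1 / (mean W)\<^sup>2 * (expectation (\<lambda>A. (?X A)\<^sup>2) - (mean W)\<^sup>2)"
    unfolding subset_exp_cmult subset_exp_add E1 using fin_\<Omega> by (simp add: power2_eq_square)
  also have "\<dots> \<le> 1 / (mean W)\<^sup>2 * (2 ^ k * K / m * (mean W)\<^sup>2)"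
    using E2 by (intro mult_left_mono) auto
  also have "\<dots> = 2 ^ k * K / m" using \<mu> by simp
  finally show ?thesis .
qed

lemma prob_not_moderate_le: "expectation (\<lambda>A. of_bool (\<not> moderate A)) \<le> 4 ^ k * K / m"
proof -
  let ?I = "{W. W \<noteq> {} \<and> W \<subseteq> {1..k}}"
  let ?b = "\<lambda>W A. of_bool (real (typed_count W A) > 2 * mean W) :: real"
  have fin: "finite ?I" by (rule finite_subset[of _ "Pow {1..k}"]) auto
  have "expectation (\<lambda>A. of_bool (\<not> moderate A)) \<le> expectation (\<lambda>A. \<Sum>W\<in>?I. ?b W A)"
  proof (rule subset_exp_mono)
    fix A
    show "of_bool (\<not> moderate A) \<le> (\<Sum>W\<in>?I. ?b W A)"
    proof (cases "moderate A")
      case True then show ?thesis by (auto intro!: sum_nonneg)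
    next
      case False
      then obtain W where W: "W \<in> ?I" "\<not> real (typed_count W A) \<le> 2 * mean W"
        unfolding moderate_def by blast
      then have "?b W A \<le> (\<Sum>W\<in>?I. ?b W A)" using fin by (intro member_le_sum) auto
      then show ?thesis using W by simp
    qed
  qed (use Q01 in auto)
  also have "\<dots> \<le> (\<Sum>W\<in>?I. 2 ^ k * K / m)"
    unfolding subset_exp_sum by (intro sum_mono prob_typed_count_large_le) auto
  also have "\<dots> = real (card ?I) * (2 ^ k * K / m)" by simp
  also have "\<dots> \<le> 2 ^ k * (2 ^ k * K / m)"
  proof (rule mult_right_mono)
    have "card ?I \<le> card (Pow {1..k})" by (intro card_mono) auto
    then show "real (card ?I) \<le> 2 ^ k" by (simp add: card_Pow)
  qed (use K1 m in auto)
  also have "\<dots> = 4 ^ k * K / m" by (simp add: power_mult_distrib[symmetric])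
  finally show ?thesis .
qed

lemma prob_no_typed_edge_le:
  assumes S: "S \<subseteq> P" "\<zeta> * real (card P) \<le> real (card S)" and \<zeta>: "0 < \<zeta>"
  shows "expectation (\<lambda>A. of_bool (\<forall>\<pi>\<in>S. \<not> graph_on {1..k} \<pi> \<subseteq> A)) \<le> exp (- (\<zeta>\<^sup>2 * m / (2 ^ (k + 1) * K)))"
proof -
  let ?B = "graph_on {1..k}"
  let ?w = "\<lambda>(u, u'). \<Prod>x\<in>?B u \<union> ?B u'. Q x"
  define \<mu> where "\<mu> = (\<Sum>\<pi>\<in>S. \<Prod>x\<in>?B \<pi>. Q x)"
  define \<Delta> where "\<Delta> = (\<Sum>(u, u')\<in>{(u, u'). u \<in> S \<and> u' \<in> S \<and> ?B u \<inter> ?B u' \<noteq> {}}. \<Prod>x\<in>?B u \<union> ?B u'. Q x)"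
  have finS: "finite S" by (rule finite_subset[OF S(1) finP])
  have W: "{1..k} \<noteq> {}" "{1..k} \<subseteq> {1..k}" using k1 by auto
  have B\<Omega>: "?B \<pi> \<subseteq> \<Omega>" if "\<pi> \<in> P" for \<pi> using graph_on_\<Omega>[of \<pi> "{1..k}"] that restrictions_full by auto
  have w0: "0 < ?w (u, u')" if "u \<in> P" "u' \<in> P" for u u'
  proof -
    have "?B u \<union> ?B u' \<subseteq> \<Omega>" using B\<Omega> that by auto
    then have "0 < Q x" if "x \<in> ?B u \<union> ?B u'" for x using that q by (fastforce simp: \<Omega>_def Q_def)
    then show ?thesis by (auto intro: prod_pos)
  qed
  have mean: "mean {1..k} = qprod {1..k} * real (card P)" unfolding mean_def restrictions_full ..
  have mpos: "0 < mean {1..k}" using mean_ge[OF W] m by linarith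
  have \<mu>: "\<mu> = qprod {1..k} * real (card S)" by (simp add: \<mu>_def prod_Q_graph_on)
  have "\<zeta> * mean {1..k} \<le> \<mu>"
    unfolding \<mu> mean using S(2) qprod_pos[OF W(2)] by (simp add: mult.left_commute)
  then have "(\<zeta> * mean {1..k})\<^sup>2 \<le> \<mu>\<^sup>2" using \<zeta> mpos by (intro power_mono) auto
  then have \<mu>2: "\<zeta>\<^sup>2 * (mean {1..k})\<^sup>2 \<le> \<mu>\<^sup>2" by (simp add: power_mult_distrib)
  have \<Delta>le: "\<Delta> \<le> 2 ^ k * K / m * (mean {1..k})\<^sup>2"
  proof -
    have "\<Delta> \<le> (\<Sum>z\<in>{(u, u'). u \<in> P \<and> u' \<in> P \<and> ?B u \<inter> ?B u' \<noteq> {}}. ?w z)"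
      unfolding \<Delta>_def
    proof (rule sum_mono2)
      show "finite {(u, u'). u \<in> P \<and> u' \<in> P \<and> ?B u \<inter> ?B u' \<noteq> {}}"
        by (rule finite_subset[of _ "P \<times> P"]) (use finP in auto)
      show "0 \<le> ?w z" if "z \<in> {(u, u'). u \<in> P \<and> u' \<in> P \<and> ?B u \<inter> ?B u' \<noteq> {}} -
        {(u, u'). u \<in> S \<and> u' \<in> S \<and> ?B u \<inter> ?B u' \<noteq> {}}" for z
        using that w0[of "fst z" "snd z"] by (cases z) auto
    qed (use S in blast)
    also have "\<dots> \<le> 2 ^ k * K / m * (mean {1..k})\<^sup>2"
      using intersecting_pairs[OF W] unfolding restrictions_full .
    finally show ?thesis .
  qed
  have "0 < card P" using finP P_ne by (simp add: card_gt_0_iff)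
  then have "0 < \<zeta> * real (card P)" using \<zeta> by simp
  then have "0 < real (card S)" using S(2) by linarith
  then obtain \<pi> where \<pi>: "\<pi> \<in> S" by fastforce
  have \<Delta>pos: "0 < \<Delta>"
  proof -
    let ?D = "{(u, u'). u \<in> S \<and> u' \<in> S \<and> ?B u \<inter> ?B u' \<noteq> {}}"
    have "finite ?D" by (rule finite_subset[of _ "S \<times> S"]) (use finS in auto)
    moreover have "(\<pi>, \<pi>) \<in> ?D" using \<pi> k1 by (auto simp: graph_on_def)
    moreover have "0 < ?w (\<pi>, \<pi>)" using \<pi> S w0 by blast
    moreover have "0 \<le> ?w z" if "z \<in> ?D" for z
    proof -
      obtain u u' where "z = (u, u')" "u \<in> P" "u' \<in> P" using \<open>z \<in> ?D\<close> S(1) by blast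
      then show ?thesis using w0[of u u'] by auto
    qed
    ultimately show ?thesis unfolding \<Delta>_def by (rule sum_pos2)
  qed
  have "expectation (\<lambda>A. of_bool (\<forall>\<pi>\<in>S. \<not> ?B \<pi> \<subseteq> A)) \<le> exp (- (\<mu>\<^sup>2 / (2 * \<Delta>)))"
    using B\<Omega> S k1 by (intro janson[OF fin_\<Omega> Q01 finS _ _ \<mu>_def \<Delta>_def]) (auto simp: graph_on_def)
  also have "\<dots> \<le> exp (- (\<zeta>\<^sup>2 * m / (2 ^ (k + 1) * K)))"
  proof -
    have "\<zeta>\<^sup>2 * m / (2 ^ (k + 1) * K)
        = (\<zeta>\<^sup>2 * (mean {1..k})\<^sup>2) / (2 * (2 ^ k * K / m * (mean {1..k})\<^sup>2))"
      using mpos m K1 by (simp add: field_simps)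
    also have "\<dots> \<le> \<mu>\<^sup>2 / (2 * \<Delta>)"
      using \<mu>2 \<Delta>le \<Delta>pos by (intro frac_le) auto
    finally show ?thesis by simp
  qed
  finally show ?thesis .
qed

lemma typed_count_mono: "finite B \<Longrightarrow> A \<subseteq> B \<Longrightarrow> typed_count W A \<le> typed_count W B"
  unfolding typed_count_def using fin_restrictions by (intro card_mono) auto

lemma moderate_subset: "moderate B \<Longrightarrow> finite B \<Longrightarrow> A \<subseteq> B \<Longrightarrow> moderate A"
  unfolding moderate_def using typed_count_mono by (meson of_nat_mono order_trans)

text \<open>The expected number of typed edges once \<open>B\<close> has been planted. An edge that meets \<open>B\<close> exactly in
  the positions \<open>J\<close> extends a typed edge of the projection to \<open>J\<close> inside \<open>B\<close>. There are at most
  \<open>2 * mean J\<close> of these, each with at most \<open>K * |P\<^sub>W| / |P\<^sub>J|\<close> extensions, and the extension costs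
  \<open>qprod (W - J)\<close>; the product is again of order \<open>mean W\<close>. Without moderation, planted clusters would
  create too many typed edges.\<close>

lemma new_edge_cost:
  assumes W: "W \<noteq> {}" "W \<subseteq> {1..k}" and B: "moderate B"
  shows "(\<Sum>e\<in>restrictions P W. \<Prod>x\<in>graph_on W e - B. Q x) \<le> 2 ^ (k + 1) * K * mean W"
proof -
  define R where "R = restrictions P W"
  \<comment> \<open>The positions in which an edge meets \<open>B\<close>.\<close>
  define met where "met = (\<lambda>e. {i \<in> W. (i, e i) \<in> B})"
  have finR: "finite R" unfolding R_def by (rule fin_restrictions)
  have finW: "finite W" using W finite_subset by auto
  have mW: "0 < mean W" using mean_ge[OF W] m by linarith
  have "(\<Sum>e\<in>R. \<Prod>x\<in>graph_on W e - B. Q x) = (\<Sum>e\<in>R. qprod (W - met e))"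
  proof (rule sum.cong)
    fix e
    have "graph_on W e - B = graph_on (W - met e) e" by (auto simp: mem_graph_on met_def)
    then show "(\<Prod>x\<in>graph_on W e - B. Q x) = qprod (W - met e)" by (simp add: prod_Q_graph_on)
  qed simp
  also have "\<dots> = (\<Sum>J\<in>Pow W. \<Sum>e | e \<in> R \<and> met e = J. qprod (W - met e))"
    using finR finW by (intro sum.group[symmetric]) (auto simp: met_def)
  also have "\<dots> \<le> (\<Sum>J\<in>Pow W. 2 * K * mean W)"
  proof (rule sum_mono)
    fix J assume J: "J \<in> Pow W"
    have "(\<Sum>e | e \<in> R \<and> met e = J. qprod (W - met e)) = real (card {e \<in> R. met e = J}) * qprod (W - J)"
      by simp
    also have "\<dots> \<le> 2 * K * mean W"
    proof (cases "J = {}")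
      case True
      have "real (card {e \<in> R. met e = J}) \<le> real (card R)" using finR by (intro of_nat_mono card_mono) auto
      then have "real (card {e \<in> R. met e = J}) * qprod (W - J) \<le> real (card R) * qprod W"
        using True qprod_pos[OF W(2)] by (simp add: mult_right_mono)
      also have "\<dots> = 1 * mean W" by (simp add: mean_def R_def)
      also have "\<dots> \<le> (2 * K) * mean W" using K1 mW by (intro mult_right_mono) auto
      finally show ?thesis .
    next
      case False
      have J': "J \<subseteq> {1..k}" "J \<subseteq> W" using J W by auto
      define T where "T = {u \<in> restrictions P J. graph_on J u \<subseteq> B}"
      have finT: "finite T" unfolding T_def using fin_restrictions by simp
      let ?d = "K * real (card R) / real (card (restrictions P J))"
      have d0: "0 \<le> ?d" using K1 by simp
      have "{e \<in> R. met e = J} \<subseteq> (\<Union>u\<in>T. {e \<in> R. restrict e J = u})"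
      proof
        fix e assume e: "e \<in> {e \<in> R. met e = J}"
        have "restrict e J \<in> restrictions P J"
          using e restrict_restrictions[of e W J] J' by (auto simp: R_def restrictions_def)
        moreover have "graph_on J (restrict e J) \<subseteq> B" using e by (auto simp: mem_graph_on met_def)
        ultimately show "e \<in> (\<Union>u\<in>T. {e \<in> R. restrict e J = u})" using e by (auto simp: T_def)
      qed
      then have "card {e \<in> R. met e = J} \<le> card (\<Union>u\<in>T. {e \<in> R. restrict e J = u})"
        using finR finT by (intro card_mono) auto
      also have "\<dots> \<le> (\<Sum>u\<in>T. card {e \<in> R. restrict e J = u})" using finT by (rule card_UN_le)
      finally have "real (card {e \<in> R. met e = J}) \<le> (\<Sum>u\<in>T. real (card {e \<in> R. restrict e J = u}))"
        unfolding of_nat_sum[symmetric] by (rule of_nat_mono)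
      also have "\<dots> \<le> (\<Sum>u\<in>T. ?d)"
      proof (rule sum_mono)
        fix u assume "u \<in> T"
        show "real (card {e \<in> R. restrict e J = u}) \<le> ?d"
        proof (cases "{e \<in> R. restrict e J = u} = {}")
          case True
          show ?thesis unfolding True using d0 by simp
        next
          case False
          then obtain e where "e \<in> R" "u = restrict e J" by auto
          then show ?thesis using extensions_le[OF \<open>J \<noteq> {}\<close> J'(2) W(2), of e] by (simp add: R_def)
        qed
      qed
      also have "\<dots> = real (typed_count J B) * ?d" by (simp add: T_def typed_count_def)
      also have "\<dots> \<le> 2 * mean J * ?d"
        using B False J' d0 by (intro mult_right_mono) (auto simp: moderate_def)
      also have "\<dots> = 2 * K * (qprod J * real (card R))"
        using card_restrictions_pos[of J] by (simp add: mean_def)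
      finally have "real (card {e \<in> R. met e = J}) * qprod (W - J)
          \<le> 2 * K * (qprod J * real (card R)) * qprod (W - J)"
        using W by (intro mult_right_mono less_imp_le[OF qprod_pos]) auto
      also have "\<dots> = 2 * K * ((qprod (W - J) * qprod J) * real (card R))" by (simp add: mult_ac)
      also have "\<dots> = 2 * K * mean W" unfolding qprod_Diff[OF J'(2) W(2)] by (simp add: mean_def R_def)
      finally show ?thesis .
    qed
    finally show "(\<Sum>e | e \<in> R \<and> met e = J. qprod (W - met e)) \<le> 2 * K * mean W" .
  qed
  also have "\<dots> = 2 ^ card W * (2 * K * mean W)" using finW by (simp add: card_Pow)
  also have "\<dots> \<le> 2 ^ k * (2 * K * mean W)"
  proof -
    have "card W \<le> k" using card_mono[OF _ W(2)] by simp
    then show ?thesis using K1 mW by (intro mult_right_mono power_increasing) auto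
  qed
  finally show ?thesis by (simp add: R_def mult_ac)
qed

lemma base_subset:
  assumes "F \<subseteq> edge_choices P k Lab Wm" "\<And>j. j \<in> {1..k} \<Longrightarrow> Wm j \<subseteq> {1..k}"
  shows "base Wm F \<subseteq> \<Omega>"
proof
  fix x assume "x \<in> base Wm F"
  then obtain l j e where F: "(l, j, e) \<in> F" and x: "x \<in> graph_on (Wm j) e" unfolding base_def by blast
  from F assms(1) have "j \<in> {1..k}" "e \<in> restrictions P (Wm j)" unfolding edge_choices_def by blast+
  then show "x \<in> \<Omega>" using graph_on_\<Omega> assms(2) x by blast
qed

text \<open>The expected number of \<open>s\<close>-element collections \<open>F\<close> that are present and whose union is moderate.
  Removing one element from a collection leaves such a collection, and the element costs at most the
  bound of \<open>new_edge_cost\<close> given the rest. Each collection of size \<open>s + 1\<close> arises in \<open>s + 1\<close> ways.\<close>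

lemma choices_weight:
  fixes Lab :: "'l set"
  assumes Lab: "finite Lab" and Wm: "\<And>j. j \<in> {1..k} \<Longrightarrow> Wm j \<noteq> {} \<and> Wm j \<subseteq> {1..k} \<and> mean (Wm j) \<le> M"
  defines "T \<equiv> edge_choices P k Lab Wm"
    and "G \<equiv> (\<lambda>s. {F. F \<subseteq> edge_choices P k Lab Wm \<and> card F = s \<and> moderate (base Wm F)})"
  shows "(\<Sum>F\<in>G s. \<Prod>x\<in>base Wm F. Q x)
    \<le> (real (card Lab) * real k * (2 ^ (k + 1) * K * M)) ^ s / fact s"
proof -
  let ?Bd = "real (card Lab) * real k * (2 ^ (k + 1) * K * M)"
  let ?w = "\<lambda>F :: ('l \<times> nat \<times> (nat \<Rightarrow> 'a)) set. \<Prod>x\<in>base Wm F. Q x"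
  let ?n = "\<lambda>(F :: ('l \<times> nat \<times> (nat \<Rightarrow> 'a)) set) t. \<Prod>x\<in>base Wm {t} - base Wm F. Q x"
  have finT: "finite T" unfolding T_def edge_choices_def using Lab fin_restrictions by auto
  have finG: "finite (G s)" for s
    using finT by (intro finite_subset[of "G s" "Pow T"]) (auto simp: G_def T_def)
  have base\<Omega>: "base Wm F \<subseteq> \<Omega>" if "F \<subseteq> T" for F
    using that Wm unfolding T_def by (intro base_subset) auto
  have prod0: "0 \<le> (\<Prod>x\<in>A. Q x)" if "A \<subseteq> \<Omega>" for A using that Q01 by (intro prod_nonneg) auto
  have M0: "0 \<le> M" using Wm[of 1] mean_ge[of "Wm 1"] m k1 by fastforce
  have step: "(\<Sum>t\<in>T. ?n F t) \<le> ?Bd" if F: "F \<in> G s" for F s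
  proof -
    have "(\<Sum>t\<in>T. ?n F t) = (\<Sum>l\<in>Lab. \<Sum>j\<in>{1..k}. \<Sum>e\<in>restrictions P (Wm j). \<Prod>x\<in>graph_on (Wm j) e - base Wm F. Q x)"
    proof -
      define c where "c = (\<lambda>j e. \<Prod>x\<in>graph_on (Wm j) e - base Wm F. Q x)"
      have "(\<Sum>t\<in>T. ?n F t) = (\<Sum>(l, z)\<in>T. c (fst z) (snd z))"
        by (intro sum.cong) (auto simp: c_def base_def)
      also have "\<dots> = (\<Sum>l\<in>Lab. \<Sum>z\<in>(SIGMA j:{1..k}. restrictions P (Wm j)). c (fst z) (snd z))"
        unfolding T_def edge_choices_def by (rule sum.cartesian_product[symmetric])
      also have "\<dots> = (\<Sum>l\<in>Lab. \<Sum>j\<in>{1..k}. \<Sum>e\<in>restrictions P (Wm j). c j e)"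
        using fin_restrictions by (subst sum.Sigma) (auto simp: split_def)
      finally show ?thesis unfolding c_def .
    qed
    also have "\<dots> \<le> (\<Sum>l\<in>Lab. \<Sum>j\<in>{1..k}. 2 ^ (k + 1) * K * M)"
    proof (intro sum_mono)
      fix j assume j: "j \<in> {1..k}"
      have "(\<Sum>e\<in>restrictions P (Wm j). \<Prod>x\<in>graph_on (Wm j) e - base Wm F. Q x) \<le> 2 ^ (k + 1) * K * mean (Wm j)"
        using Wm[OF j] F by (intro new_edge_cost) (auto simp: G_def)
      also have "\<dots> \<le> 2 ^ (k + 1) * K * M" using Wm[OF j] K1 by (intro mult_left_mono) auto
      finally show "(\<Sum>e\<in>restrictions P (Wm j). \<Prod>x\<in>graph_on (Wm j) e - base Wm F. Q x) \<le> 2 ^ (k + 1) * K * M" .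
    qed
    finally show ?thesis by simp
  qed
  show ?thesis
  proof (induction s)
    case 0
    have "G 0 \<subseteq> {{}}" using finT by (auto simp: G_def T_def[symmetric] dest: finite_subset)
    then have "(\<Sum>F\<in>G 0. ?w F) \<le> (\<Sum>F\<in>{{}}. ?w F)"
      by (intro sum_mono2) (auto simp: base_def)
    then show ?case by (simp add: base_def)
  next
    case (Suc s)
    have w: "?w F = ?w (F - {t}) * ?n (F - {t}) t" if "F \<in> G (Suc s)" "t \<in> F" for F t
    proof -
      have "base Wm F = base Wm (F - {t}) \<union> (base Wm {t} - base Wm (F - {t}))"
        using that by (auto simp: base_def)
      moreover have "finite (base Wm F)"
        using base\<Omega>[of F] that fin_\<Omega> by (auto simp: G_def T_def intro: finite_subset)
      ultimately show ?thesis by (metis Diff_disjoint finite_Un prod.union_disjoint)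
    qed
    have del: "F - {t} \<in> G s \<and> t \<in> T" if "F \<in> G (Suc s)" "t \<in> F" for F t
    proof -
      have F: "F \<subseteq> T" "card F = Suc s" "moderate (base Wm F)" using that by (auto simp: G_def T_def)
      have "finite (base Wm F)" using base\<Omega>[OF F(1)] fin_\<Omega> finite_subset by blast
      moreover have "base Wm (F - {t}) \<subseteq> base Wm F" by (auto simp: base_def)
      ultimately have "moderate (base Wm (F - {t}))" using F(3) moderate_subset by blast
      moreover have "card (F - {t}) = s" using F(2) that(2) by simp
      ultimately show ?thesis using F(1) that(2) by (auto simp: G_def T_def)
    qed
    have "real (Suc s) * (\<Sum>F\<in>G (Suc s). ?w F) = (\<Sum>F\<in>G (Suc s). \<Sum>t\<in>F. ?w F)"
      by (simp add: sum_distrib_left G_def)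
    also have "\<dots> = (\<Sum>F\<in>G (Suc s). \<Sum>t\<in>F. ?w (F - {t}) * ?n (F - {t}) t)"
      using w by (intro sum.cong refl) auto
    also have "\<dots> = (\<Sum>(F, t)\<in>(SIGMA F:G (Suc s). F). ?w (F - {t}) * ?n (F - {t}) t)"
      using finG finT by (subst sum.Sigma) (auto simp: G_def T_def intro: finite_subset)
    also have "\<dots> = (\<Sum>z\<in>(\<lambda>(F, t). (F - {t}, t)) ` (SIGMA F:G (Suc s). F). ?w (fst z) * ?n (fst z) (snd z))"
    proof (subst sum.reindex)
      show "inj_on (\<lambda>(F, t). (F - {t}, t)) (SIGMA F:G (Suc s). F)"
        by (auto simp: inj_on_def)
    qed (auto intro!: sum.cong)
    also have "\<dots> \<le> (\<Sum>z\<in>G s \<times> T. ?w (fst z) * ?n (fst z) (snd z))"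
    proof (rule sum_mono2)
      show "finite (G s \<times> T)" using finG finT by simp
      show "(\<lambda>(F, t). (F - {t}, t)) ` (SIGMA F:G (Suc s). F) \<subseteq> G s \<times> T" using del by auto
      fix z assume "z \<in> G s \<times> T - (\<lambda>(F, t). (F - {t}, t)) ` (SIGMA F:G (Suc s). F)"
      then have "fst z \<subseteq> T" "{snd z} \<subseteq> T" by (auto simp: G_def T_def)
      then have "base Wm (fst z) \<subseteq> \<Omega>" "base Wm {snd z} - base Wm (fst z) \<subseteq> \<Omega>"
        using base\<Omega> by blast+
      then show "0 \<le> ?w (fst z) * ?n (fst z) (snd z)" using prod0 by (intro mult_nonneg_nonneg)
    qed
    also have "\<dots> = (\<Sum>F\<in>G s. ?w F * (\<Sum>t\<in>T. ?n F t))"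
      by (simp add: sum.cartesian_product' sum_distrib_left)
    also have "\<dots> \<le> (\<Sum>F\<in>G s. ?w F * ?Bd)"
    proof (rule sum_mono)
      fix F assume F: "F \<in> G s"
      then have "0 \<le> ?w F" using base\<Omega>[of F] by (intro prod0) (auto simp: G_def T_def)
      then show "?w F * (\<Sum>t\<in>T. ?n F t) \<le> ?w F * ?Bd" using step[OF F] by (rule mult_left_mono[rotated])
    qed
    also have "\<dots> = (\<Sum>F\<in>G s. ?w F) * ?Bd" by (rule sum_distrib_right[symmetric])
    also have "\<dots> \<le> (?Bd ^ s / fact s) * ?Bd"
      using Suc M0 K1 by (intro mult_right_mono mult_nonneg_nonneg) auto
    finally have "real (Suc s) * (\<Sum>F\<in>G (Suc s). ?w F) \<le> ?Bd ^ Suc s / fact s" by (simp add: mult_ac)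
    moreover have "x \<le> y / fact (Suc s)" if "real (Suc s) * x \<le> y / fact s" for x y :: real
    proof -
      have "x \<le> y / fact s / real (Suc s)"
        using that by (subst pos_le_divide_eq) (simp_all only: of_nat_0_less_iff zero_less_Suc mult.commute)
      then show ?thesis by (simp add: mult.commute)
    qed
    ultimately show ?case by blast
  qed
qed

text \<open>The union bound over the collections \<open>F\<close>. Only those with moderate union occur unless the random
  set itself fails to be moderate.\<close>

lemma bad_event_prob_le:
  fixes Lab :: "'l set" and r :: real
  assumes Lab: "finite Lab" and Wm: "\<And>j. j \<in> {1..k} \<Longrightarrow> Wm j \<noteq> {} \<and> Wm j \<subseteq> {1..k} \<and> mean (Wm j) \<le> M"
    and \<zeta>: "0 < \<zeta>" and S: "\<And>F. S F \<subseteq> P"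
    and bad: "\<And>A. A \<subseteq> \<Omega> \<Longrightarrow> bad A \<Longrightarrow> \<exists>F. F \<subseteq> edge_choices P k Lab Wm \<and> card F \<le> s \<and> base Wm F \<subseteq> A \<and>
      \<zeta> * real (card P) \<le> real (card (S F)) \<and> (\<forall>\<pi>\<in>S F. \<not> graph_on {1..k} \<pi> \<subseteq> A)"
  shows "expectation (\<lambda>A. of_bool (bad A)) \<le> 4 ^ k * K / m +
    (\<Sum>i\<le>s. (real (card Lab) * real k * (2 ^ (k + 1) * K * M)) ^ i / fact i) *
    exp (- (\<zeta>\<^sup>2 * m / (2 ^ (k + 1) * K)))"
proof -
  let ?T = "edge_choices P k Lab Wm"
  let ?G = "\<lambda>i. {F. F \<subseteq> ?T \<and> card F = i \<and> moderate (base Wm F)}"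
  let ?ex = "exp (- (\<zeta>\<^sup>2 * m / (2 ^ (k + 1) * K)))"
  define none where "none = (\<lambda>F A. of_bool (\<forall>\<pi>\<in>S F. \<not> graph_on {1..k} \<pi> \<subseteq> A) :: real)"
  define dense where "dense = (\<lambda>F. \<zeta> * real (card P) \<le> real (card (S F)))"
  have finT: "finite ?T" unfolding edge_choices_def using Lab fin_restrictions by auto
  have finG: "finite (?G i)" for i by (rule finite_subset[of _ "Pow ?T"]) (use finT in auto)
  have base\<Omega>: "base Wm F \<subseteq> \<Omega>" if "F \<subseteq> ?T" for F
    using that Wm by (intro base_subset) auto
  have "expectation (\<lambda>A. of_bool (bad A)) \<le> expectation (\<lambda>A. of_bool (\<not> moderate A) +
    (\<Sum>i\<le>s. \<Sum>F\<in>?G i. of_bool (dense F) * (of_bool (base Wm F \<subseteq> A) * none F A)))"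
  proof (rule subset_exp_mono)
    fix A assume A: "A \<subseteq> \<Omega>"
    let ?t = "\<lambda>F. of_bool (dense F) * (of_bool (base Wm F \<subseteq> A) * none F A)"
    have t0: "0 \<le> ?t F" for F by (simp add: none_def)
    have t1: "0 \<le> (\<Sum>i\<le>s. \<Sum>F\<in>?G i. ?t F)" by (intro sum_nonneg t0)
    show "of_bool (bad A) \<le> of_bool (\<not> moderate A) + (\<Sum>i\<le>s. \<Sum>F\<in>?G i. ?t F)"
    proof (cases "bad A \<and> moderate A")
      case False
      then show ?thesis using t1 by auto
    next
      case True
      then obtain F where F: "F \<subseteq> ?T" "card F \<le> s" "base Wm F \<subseteq> A" "dense F"
        "\<forall>\<pi>\<in>S F. \<not> graph_on {1..k} \<pi> \<subseteq> A"
        using bad[OF A] unfolding dense_def by blast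
      have "moderate (base Wm F)"
        using True F(3) finite_subset[OF A fin_\<Omega>] moderate_subset by blast
      then have FG: "F \<in> ?G (card F)" using F(1) by auto
      have "1 = ?t F" using F(3-5) by (simp add: none_def)
      also have "\<dots> \<le> (\<Sum>F\<in>?G (card F). ?t F)" using FG finG t0 by (intro member_le_sum) auto
      also have "\<dots> \<le> (\<Sum>i\<le>s. \<Sum>F\<in>?G i. ?t F)"
        using F(2) t0 by (intro member_le_sum[of "card F" "{..s}" "\<lambda>i. \<Sum>F\<in>?G i. ?t F"]) (auto intro!: sum_nonneg)
      finally show ?thesis using True by simp
    qed
  qed (use Q01 in auto)
  also have "\<dots> = expectation (\<lambda>A. of_bool (\<not> moderate A)) +
    (\<Sum>i\<le>s. \<Sum>F\<in>?G i. of_bool (dense F) * expectation (\<lambda>A. of_bool (base Wm F \<subseteq> A) * none F A))"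
    unfolding subset_exp_add subset_exp_sum subset_exp_cmult ..
  also have "\<dots> \<le> 4 ^ k * K / m + (\<Sum>i\<le>s. \<Sum>F\<in>?G i. (\<Prod>x\<in>base Wm F. Q x) * ?ex)"
  proof (intro add_mono prob_not_moderate_le sum_mono)
    fix i F assume F: "F \<in> ?G i"
    have b: "base Wm F \<subseteq> \<Omega>" using F base\<Omega> by auto
    have p0: "0 \<le> (\<Prod>x\<in>base Wm F. Q x)" using b Q01 by (intro prod_nonneg) auto
    show "of_bool (dense F) * expectation (\<lambda>A. of_bool (base Wm F \<subseteq> A) * none F A)
      \<le> (\<Prod>x\<in>base Wm F. Q x) * ?ex"
    proof (cases "dense F")
      case False
      then show ?thesis using p0 by simp
    next
      case True
      have "expectation (\<lambda>A. of_bool (base Wm F \<subseteq> A) * none F A) \<le> (\<Prod>x\<in>base Wm F. Q x) * expectation (none F)"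
      proof (rule subset_exp_superset_antimono[OF fin_\<Omega> b Q01])
        show "antimono (none F)" unfolding none_def by (rule antimonoI) (auto simp: of_bool_def)
      qed
      also have "\<dots> \<le> (\<Prod>x\<in>base Wm F. Q x) * ?ex"
        using p0 True S \<zeta> unfolding none_def dense_def by (intro mult_left_mono prob_no_typed_edge_le)
      finally show ?thesis using True by simp
    qed
  qed
  also have "(\<Sum>i\<le>s. \<Sum>F\<in>?G i. (\<Prod>x\<in>base Wm F. Q x) * ?ex) = (\<Sum>i\<le>s. \<Sum>F\<in>?G i. (\<Prod>x\<in>base Wm F. Q x)) * ?ex"
    by (simp only: sum_distrib_right)
  also have "\<dots> \<le> (\<Sum>i\<le>s. (real (card Lab) * real k * (2 ^ (k + 1) * K * M)) ^ i / fact i) * ?ex"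
    using choices_weight[OF Lab Wm] by (intro mult_right_mono sum_mono) auto
  finally show ?thesis by simp
qed

end

section \<open>Ordered hypergraphs\<close>

lemma finite_ord_edges:
  assumes "uniform_ordered_hypergraph k H" "finite (verts H)"
  shows "finite (ord_edges H)"
proof (rule finite_subset)
  show "ord_edges H \<subseteq> {1..k} \<rightarrow>\<^sub>E verts H"
  proof
    fix \<pi> assume "\<pi> \<in> ord_edges H"
    then obtain e where "\<pi> \<in> extensional {1..k}" "e \<in> edges H" "bij_betw \<pi> {1..k} e"
      using assms(1) unfolding uniform_ordered_hypergraph_def by blast
    moreover then have "e \<subseteq> verts H"
      using assms(1) unfolding uniform_ordered_hypergraph_def uniform_hypergraph_def by blast
    ultimately show "\<pi> \<in> {1..k} \<rightarrow>\<^sub>E verts H" by (auto simp: PiE_def bij_betw_def)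
  qed
  show "finite ({1..k} \<rightarrow>\<^sub>E verts H)" using assms(2) by (intro finite_PiE) auto
qed

lemma ord_edgeD:
  assumes "uniform_ordered_hypergraph k H" "\<pi> \<in> ord_edges H"
  shows "\<pi> \<in> extensional {1..k}" "inj_on \<pi> {1..k}" "\<pi> ` {1..k} \<in> edges H" "\<pi> ` {1..k} \<subseteq> verts H"
proof -
  obtain e where e: "\<pi> \<in> extensional {1..k}" "e \<in> edges H" "bij_betw \<pi> {1..k} e"
    using assms unfolding uniform_ordered_hypergraph_def by blast
  then show "\<pi> \<in> extensional {1..k}" "inj_on \<pi> {1..k}" "\<pi> ` {1..k} \<in> edges H" "\<pi> ` {1..k} \<subseteq> verts H"
    using assms(1) unfolding uniform_ordered_hypergraph_def uniform_hypergraph_def by (auto simp: bij_betw_def)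
qed

lemma edge_is_image:
  assumes "uniform_ordered_hypergraph k H" "e \<in> edges H"
  obtains \<pi> where "\<pi> \<in> ord_edges H" "e = \<pi> ` {1..k}"
  using assms unfolding uniform_ordered_hypergraph_def by blast

lemma osize_induced: "osize (induced k H U) = card {\<pi> \<in> ord_edges H. \<pi> ` {1..k} \<subseteq> U}"
  by (simp add: osize_def induced_def)

lemma osize_proj: "osize (proj H I) = card (restrictions (ord_edges H) I)"
  by (simp add: osize_def proj_def restrictions_def)

lemma card_edges_le_osize:
  assumes "uniform_ordered_hypergraph k H" "finite (verts H)"
  shows "card (edges H) \<le> osize H"
proof -
  have "edges H = (\<lambda>\<pi>. \<pi> ` {1..k}) ` ord_edges H"
    using assms(1) by (simp add: uniform_ordered_hypergraph_def)
  then show ?thesis unfolding osize_def using finite_ord_edges[OF assms] by (metis card_image_le)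
qed

text \<open>An edge of size \<open>k\<close> has \<open>k!\<close> orderings.\<close>

lemma card_ord_edges_within_le:
  assumes H: "uniform_ordered_hypergraph k H" "finite (verts H)"
  shows "card {\<pi> \<in> ord_edges H. \<pi> ` {1..k} \<subseteq> U} \<le> fact k * card {e \<in> edges H. e \<subseteq> U}"
proof -
  let ?E = "{e \<in> edges H. e \<subseteq> U}"
  let ?B = "\<lambda>e. {\<pi> \<in> {1..k} \<rightarrow>\<^sub>E e. inj_on \<pi> {1..k}}"
  have edges: "e \<subseteq> verts H \<and> finite e \<and> card e = k" if "e \<in> edges H" for e
    using H(1) that unfolding uniform_ordered_hypergraph_def uniform_hypergraph_def by blast
  have finE: "finite ?E"
    by (rule finite_subset[of _ "Pow (verts H)"])
      (use H(2) edges in auto)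
  have finB: "finite (?B e)" if "e \<in> ?E" for e
  proof -
    have "finite ({1..k} \<rightarrow>\<^sub>E e)" using edges[of e] that by (intro finite_PiE) auto
    then show ?thesis by simp
  qed
  have cardB: "card (?B e) = fact k" if "e \<in> ?E" for e
  proof -
    have "card (?B e) = (\<Prod>j = 0..<k. k - j)"
      using edges[of e] that by (subst card_inj_on_subset_funcset) auto
    then show ?thesis by (simp add: fact_prod_rev)
  qed
  have "{\<pi> \<in> ord_edges H. \<pi> ` {1..k} \<subseteq> U} \<subseteq> (\<Union>e\<in>?E. ?B e)"
  proof
    fix \<pi> assume \<pi>: "\<pi> \<in> {\<pi> \<in> ord_edges H. \<pi> ` {1..k} \<subseteq> U}"
    have "\<pi> \<in> ?B (\<pi> ` {1..k})" using ord_edgeD[OF H(1), of \<pi>] \<pi> by (auto simp: PiE_def)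
    moreover have "\<pi> ` {1..k} \<in> ?E" using ord_edgeD[OF H(1), of \<pi>] \<pi> by auto
    ultimately show "\<pi> \<in> (\<Union>e\<in>?E. ?B e)" by blast
  qed
  then have "card {\<pi> \<in> ord_edges H. \<pi> ` {1..k} \<subseteq> U} \<le> card (\<Union>e\<in>?E. ?B e)"
    using finE finB by (intro card_mono) auto
  also have "\<dots> \<le> (\<Sum>e\<in>?E. card (?B e))" using finE by (rule card_UN_le)
  also have "\<dots> = (\<Sum>e\<in>?E. fact k)" by (intro sum.cong refl cardB)
  finally show ?thesis by (simp add: mult.commute)
qed

lemma ramsey_mono:
  assumes "\<And>i. i \<in> {1..r} \<Longrightarrow> finite (ord_edges (H i))" "V \<subseteq> V'"
    and "ramsey r k V (\<lambda>i. induced (k i) (H i) V)"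
  shows "ramsey r k V' (\<lambda>i. induced (k i) (H i) V')"
  unfolding ramsey_def
proof (intro allI impI)
  fix U assume U: "is_partition r V' U"
  have "is_partition r V (\<lambda>i. U i \<inter> V)"
    using U assms(2) by (auto simp: is_partition_def disjoint_family_on_def)
  then obtain i where i: "i \<in> {1..r}" "0 < osize (induced (k i) (induced (k i) (H i) V) (U i \<inter> V))"
    using assms(3) unfolding ramsey_def by blast
  have "osize (induced (k i) (induced (k i) (H i) V) (U i \<inter> V))
      \<le> osize (induced (k i) (induced (k i) (H i) V') (U i))"
    unfolding osize_induced using assms(1)[OF i(1)] assms(2)
    by (intro card_mono) (auto simp: induced_def)
  then show "\<exists>i\<in>{1..r}. 0 < osize (induced (k i) (induced (k i) (H i) V') (U i))" using i by force
qed

lemma codegree_le_max_codeg: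
  assumes "finite (verts H)" "v \<in> verts H" "l < card (verts H)"
  shows "codegree (verts H) (edges H) l {v} \<le> max_codeg H (Suc l) v"
proof -
  let ?M = "{hdeg H T |T. v \<in> T \<and> T \<subseteq> verts H \<and> card T = Suc l}"
  have fin: "finite ?M"
    by (rule finite_subset[of _ "hdeg H ` Pow (verts H)"]) (use assms(1) in auto)
  have max: "hdeg H T \<le> max_codeg H (Suc l) v" if "v \<in> T" "T \<subseteq> verts H" "card T = Suc l" for T
    unfolding max_codeg_def using fin that by (intro Max_ge) auto
  have "x \<le> max_codeg H (Suc l) v"
    if "x \<in> insert 0 ((\<lambda>W. card {e \<in> edges H. W \<subseteq> e}) ` {W. {v} \<subseteq> W \<and> W \<subseteq> verts H \<and> card W = card {v} + l})" for x
    using that max by (auto simp: hdeg_def)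
  moreover have "finite ((\<lambda>W. card {e \<in> edges H. W \<subseteq> e}) ` {W. {v} \<subseteq> W \<and> W \<subseteq> verts H \<and> card W = card {v} + l})"
    using assms(1) by auto
  ultimately show ?thesis unfolding codegree_def by (subst Max_le_iff) auto
qed

text \<open>Since all summands of the co-degree function are nonnegative, each of them is bounded up to a
  constant depending on \<open>k\<close>.\<close>

lemma codegree_sum_le_codeg:
  assumes H: "uniform_ordered_hypergraph k H" "finite (verts H)" "k \<le> card (verts H)"
    and \<tau>: "0 < \<tau>" and \<delta>: "codeg k H \<tau> \<le> \<delta>" and l: "1 \<le> l" "l < k"
  shows "(\<Sum>v\<in>verts H. real (codegree (verts H) (edges H) l {v}))
    \<le> \<delta> * 2 ^ (k choose 2) * real k * \<tau> ^ l * real (card (edges H))"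
proof -
  let ?V = "verts H" and ?E = "edges H"
  have unif: "e \<subseteq> ?V \<and> finite e \<and> card e = k" if "e \<in> ?E" for e
    using H(1) that unfolding uniform_ordered_hypergraph_def uniform_hypergraph_def by blast
  have finE: "finite ?E" by (rule finite_subset[of _ "Pow ?V"]) (use H(2) unif in auto)
  have cpos: "0 < card ?V" using H(3) l by linarith
  have deg: "real (card ?V) * avg_deg H = real k * real (card ?E)"
  proof -
    have "(\<Sum>v\<in>?V. hdeg H {v}) = (\<Sum>e\<in>?E. card (e \<inter> ?V))"
      using sum_card_incidences[OF H(2) finE] by (simp add: hdeg_def)
    also have "\<dots> = (\<Sum>e\<in>?E. k)" using unif by (intro sum.cong) (auto simp: Int_absorb2)
    finally have "(\<Sum>v\<in>?V. real (hdeg H {v})) = real (card ?E * k)" by (simp flip: of_nat_sum)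
    then show ?thesis using cpos by (simp add: avg_deg_def)
  qed
  have nn: "0 \<le> codeg_j H \<tau> j" for j
    using \<tau> unfolding codeg_j_def avg_deg_def by (intro divide_nonneg_nonneg mult_nonneg_nonneg sum_nonneg) auto
  show ?thesis
  proof (cases "?E = {}")
    case True
    have "codegree ?V {} l {v} = 0" for v
    proof -
      have "insert 0 ((\<lambda>W. card {e \<in> {}. W \<subseteq> e}) ` {W. {v} \<subseteq> W \<and> W \<subseteq> ?V \<and> card W = card {v} + l}) = {0 :: nat}" (is "?L = _")
      proof (rule subset_antisym)
        show "?L \<subseteq> {0}" by force
      qed simp
      then have "Max ?L = 0" by (simp only: Max_singleton)
      then show ?thesis unfolding codegree_def True .
    qed
    then show ?thesis using True by simp
  next
    case False
    have Epos: "0 < real k * real (card ?E)" using False finE l by (simp add: card_gt_0_iff)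
    have j: "Suc l \<in> {2..k}" using l by auto
    have "codeg_j H \<tau> (Suc l) / 2 ^ (k choose 2) \<le> codeg_j H \<tau> (Suc l) / 2 ^ ((Suc l - 1) choose 2)"
    proof (rule divide_left_mono)
      have "(Suc l - 1) choose 2 \<le> k choose 2" using l by (intro binomial_right_mono) auto
      then show "(2::real) ^ ((Suc l - 1) choose 2) \<le> 2 ^ (k choose 2)" by (intro power_increasing) auto
    qed (use nn in auto)
    also have "\<dots> \<le> (\<Sum>j=2..k. codeg_j H \<tau> j / 2 ^ ((j - 1) choose 2))"
      using j nn by (intro member_le_sum[of "Suc l"]) auto
    also have "\<dots> = 1 * (\<Sum>j=2..k. codeg_j H \<tau> j / 2 ^ ((j - 1) choose 2))" by simp
    also have "\<dots> \<le> codeg k H \<tau>"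
      unfolding codeg_def by (intro mult_right_mono sum_nonneg divide_nonneg_nonneg nn) simp_all
    also note \<delta>
    finally have "codeg_j H \<tau> (Suc l) \<le> \<delta> * 2 ^ (k choose 2)" by (simp add: pos_divide_le_eq)
    then have "(\<Sum>v\<in>?V. real (max_codeg H (Suc l) v)) \<le> \<delta> * 2 ^ (k choose 2) * (\<tau> ^ l * (real k * real (card ?E)))"
    proof -
      have "0 < \<tau> ^ l * (real k * real (card ?E))" by (rule mult_pos_pos[OF zero_less_power[OF \<tau>] Epos])
      moreover have "codeg_j H \<tau> (Suc l)
          = (\<Sum>v\<in>?V. real (max_codeg H (Suc l) v)) / (\<tau> ^ l * (real k * real (card ?E)))"
        unfolding codeg_j_def mult.assoc deg by simp
      ultimately show ?thesis
        using \<open>codeg_j H \<tau> (Suc l) \<le> \<delta> * 2 ^ (k choose 2)\<close> by (simp only: pos_divide_le_eq)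
    qed
    moreover have "(\<Sum>v\<in>?V. real (codegree ?V ?E l {v})) \<le> (\<Sum>v\<in>?V. real (max_codeg H (Suc l) v))"
      using H l by (intro sum_mono of_nat_mono codegree_le_max_codeg) auto
    ultimately show ?thesis by (simp add: mult_ac)
  qed
qed

section \<open>Fingerprints of colourings that are not Ramsey\<close>

text \<open>Recovers the labelled vertices of colour \<open>i\<close> from the recorded edges.\<close>

definition fingerprint :: "'i \<Rightarrow> (('i \<times> nat) \<times> nat \<times> (nat \<Rightarrow> 'a)) set \<Rightarrow> (nat \<times> 'a) set" where
  "fingerprint i F = {(l, e j) |l j e. ((i, l), j, e) \<in> F}"

definition leftover :: "nat \<Rightarrow> 'a set \<Rightarrow> (nat \<Rightarrow> (nat \<times> 'a) set \<Rightarrow> 'a set) \<Rightarrow>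
    ((nat \<times> nat) \<times> nat \<times> (nat \<Rightarrow> 'a)) set \<Rightarrow> 'a set" where
  "leftover r V container F = V - (\<Union>i\<in>{2..r}. container i (fingerprint i F))"

text \<open>The containers, made disjoint by removing from each the earlier ones, and the rest form a partition
  of \<open>V\<close>. A container spans too few edges to satisfy the robust Ramsey property, so the rest must.\<close>

lemma leftover_dense:
  fixes H :: "nat \<Rightarrow> 'a ordered_hypergraph" and B :: "nat \<Rightarrow> 'a set"
  assumes r: "r \<ge> 2" and fin: "finite V"
    and H: "\<And>i. i \<in> {1..r} \<Longrightarrow> uniform_ordered_hypergraph (k i) (H i) \<and> verts (H i) = V"
    and kt: "\<And>i. i \<in> {2..r} \<Longrightarrow> k i \<le> t" and \<epsilon>: "0 < \<epsilon>" "fact t * \<epsilon> < \<zeta>"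
    and ram: "\<And>U. is_partition r V U \<Longrightarrow>
      \<exists>i\<in>{1..r}. real (osize (induced (k i) (H i) (U i))) > \<zeta> * real (osize (H i))"
    and B: "\<And>i. i \<in> {2..r} \<Longrightarrow> real (card {e \<in> edges (H i). e \<subseteq> B i}) \<le> \<epsilon> * real (card (edges (H i)))"
  shows "\<zeta> * real (osize (H 1)) < real (osize (induced (k 1) (H 1) (V - (\<Union>i\<in>{2..r}. B i))))"
proof -
  define U where "U = (\<lambda>i. if i = 1 then V - (\<Union>i\<in>{2..r}. B i) else V \<inter> B i - (\<Union>i'\<in>{2..<i}. B i'))"
  have "is_partition r V U"
    unfolding is_partition_def
  proof
    show "disjoint_family_on U {1..r}"
      unfolding disjoint_family_on_def
    proof (intro ballI impI)
      have "U i \<inter> U j = {}" if "i < j" "i \<in> {1..r}" "j \<in> {1..r}" for i j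
        using that by (cases "i = 1") (auto simp: U_def)
      then show "U i \<inter> U j = {}" if "i \<in> {1..r}" "j \<in> {1..r}" "i \<noteq> j" for i j
        using that by (metis Int_commute linorder_neqE_nat)
    qed
    show "(\<Union>i\<in>{1..r}. U i) = V"
    proof
      show "(\<Union>i\<in>{1..r}. U i) \<subseteq> V" by (auto simp: U_def)
      show "V \<subseteq> (\<Union>i\<in>{1..r}. U i)"
      proof
        fix v assume v: "v \<in> V"
        show "v \<in> (\<Union>i\<in>{1..r}. U i)"
        proof (cases "\<exists>i. i \<in> {2..r} \<and> v \<in> B i")
          case False
          then have "v \<in> U 1" using v by (auto simp: U_def)
          then show ?thesis using r by force
        next
          case True
          define i where "i = (LEAST i. i \<in> {2..r} \<and> v \<in> B i)"
          have i: "i \<in> {2..r}" "v \<in> B i" using LeastI_ex[OF True] by (auto simp: i_def)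
          have "v \<notin> B i'" if "i' \<in> {2..<i}" for i'
            using not_less_Least[of i' "\<lambda>i. i \<in> {2..r} \<and> v \<in> B i"] that i by (auto simp: i_def)
          then have "v \<in> U i" using i v by (auto simp: U_def)
          then show ?thesis using i(1) by (intro UN_I[of i]) auto
        qed
      qed
    qed
  qed
  then obtain i where i: "i \<in> {1..r}" "real (osize (induced (k i) (H i) (U i))) > \<zeta> * real (osize (H i))"
    using ram by blast
  have "i = 1"
  proof (rule ccontr)
    assume "i \<noteq> 1"
    then have i2: "i \<in> {2..r}" using i(1) by auto
    have Hi: "uniform_ordered_hypergraph (k i) (H i)" "finite (verts (H i))" using H[OF i(1)] fin by auto
    have "osize (induced (k i) (H i) (U i)) \<le> card {\<pi> \<in> ord_edges (H i). \<pi> ` {1..k i} \<subseteq> B i}"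
      unfolding osize_induced using finite_ord_edges[OF Hi] i2 by (intro card_mono) (auto simp: U_def)
    also have "\<dots> \<le> fact (k i) * card {e \<in> edges (H i). e \<subseteq> B i}"
      by (rule card_ord_edges_within_le[OF Hi])
    finally have "real (osize (induced (k i) (H i) (U i))) \<le> real (fact (k i) * card {e \<in> edges (H i). e \<subseteq> B i})"
      by (rule of_nat_mono)
    also have "\<dots> = fact (k i) * real (card {e \<in> edges (H i). e \<subseteq> B i})" by simp
    also have "\<dots> \<le> fact t * (\<epsilon> * real (osize (H i)))"
    proof (rule mult_mono)
      show "(fact (k i) :: real) \<le> fact t" using kt[OF i2] by (rule fact_mono)
      have "real (card {e \<in> edges (H i). e \<subseteq> B i}) \<le> \<epsilon> * real (card (edges (H i)))" by (rule B[OF i2])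
      also have "\<dots> \<le> \<epsilon> * real (osize (H i))"
        using card_edges_le_osize[OF Hi] \<epsilon> by (intro mult_left_mono) auto
      finally show "real (card {e \<in> edges (H i). e \<subseteq> B i}) \<le> \<epsilon> * real (osize (H i))" .
    qed auto
    also have "\<dots> = (fact t * \<epsilon>) * real (osize (H i))" by simp
    also have "\<dots> \<le> \<zeta> * real (osize (H i))" using \<epsilon>(2) by (intro mult_right_mono) auto
    finally show False using i(2) by simp
  qed
  then show ?thesis using i(2) by (simp add: U_def)
qed

text \<open>Let \<open>S\<close> be the set of vertices in typed edges. Containers are applied to \<open>U i \<inter> S\<close> rather than
  to \<open>U i\<close>, so that each fingerprint vertex comes with a typed edge. This loses nothing: a typed
  edge has all its vertices in \<open>S\<close>, so if it avoids all containers, it avoids \<open>U i\<close> for \<open>i \<ge> 2\<close>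
  and hence lies in \<open>U 1\<close>, which is impossible.\<close>

lemma not_ramsey_fingerprint:
  fixes H :: "nat \<Rightarrow> 'a ordered_hypergraph" and container :: "nat \<Rightarrow> (nat \<times> 'a) set \<Rightarrow> 'a set"
  defines "P \<equiv> ord_edges (H 1)"
  assumes r: "r \<ge> 2" and fin: "finite V"
    and H: "\<And>i. i \<in> {1..r} \<Longrightarrow> uniform_ordered_hypergraph (k i) (H i) \<and> verts (H i) = V"
    and kt: "\<And>i. i \<in> {2..r} \<Longrightarrow> k i \<le> t" and \<epsilon>: "0 < \<epsilon>" "fact t * \<epsilon> < \<zeta>"
    and ram: "\<And>U. is_partition r V U \<Longrightarrow>
      \<exists>i\<in>{1..r}. real (osize (induced (k i) (H i) (U i))) > \<zeta> * real (osize (H i))"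
    and container: "\<And>i. i \<in> {2..r} \<Longrightarrow>
      container_map V (edges (H i)) (L i) (s i) (\<epsilon> * real (card (edges (H i)))) (container i)"
    and Wm: "\<And>j. j \<in> {1..k 1} \<Longrightarrow> j \<in> Wm j \<and> Wm j \<subseteq> {1..k 1}"
    and A: "A \<subseteq> {1..k 1} \<times> V"
    and not_ramsey: "\<not> ramsey r k (snd ` A) (\<lambda>i. induced (k i) (H i) (snd ` A))"
  shows "\<exists>F. F \<subseteq> edge_choices P (k 1) (SIGMA i:{2..r}. {..<L i}) Wm \<and> real (card F) \<le> (\<Sum>i\<in>{2..r}. s i) \<and>
    base Wm F \<subseteq> A \<and>
    \<zeta> * real (card P) \<le> real (card {\<pi> \<in> P. \<pi> ` {1..k 1} \<subseteq> leftover r V container F}) \<and>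
    (\<forall>\<pi>\<in>{\<pi> \<in> P. \<pi> ` {1..k 1} \<subseteq> leftover r V container F}. \<not> graph_on {1..k 1} \<pi> \<subseteq> A)"
proof -
  obtain U where U: "is_partition r (snd ` A) U"
    "\<And>i. i \<in> {1..r} \<Longrightarrow> osize (induced (k i) (induced (k i) (H i) (snd ` A)) (U i)) = 0"
    using not_ramsey unfolding ramsey_def by auto
  have UA: "U i \<subseteq> snd ` A" if "i \<in> {1..r}" for i using U(1) that by (auto simp: is_partition_def)
  have AV: "snd ` A \<subseteq> V" using A by auto
  have indep: "\<not> \<pi> ` {1..k i} \<subseteq> U i" if i: "i \<in> {1..r}" and \<pi>: "\<pi> \<in> ord_edges (H i)" for i \<pi>
  proof
    assume sub: "\<pi> ` {1..k i} \<subseteq> U i"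
    have "finite (ord_edges (H i))" using finite_ord_edges H[OF i] fin by metis
    then have "{\<pi> \<in> ord_edges (induced (k i) (H i) (snd ` A)). \<pi> ` {1..k i} \<subseteq> U i} = {}"
      using U(2)[OF i] by (simp add: osize_induced) (simp add: induced_def)
    then show False using sub \<pi> UA[OF i] by (auto simp: induced_def)
  qed
  define Typed where "Typed = {\<pi> \<in> P. graph_on {1..k 1} \<pi> \<subseteq> A}"
  define S where "S = (\<Union>\<pi>\<in>Typed. \<pi> ` {1..k 1})"
  have "\<exists>\<Phi>. \<Phi> \<subseteq> {..<L i} \<times> (U i \<inter> S) \<and> real (card \<Phi>) \<le> s i \<and> U i \<inter> S \<subseteq> container i \<Phi> \<and>
    real (card {e \<in> edges (H i). e \<subseteq> container i \<Phi>}) \<le> \<epsilon> * real (card (edges (H i)))" (is "\<exists>\<Phi>. ?good i \<Phi>") if i: "i \<in> {2..r}" for i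
  proof -
    have i1: "i \<in> {1..r}" using i by auto
    have "U i \<inter> S \<subseteq> V" using UA[OF i1] AV by auto
    moreover have "\<forall>e\<in>edges (H i). \<not> e \<subseteq> U i \<inter> S"
    proof
      fix e assume "e \<in> edges (H i)"
      then obtain \<pi> where "\<pi> \<in> ord_edges (H i)" "e = \<pi> ` {1..k i}"
        using edge_is_image[of "k i" "H i"] H[OF i1] by metis
      then show "\<not> e \<subseteq> U i \<inter> S" using indep[OF i1] by auto
    qed
    ultimately show ?thesis by (rule container_mapE[OF container[OF i]]) blast
  qed
  then have "\<forall>i. \<exists>\<Phi>. i \<in> {2..r} \<longrightarrow> ?good i \<Phi>" by simp
  then obtain \<Phi> where "\<forall>i. i \<in> {2..r} \<longrightarrow> ?good i (\<Phi> i)" by (rule choice[THEN exE])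
  then have \<Phi>: "\<And>i. i \<in> {2..r} \<Longrightarrow> \<Phi> i \<subseteq> {..<L i} \<times> (U i \<inter> S)"
    "\<And>i. i \<in> {2..r} \<Longrightarrow> real (card (\<Phi> i)) \<le> s i" "\<And>i. i \<in> {2..r} \<Longrightarrow> U i \<inter> S \<subseteq> container i (\<Phi> i)"
    "\<And>i. i \<in> {2..r} \<Longrightarrow> real (card {e \<in> edges (H i). e \<subseteq> container i (\<Phi> i)}) \<le> \<epsilon> * real (card (edges (H i)))"
    by simp_all
  have "\<exists>z. fst z \<in> {1..k 1} \<and> snd z \<in> restrictions P (Wm (fst z)) \<and> snd z (fst z) = v \<and>
    graph_on (Wm (fst z)) (snd z) \<subseteq> A" (is "\<exists>z. ?covers v z") if v: "v \<in> S" for v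
  proof -
    obtain \<pi> j where \<pi>: "\<pi> \<in> P" "graph_on {1..k 1} \<pi> \<subseteq> A" and j: "j \<in> {1..k 1}" "v = \<pi> j"
      using v by (auto simp: S_def Typed_def)
    have "graph_on (Wm j) (restrict \<pi> (Wm j)) \<subseteq> A"
      using \<pi>(2) Wm[OF j(1)] by (fastforce simp: graph_on_def)
    then show ?thesis using j \<pi>(1) Wm[OF j(1)]
      by (intro exI[of _ "(j, restrict \<pi> (Wm j))"]) (auto simp: restrictions_def)
  qed
  then have "\<forall>v. \<exists>z. v \<in> S \<longrightarrow> ?covers v z" by simp
  then obtain g where "\<forall>v. v \<in> S \<longrightarrow> ?covers v (g v)" by (rule choice[THEN exE])
  then have g: "\<And>v. v \<in> S \<Longrightarrow> fst (g v) \<in> {1..k 1}"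
    "\<And>v. v \<in> S \<Longrightarrow> snd (g v) \<in> restrictions P (Wm (fst (g v)))"
    "\<And>v. v \<in> S \<Longrightarrow> snd (g v) (fst (g v)) = v" "\<And>v. v \<in> S \<Longrightarrow> graph_on (Wm (fst (g v))) (snd (g v)) \<subseteq> A"
    by simp_all
  define F where "F = (\<Union>i\<in>{2..r}. (\<lambda>(l, v). ((i, l), g v)) ` \<Phi> i)"
  have fin\<Phi>: "finite (\<Phi> i)" if i: "i \<in> {2..r}" for i
  proof -
    have "U i \<subseteq> V" using UA[of i] AV i by auto
    then have "\<Phi> i \<subseteq> {..<L i} \<times> V" using \<Phi>(1)[OF i] by auto
    then show ?thesis using fin by (meson finite_SigmaI finite_lessThan finite_subset)
  qed
  have F1: "F \<subseteq> edge_choices P (k 1) (SIGMA i:{2..r}. {..<L i}) Wm"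
  proof
    fix x assume "x \<in> F"
    then obtain i l v where x: "x = ((i, l), g v)" "i \<in> {2..r}" "(l, v) \<in> \<Phi> i" by (auto simp: F_def)
    then have "l < L i" "v \<in> S" using \<Phi>(1)[OF x(2)] by auto
    moreover have "g v \<in> (SIGMA j:{1..k 1}. restrictions P (Wm j))"
      using g(1,2)[OF \<open>v \<in> S\<close>] by (cases "g v") auto
    ultimately show "x \<in> edge_choices P (k 1) (SIGMA i:{2..r}. {..<L i}) Wm"
      using x(1,2) by (simp add: edge_choices_def)
  qed
  have F2: "real (card F) \<le> (\<Sum>i\<in>{2..r}. s i)"
  proof -
    have "card F \<le> (\<Sum>i\<in>{2..r}. card ((\<lambda>(l, v). ((i, l), g v)) ` \<Phi> i))"
      unfolding F_def by (intro card_UN_le) auto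
    also have "\<dots> \<le> (\<Sum>i\<in>{2..r}. card (\<Phi> i))" using fin\<Phi> by (intro sum_mono card_image_le) auto
    finally have "real (card F) \<le> (\<Sum>i\<in>{2..r}. real (card (\<Phi> i)))"
      unfolding of_nat_sum[symmetric] by (rule of_nat_mono)
    also have "\<dots> \<le> (\<Sum>i\<in>{2..r}. s i)" using \<Phi>(2) by (intro sum_mono) auto
    finally show ?thesis .
  qed
  have F3: "base Wm F \<subseteq> A"
  proof
    fix x assume "x \<in> base Wm F"
    then obtain i l v where x: "i \<in> {2..r}" "(l, v) \<in> \<Phi> i" "x \<in> graph_on (Wm (fst (g v))) (snd (g v))"
      by (auto simp: base_def F_def split_def)
    then show "x \<in> A" using g(4)[of v] \<Phi>(1)[OF x(1)] by auto
  qed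
  have fing: "fingerprint i F = \<Phi> i" if i: "i \<in> {2..r}" for i
  proof
    show "fingerprint i F \<subseteq> \<Phi> i"
    proof
      fix x assume "x \<in> fingerprint i F"
      then obtain l j e where x: "x = (l, e j)" "((i, l), j, e) \<in> F" by (auto simp: fingerprint_def)
      then obtain v where v: "(l, v) \<in> \<Phi> i" "g v = (j, e)" by (auto simp: F_def)
      then have "e j = v" using g(3)[of v] \<Phi>(1)[OF i] by auto
      then show "x \<in> \<Phi> i" using x v by simp
    qed
    show "\<Phi> i \<subseteq> fingerprint i F"
    proof
      fix x assume x: "x \<in> \<Phi> i"
      obtain l v where lv: "x = (l, v)" by (cases x)
      have "snd (g v) (fst (g v)) = v" using g(3)[of v] \<Phi>(1)[OF i] x lv by auto
      moreover have "((i, l), fst (g v), snd (g v)) \<in> F" using x lv i by (force simp: F_def)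
      ultimately show "x \<in> fingerprint i F" unfolding fingerprint_def lv by (intro CollectI exI[of _ l] exI[of _ "fst (g v)"] exI[of _ "snd (g v)"]) simp
    qed
  qed
  have left: "leftover r V container F = V - (\<Union>i\<in>{2..r}. container i (\<Phi> i))"
    unfolding leftover_def using fing by auto
  have "\<zeta> * real (card P) \<le> real (card {\<pi> \<in> P. \<pi> ` {1..k 1} \<subseteq> leftover r V container F})"
    using leftover_dense[OF r fin H kt \<epsilon> ram \<Phi>(4)] unfolding left osize_induced
    by (simp add: osize_def P_def)
  moreover have "\<not> graph_on {1..k 1} \<pi> \<subseteq> A"
    if \<pi>: "\<pi> \<in> P" "\<pi> ` {1..k 1} \<subseteq> leftover r V container F" for \<pi>
  proof
    assume typed: "graph_on {1..k 1} \<pi> \<subseteq> A"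
    have "\<pi> ` {1..k 1} \<subseteq> U 1"
    proof
      fix v assume v: "v \<in> \<pi> ` {1..k 1}"
      have "v \<in> S" using v \<pi>(1) typed by (auto simp: S_def Typed_def)
      have "v \<in> snd ` A" using v typed by (force simp: graph_on_def)
      then obtain i where i: "i \<in> {1..r}" "v \<in> U i" using U(1) unfolding is_partition_def by blast
      have "i = 1"
      proof (rule ccontr)
        assume "i \<noteq> 1"
        then have i2: "i \<in> {2..r}" using i by auto
        then have "v \<in> container i (\<Phi> i)" using \<Phi>(3) i(2) \<open>v \<in> S\<close> by auto
        then show False using v \<pi>(2) i2 unfolding left by auto
      qed
      then show "v \<in> U 1" using i by simp
    qed
    then show False using indep[of 1 \<pi>] \<pi>(1) r by (auto simp: P_def)
  qed
  ultimately show ?thesis using F1 F2 F3 by (intro exI[of _ F]) auto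
qed

section \<open>The probability bound and the choice of the constants\<close>

text \<open>For \<open>i \<le> s \<le> c * x\<close> the factor \<open>(B / c) ^ i\<close> is at most \<open>(B / c) powr (c * x)\<close>, which leaves a
  partial sum of \<open>exp (c * x)\<close>.\<close>

lemma exp_partial_sum_le:
  fixes B c x :: real
  assumes "0 < c" "c \<le> B" "0 \<le> x" "real s \<le> c * x" "0 \<le> y" "y \<le> B * x"
  shows "(\<Sum>i\<le>s. y ^ i / fact i) \<le> exp (c * x * (1 + ln (B / c)))"
proof -
  have Bc: "1 \<le> B / c" using assms by simp
  have "(\<Sum>i\<le>s. y ^ i / fact i) \<le> (\<Sum>i\<le>s. exp (ln (B / c) * (c * x)) * ((c * x) ^ i / fact i))"
  proof (rule sum_mono)
    fix i assume i: "i \<in> {..s}"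
    have "(B / c) ^ i = exp (ln (B / c) * real i)"
      using Bc by (simp add: exp_of_nat2_mult)
    also have "\<dots> \<le> exp (ln (B / c) * (c * x))"
      using i assms(4) Bc by (intro iffD2[OF exp_le_cancel_iff] mult_left_mono) auto
    finally have e: "(B / c) ^ i \<le> exp (ln (B / c) * (c * x))" .
    have "y ^ i \<le> (B * x) ^ i" using assms by (intro power_mono) auto
    also have "\<dots> = (B / c) ^ i * (c * x) ^ i" using assms(1) by (simp add: power_mult_distrib[symmetric])
    also have "\<dots> \<le> exp (ln (B / c) * (c * x)) * (c * x) ^ i"
      using e assms by (intro mult_right_mono) auto
    finally show "y ^ i / fact i \<le> exp (ln (B / c) * (c * x)) * ((c * x) ^ i / fact i)"
      by (simp add: divide_right_mono)
  qed
  also have "\<dots> = exp (ln (B / c) * (c * x)) * (\<Sum>i\<le>s. (c * x) ^ i / fact i)"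
    by (simp add: sum_distrib_left)
  also have "(\<Sum>i\<le>s. (c * x) ^ i / fact i) \<le> exp (c * x)"
  proof -
    have "(\<lambda>i. (c * x) ^ i / fact i) sums exp (c * x)"
      using exp_converges[of "c * x"] by (simp add: divide_inverse mult.commute)
    then show ?thesis
      using assms sum_le_suminf[of "\<lambda>i. (c * x) ^ i / fact i" "{..s}"] by (simp add: sums_iff)
  qed
  finally show ?thesis by (simp add: exp_add[symmetric] algebra_simps)
qed

lemma linear_beats_log:
  fixes a b c :: real
  assumes "0 < a" "0 < b" "0 < c"
  shows "\<exists>C0\<ge>1. c * (1 + ln ((b * C0 ^ k + c) / c)) + 1 \<le> a * C0"
proof -
  define \<alpha> where "\<alpha> = c * (1 + ln ((b + c) / c)) + 1"
  have "((\<lambda>x. \<alpha> * inverse x + c * real k * (ln x / x)) \<longlongrightarrow> \<alpha> * 0 + c * real k * 0) at_top"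
    by (intro tendsto_intros tendsto_inverse_0_at_top filterlim_ident ln_x_over_x_tendsto_0)
  then have "\<forall>\<^sub>F x in at_top. \<alpha> * inverse x + c * real k * (ln x / x) < a"
    using assms(1) by (intro order_tendstoD(2)) auto
  then obtain N where N: "\<And>x. x \<ge> N \<Longrightarrow> \<alpha> * inverse x + c * real k * (ln x / x) < a"
    by (auto simp: eventually_at_top_linorder)
  define C0 where "C0 = max 1 N"
  have C0: "C0 \<ge> 1" "C0 \<ge> N" by (auto simp: C0_def)
  have "(b * C0 ^ k + c) / c \<le> (b + c) / c * C0 ^ k"
  proof -
    have "1 \<le> C0 ^ k" using C0 by simp
    then have "c * 1 \<le> c * C0 ^ k" using assms by (intro mult_left_mono) auto
    then show ?thesis using assms by (simp add: field_simps)
  qed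
  then have "ln ((b * C0 ^ k + c) / c) \<le> ln ((b + c) / c * C0 ^ k)"
    using assms C0 by (subst ln_le_cancel_iff) (auto intro!: divide_pos_pos add_pos_pos mult_pos_pos)
  also have "\<dots> = ln ((b + c) / c) + real k * ln C0"
    using assms C0 by (subst ln_mult) (auto simp: ln_realpow)
  finally have "c * (1 + ln ((b * C0 ^ k + c) / c)) + 1 \<le> c * (1 + (ln ((b + c) / c) + real k * ln C0)) + 1"
    using assms by simp
  also have "\<dots> = \<alpha> + c * real k * ln C0" by (simp add: \<alpha>_def algebra_simps)
  also have "\<dots> = (\<alpha> * inverse C0 + c * real k * (ln C0 / C0)) * C0"
    using C0 by (simp add: field_simps)
  also have "\<dots> \<le> a * C0" using N[OF C0(2)] C0 by (intro mult_right_mono) auto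
  finally show ?thesis using C0 by blast
qed

text \<open>All the ingredients at a fixed \<open>n\<close>, with \<open>x\<close> in the role of \<open>\<tau> n * n\<close>. The role \<open>i\<close> is sampled
  with density \<open>C0 * p powr w i \<le> C0 * p\<close>, so the \<open>k 1\<close> roles of a vertex together stay within \<open>q\<close>. The
  exponents \<open>1 \<le> |I| \<le> k 1\<close> of \<open>C0\<close> account for the factor \<open>C0\<close> in the lower bound for all projections and
  \<open>C0 ^ k 1\<close> in the upper bound for the minimisers.\<close>

lemma non_ramsey_probability_le:
  fixes H :: "nat \<Rightarrow> nat ordered_hypergraph" and w :: "nat \<Rightarrow> real" and x :: real
    and container :: "nat \<Rightarrow> (nat \<times> nat) set \<Rightarrow> nat set"
  defines "K' \<equiv> \<lambda>K. max 1 (K :: real)"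
  assumes r: "r \<ge> 2" and k1: "1 \<le> k 1"
    and H: "\<And>i. i \<in> {1..r} \<Longrightarrow> uniform_ordered_hypergraph (k i) (H i) \<and> verts (H i) = {1..n}"
    and kt: "\<And>i. i \<in> {2..r} \<Longrightarrow> k i \<le> t" and \<epsilon>: "0 < \<epsilon>" "fact t * \<epsilon> < \<zeta>"
    and ram: "\<And>U. is_partition r {1..n} U \<Longrightarrow>
      \<exists>i\<in>{1..r}. real (osize (induced (k i) (H i) (U i))) > \<zeta> * real (osize (H i))"
    and container: "\<And>i. i \<in> {2..r} \<Longrightarrow>
      container_map {1..n} (edges (H i)) (L i) (s i) (\<epsilon> * real (card (edges (H i)))) (container i)"
    and tamed: "tamed (k 1) K (H 1)"
    and p: "0 < p" "p \<le> 1" and w: "\<And>i. i \<in> {1..k 1} \<Longrightarrow> w i \<ge> 1"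
    and x: "0 < x" and lower_min: "c' * x \<le> min_weighted_size (k 1) p w (H 1)" and c': "0 < c'"
    and upper: "min_weighted_size (k 1) p w (H 1) \<le> C' * x"
    and proper: "\<And>i. i \<in> {1..k 1} \<Longrightarrow> \<exists>W. minimiser (k 1) p w (H 1) W \<and> i \<in> W"
    and C0: "1 \<le> C0" "C0 * p \<le> 1"
    and qb: "0 \<le> q" "q \<le> 1" "real (k 1) * (C0 * p) \<le> q"
    and S: "(\<Sum>i\<in>{2..r}. s i) < real S + 1"
  shows "measure_pmf.prob (random_subset n q) {V. ramsey r k V (\<lambda>i. induced (k i) (H i) V)} \<ge>
    1 - (4 ^ k 1 * K' K / (C0 * (c' * x)) +
      (\<Sum>i\<le>S. (real (card (SIGMA i:{2..r}. {..<L i})) * real (k 1) * (2 ^ (k 1 + 1) * K' K * (C0 ^ k 1 * (C' * x)))) ^ i / fact i) *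
      exp (- (\<zeta>\<^sup>2 * (C0 * (c' * x)) / (2 ^ (k 1 + 1) * K' K))))"
proof -
  define P where "P = ord_edges (H 1)"
  define qi where "qi = (\<lambda>i. C0 * p powr w i)"
  have one: "1 \<in> {1..r}" using r by auto
  have fin_ord: "finite (ord_edges (H i))" if "i \<in> {1..r}" for i
    using H[OF that] by (intro finite_ord_edges) auto
  have finP: "finite P" unfolding P_def by (rule fin_ord[OF one])
  have \<zeta>0: "0 < \<zeta>"
  proof -
    have "0 < fact t * \<epsilon>" using \<epsilon> by simp
    then show ?thesis using \<epsilon>(2) by linarith
  qed
  have qi: "0 < qi i \<and> qi i \<le> C0 * p" if "i \<in> {1..k 1}" for i
  proof -
    have "p powr w i \<le> p powr 1" using p w[OF that] by (intro powr_mono') auto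
    then show ?thesis using p C0 by (auto simp: qi_def)
  qed
  have mws: "min_weighted_size (k 1) p w (H 1) \<le> weighted_size p w (H 1) I" if "I \<noteq> {}" "I \<subseteq> {1..k 1}" for I
  proof -
    have "finite {I. I \<noteq> {} \<and> I \<subseteq> {1..k 1}}" by (rule finite_subset[of _ "Pow {1..k 1}"]) auto
    then show ?thesis unfolding min_weighted_size_def using that by (intro Min_le) auto
  qed
  have mean_eq: "(\<Prod>i\<in>I. qi i) * real (card (restrictions P I)) = C0 ^ card I * weighted_size p w (H 1) I" for I
    using p by (simp add: qi_def prod.distrib weighted_size_def osize_proj P_def powr_sum)
  have lower': "C0 * (c' * x) \<le> (\<Prod>i\<in>I. qi i) * real (card (restrictions P I))"
    if I: "I \<noteq> {}" "I \<subseteq> {1..k 1}" for I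
  proof -
    have "finite I" using I finite_subset by auto
    then have "1 \<le> card I" using I by (simp add: Suc_le_eq card_gt_0_iff)
    then have "C0 ^ 1 \<le> C0 ^ card I" using C0 by (intro power_increasing) auto
    moreover have "c' * x \<le> weighted_size p w (H 1) I" using lower_min mws[OF I] by linarith
    ultimately show ?thesis unfolding mean_eq using C0 c' x by (intro mult_mono) auto
  qed
  have P_ne: "P \<noteq> {}"
  proof
    assume "P = {}"
    then have "C0 * (c' * x) \<le> 0" using lower'[of "{1}"] k1 by (simp add: restrictions_def)
    moreover have "0 < C0 * (c' * x)" using C0 c' x by simp
    ultimately show False by linarith
  qed
  interpret typed_sampling P "k 1" "{1..n}" qi "K' K" "C0 * (c' * x)"
  proof
    show "\<pi> \<in> extensional {1..k 1}" "\<pi> ` {1..k 1} \<subseteq> {1..n}" if "\<pi> \<in> P" for \<pi>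
      using ord_edgeD[of "k 1" "H 1" \<pi>] H[OF one] that by (auto simp: P_def)
    show "0 < qi i \<and> qi i \<le> 1" if "i \<in> {1..k 1}" for i using qi[OF that] C0 by auto
    show "0 < C0 * (c' * x)" using C0 c' x by simp
    show "C0 * (c' * x) \<le> (\<Prod>i\<in>I. qi i) * real (card (restrictions P I))"
      if "I \<noteq> {}" "I \<subseteq> {1..k 1}" for I by (rule lower'[OF that])
    fix I W \<pi> assume I: "I \<noteq> {}" "I \<subseteq> W" "W \<subseteq> {1..k 1}" and \<pi>: "\<pi> \<in> P"
    show "real (card {\<sigma> \<in> restrictions P W. restrict \<sigma> I = restrict \<pi> I}) * real (card (restrictions P I))
      \<le> K' K * real (card (restrictions P W))"
    proof (cases "I = W")
      case True
      have "{\<sigma> \<in> restrictions P W. restrict \<sigma> W = restrict \<pi> W} \<subseteq> {restrict \<pi> W}"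
        by (auto simp: restrictions_def)
      then have "card {\<sigma> \<in> restrictions P W. restrict \<sigma> W = restrict \<pi> W} \<le> 1"
        using card_mono[of "{restrict \<pi> W}"] by simp
      then have "real (card {\<sigma> \<in> restrictions P W. restrict \<sigma> W = restrict \<pi> W}) \<le> 1" by simp
      then have "real (card {\<sigma> \<in> restrictions P W. restrict \<sigma> W = restrict \<pi> W}) \<le> K' K"
        unfolding K'_def by (rule order_trans) simp
      then show ?thesis unfolding True by (intro mult_right_mono) auto
    next
      case False
      have u: "restrict \<pi> I \<in> ord_edges (proj (H 1) I)" using \<pi> by (simp add: proj_def P_def)
      have cI: "0 < real (card (restrictions P I))"
        using finP P_ne by (simp add: card_gt_0_iff restrictions_def)
      have "real (proj_deg (H 1) W I (restrict \<pi> I)) \<le> K * real (osize (proj (H 1) W)) / real (osize (proj (H 1) I))"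
        using tamed I False u unfolding tamed_def by blast
      then have "real (card {\<sigma> \<in> restrictions P W. restrict \<sigma> I = restrict \<pi> I})
          \<le> K * real (card (restrictions P W)) / real (card (restrictions P I))"
        unfolding osize_proj by (simp add: proj_deg_def proj_def restrictions_def P_def)
      then have "real (card {\<sigma> \<in> restrictions P W. restrict \<sigma> I = restrict \<pi> I}) * real (card (restrictions P I))
          \<le> K * real (card (restrictions P W))"
        using cI by (simp add: pos_le_divide_eq)
      also have "\<dots> \<le> K' K * real (card (restrictions P W))" by (intro mult_right_mono) (auto simp: K'_def)
      finally show ?thesis .
    qed
  qed (use finP P_ne k1 in \<open>auto simp: K'_def\<close>)
  define Wm where "Wm = (\<lambda>j. SOME W. minimiser (k 1) p w (H 1) W \<and> j \<in> W)"
  have Wm: "minimiser (k 1) p w (H 1) (Wm j) \<and> j \<in> Wm j" if "j \<in> {1..k 1}" for j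
    unfolding Wm_def by (rule someI_ex[OF proper[OF that]])
  have Wm_sub: "j \<in> Wm j \<and> Wm j \<subseteq> {1..k 1}" if "j \<in> {1..k 1}" for j
    using Wm[OF that] by (auto simp: minimiser_def)
  have mean_Wm: "mean (Wm j) \<le> C0 ^ k 1 * (C' * x)" if j: "j \<in> {1..k 1}" for j
  proof -
    have min: "weighted_size p w (H 1) (Wm j) = min_weighted_size (k 1) p w (H 1)"
      using Wm[OF j] by (simp add: minimiser_def)
    have "card (Wm j) \<le> k 1" using card_mono[of "{1..k 1}" "Wm j"] Wm_sub[OF j] by simp
    then have "C0 ^ card (Wm j) \<le> C0 ^ k 1" using C0 by (intro power_increasing) auto
    moreover have "0 \<le> min_weighted_size (k 1) p w (H 1)" using lower_min mult_pos_pos[OF c' x] by linarith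
    ultimately show ?thesis
      unfolding mean_def qprod_def mean_eq min using upper C0 by (intro mult_mono) auto
  qed
  let ?R = "\<lambda>V. ramsey r k V (\<lambda>i. induced (k i) (H i) V)"
  let ?Lab = "SIGMA i:{2..r}. {..<L i}"
  let ?S = "\<lambda>F. {\<pi> \<in> P. \<pi> ` {1..k 1} \<subseteq> leftover r {1..n} container F}"
  have bad: "expectation (\<lambda>A. of_bool (\<not> ?R (snd ` A))) \<le> 4 ^ k 1 * K' K / (C0 * (c' * x)) +
      (\<Sum>i\<le>S. (real (card ?Lab) * real (k 1) * (2 ^ (k 1 + 1) * K' K * (C0 ^ k 1 * (C' * x)))) ^ i / fact i) *
      exp (- (\<zeta>\<^sup>2 * (C0 * (c' * x)) / (2 ^ (k 1 + 1) * K' K)))"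
  proof (rule bad_event_prob_le[where Wm = Wm and S = ?S])
    fix A assume A: "A \<subseteq> \<Omega>" "\<not> ?R (snd ` A)"
    have "\<exists>F. F \<subseteq> edge_choices P (k 1) ?Lab Wm \<and> real (card F) \<le> (\<Sum>i\<in>{2..r}. s i) \<and>
      base Wm F \<subseteq> A \<and> \<zeta> * real (card P) \<le> real (card (?S F)) \<and>
      (\<forall>\<pi>\<in>?S F. \<not> graph_on {1..k 1} \<pi> \<subseteq> A)" (is "\<exists>F. ?good F")
      unfolding P_def
      by (rule not_ramsey_fingerprint[OF r finite_atLeastAtMost H kt \<epsilon> ram container Wm_sub
          A(1)[unfolded \<Omega>_def] A(2)])
    then obtain F where "?good F" ..
    then have F: "F \<subseteq> edge_choices P (k 1) ?Lab Wm" "real (card F) \<le> (\<Sum>i\<in>{2..r}. s i)"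
      "base Wm F \<subseteq> A" "\<zeta> * real (card P) \<le> real (card (?S F))"
      "\<forall>\<pi>\<in>?S F. \<not> graph_on {1..k 1} \<pi> \<subseteq> A" by simp_all
    have "card F \<le> S" using F(2) S by linarith
    then show "\<exists>F. F \<subseteq> edge_choices P (k 1) ?Lab Wm \<and> card F \<le> S \<and> base Wm F \<subseteq> A \<and>
      \<zeta> * real (card P) \<le> real (card (?S F)) \<and> (\<forall>\<pi>\<in>?S F. \<not> graph_on {1..k 1} \<pi> \<subseteq> A)"
      using F(1,3,4,5) by (intro exI[of _ F] conjI)
  qed (use Wm_sub mean_Wm \<zeta>0 in auto)
  have "expectation (\<lambda>A. of_bool (?R (snd ` A))) \<le> subset_exp {1..n} (\<lambda>_. q) (\<lambda>V. of_bool (?R V))"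
  proof (rule subset_exp_image_le)
    show "mono (\<lambda>V. of_bool (?R V) :: real)"
      using ramsey_mono[of r H _ _ k] fin_ord by (auto intro!: monoI simp: of_bool_def)
    show "snd ` \<Omega> \<subseteq> {1..n}" unfolding \<Omega>_def by auto
    show "0 \<le> Q z" if "z \<in> \<Omega>" for z using Q01[OF that] by simp
    fix v assume v: "v \<in> {1..n}"
    have "{z. z \<in> \<Omega> \<and> snd z = v} = (\<lambda>i. (i, v)) ` {1..k 1}" using v unfolding \<Omega>_def by auto
    then have "(\<Sum>z | z \<in> \<Omega> \<and> snd z = v. Q z) = (\<Sum>i\<in>{1..k 1}. qi i)"
      by (simp add: sum.reindex inj_on_def Q_def)
    also have "\<dots> \<le> (\<Sum>i\<in>{1..k 1}. C0 * p)" using qi by (intro sum_mono) auto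
    also have "\<dots> \<le> q" using qb(3) by simp
    finally show "(\<Sum>z | z \<in> \<Omega> \<and> snd z = v. Q z) \<le> q" .
  qed (use fin_\<Omega> qb in simp_all)
  also have "\<dots> = measure_pmf.prob (random_subset n q) {V. ?R V}"
    using qb by (intro prob_random_subset[symmetric])
  finally have "expectation (\<lambda>A. of_bool (?R (snd ` A))) \<le> measure_pmf.prob (random_subset n q) {V. ?R V}" .
  moreover have "expectation (\<lambda>A. of_bool (?R (snd ` A))) = 1 - expectation (\<lambda>A. of_bool (\<not> ?R (snd ` A)))"
  proof -
    have "expectation (\<lambda>A. of_bool (?R (snd ` A))) = expectation (\<lambda>A. 1 - of_bool (\<not> ?R (snd ` A)))"
      by (rule subset_exp_cong) simp
    also have "\<dots> = 1 - expectation (\<lambda>A. of_bool (\<not> ?R (snd ` A)))"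
      using fin_\<Omega> by (simp only: subset_exp_diff subset_exp_const)
    finally show ?thesis .
  qed
  ultimately show ?thesis using bad by linarith
qed

theorem theorem2p7:
  fixes r t :: nat and k :: "nat \<Rightarrow> nat"
    and \<zeta> K \<epsilon> c' C' :: real
    and H :: "nat \<Rightarrow> nat \<Rightarrow> nat ordered_hypergraph"
    and w :: "nat \<Rightarrow> real"
  assumes "r \<ge> 2"
    and "\<And>i. i \<in> {1..r} \<Longrightarrow> k i \<ge> 2"
    and "\<zeta> > 0" and "K > 0" and "\<epsilon> > 0" and "\<epsilon> < 1 / 2"
    and "t = Max (k ` {2..r})"
    and "\<zeta> > fact t * \<epsilon>"
    and "\<And>i n. i \<in> {1..r} \<Longrightarrow> uniform_ordered_hypergraph (k i) (H i n) \<and> verts (H i n) = {1..n}"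
    and "\<And>i. i \<in> {1..k 1} \<Longrightarrow> w i \<ge> 1"
    and "c' > 0" and "C' > 0"
  shows "\<exists>C>0. \<forall>(p :: nat \<Rightarrow> real) (\<tau> :: nat \<Rightarrow> real).
    (\<forall>n. 0 < p n \<and> p n \<le> 1) \<longrightarrow> p \<longlonglongrightarrow> 0 \<longrightarrow>
    (\<forall>n. 0 < \<tau> n \<and> \<tau> n < 1) \<longrightarrow> filterlim (\<lambda>n. \<tau> n * real n) at_top sequentially \<longrightarrow>
    seq_ramsey r \<zeta> k H \<longrightarrow>
    (\<forall>\<^sub>F n in sequentially. tamed (k 1) K (H 1 n)) \<longrightarrow>
    properly_bounded_seq (k 1) p w \<tau> c' C' (H 1) \<longrightarrow>
    (\<forall>\<^sub>F n in sequentially. \<forall>i\<in>{2..r}. codeg (k i) (H i n) (\<tau> n) \<le> \<epsilon> / (12 * fact t)) \<longrightarrow>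
    (\<forall>q :: nat \<Rightarrow> real.
       (\<forall>n. 0 \<le> q n \<and> q n \<le> 1 \<and> q n \<ge> C * p n) \<longrightarrow>
       (\<lambda>n. measure_pmf.prob (random_subset n (q n))
              {V. ramsey r k V (\<lambda>i. induced (k i) (H i n) V)}) \<longlonglongrightarrow> 1)"
proof -
  note r = assms(1) and k2 = assms(2) and \<epsilon> = assms(5) and \<zeta>t = assms(8) and H = assms(9) and w = assms(10)
  have kt: "k i \<le> t" if "i \<in> {2..r}" for i unfolding assms(7) using that by (intro Max_ge) auto
  define D where "D = (\<lambda>i. \<epsilon> / (12 * fact t) * 2 ^ (k i choose 2) * real (k i))"
  let ?containers = "\<lambda>i L c. 0 < c \<and> (\<forall>(V :: nat set) E \<tau>. finite V \<longrightarrow> (\<forall>e\<in>E. e \<subseteq> V \<and> card e = k i) \<longrightarrow> 0 < \<tau> \<longrightarrow>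
    (\<forall>l\<in>{1..<k i}. (\<Sum>v\<in>V. real (codegree V E l {v})) \<le> D i * \<tau> ^ l * real (card E)) \<longrightarrow>
    (\<exists>cont. container_map V E L (c * \<tau> * real (card V)) (\<epsilon> * real (card E)) cont))"
  have "\<exists>z. ?containers i (fst z) (snd z)" if i: "i \<in> {2..r}" for i
  proof -
    have "k i \<ge> 2" using k2[of i] i by auto
    moreover have "0 < D i" unfolding D_def using \<epsilon> \<open>k i \<ge> 2\<close> by (intro mult_pos_pos divide_pos_pos) auto
    ultimately have "\<exists>L c. ?containers i L c" using \<epsilon> by (rule hypergraph_containers)
    then show ?thesis by simp
  qed
  then have "\<forall>i. \<exists>z. i \<in> {2..r} \<longrightarrow> ?containers i (fst z) (snd z)" by simp
  then obtain z where z: "\<forall>i. i \<in> {2..r} \<longrightarrow> ?containers i (fst (z i)) (snd (z i))"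
    by (rule choice[THEN exE])
  define L where "L = (\<lambda>i. fst (z i))"
  define cs where "cs = (\<lambda>i. snd (z i))"
  have cs: "0 < cs i" if "i \<in> {2..r}" for i using z that by (simp add: cs_def)
  have containers: "\<exists>cont. container_map V E (L i) (cs i * \<tau> * real (card V)) (\<epsilon> * real (card E)) cont"
    if "i \<in> {2..r}" "finite V" "\<forall>e\<in>E. e \<subseteq> V \<and> card e = k i" "0 < \<tau>"
      "\<forall>l\<in>{1..<k i}. (\<Sum>v\<in>V. real (codegree V E l {v})) \<le> D i * \<tau> ^ l * real (card E)"
    for i and V :: "nat set" and E \<tau>
    using z[rule_format, OF that(1), THEN conjunct2, rule_format, OF that(2) that(3)[rule_format] that(4) that(5)[rule_format]]
    unfolding L_def cs_def .
  define c where "c = (\<Sum>i\<in>{2..r}. cs i)"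
  have c: "0 < c" unfolding c_def using cs r by (intro sum_pos) auto
  define K' where "K' = max 1 K"
  have K': "1 \<le> K'" by (simp add: K'_def)
  define b where "b = real (card (SIGMA i:{2..r}. {..<L i})) * real (k 1) * (2 ^ (k 1 + 1) * K' * C') + 1"
  \<comment> \<open>\<open>a * C0\<close> is the Janson exponent per unit of \<open>\<tau> n * n\<close>, and \<open>b * C0 ^ k 1\<close> dominates the number of edge choices; the summand \<open>1\<close> in \<open>b\<close> only keeps it positive.\<close>
  define a where "a = \<zeta>\<^sup>2 * c' / (2 ^ (k 1 + 1) * K')"
  have a: "0 < a" unfolding a_def using assms K' by (intro divide_pos_pos mult_pos_pos) auto
  have b: "0 < b" unfolding b_def using K' assms(12) by (intro add_nonneg_pos mult_nonneg_nonneg of_nat_0_le_iff) auto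
  \<comment> \<open>The entropy of the fingerprints is logarithmic in \<open>C0\<close>; the spare \<open>1\<close> leaves an error of \<open>exp (- \<tau> n * n)\<close>.\<close>
  obtain C0 where C0: "1 \<le> C0" "c * (1 + ln ((b * C0 ^ k 1 + c) / c)) + 1 \<le> a * C0"
    using linear_beats_log[OF a b c] by blast
  have k1: "1 \<le> k 1" "2 \<le> k 1" using k2[of 1] r by auto
  \<comment> \<open>A vertex may be sampled in each of its \<open>k 1\<close> roles.\<close>
  define C where "C = real (k 1) * C0"
  have "0 < C" unfolding C_def using k1 C0 by (intro mult_pos_pos) auto
  moreover have "(\<lambda>n. measure_pmf.prob (random_subset n (q n))
      {V. ramsey r k V (\<lambda>i. induced (k i) (H i n) V)}) \<longlonglongrightarrow> 1"
    if p: "\<forall>n. 0 < p n \<and> p n \<le> 1" "p \<longlonglongrightarrow> 0"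
      and \<tau>: "\<forall>n. 0 < \<tau> n \<and> \<tau> n < 1" "filterlim (\<lambda>n. \<tau> n * real n) at_top sequentially"
      and ram: "seq_ramsey r \<zeta> k H" and tame: "\<forall>\<^sub>F n in sequentially. tamed (k 1) K (H 1 n)"
      and bounded: "properly_bounded_seq (k 1) p w \<tau> c' C' (H 1)"
      and codeg: "\<forall>\<^sub>F n in sequentially. \<forall>i\<in>{2..r}. codeg (k i) (H i n) (\<tau> n) \<le> \<epsilon> / (12 * fact t)"
      and q: "\<forall>n. 0 \<le> q n \<and> q n \<le> 1 \<and> q n \<ge> C * p n" for p \<tau> q :: "nat \<Rightarrow> real"
  proof -
    let ?x = "\<lambda>n. \<tau> n * real n"
    let ?prob = "\<lambda>n. measure_pmf.prob (random_subset n (q n)) {V. ramsey r k V (\<lambda>i. induced (k i) (H i n) V)}"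
    let ?err = "\<lambda>n. 4 ^ k 1 * K' / (C0 * (c' * ?x n)) + exp (- ?x n)"
    have ev1: "\<forall>\<^sub>F n in sequentially. C0 * p n \<le> 1"
    proof -
      have "(\<lambda>n. C0 * p n) \<longlonglongrightarrow> C0 * 0" using p(2) by (intro tendsto_mult_left)
      then have "\<forall>\<^sub>F n in sequentially. C0 * p n < 1" by (rule order_tendstoD) simp
      then show ?thesis by (rule eventually_mono) simp
    qed
    have "\<forall>\<^sub>F n in sequentially. 1 - ?err n \<le> ?prob n"
      using ev1 ram[unfolded seq_ramsey_def] tame
        bounded[unfolded properly_bounded_seq_def bounded_seq_def, THEN conjunct1]
        bounded[unfolded properly_bounded_seq_def proper_weight_def, THEN conjunct2]
        \<comment> \<open>With more than \<open>t\<close> vertices the maxima in the co-degree function range over nonempty sets.\<close>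
        codeg eventually_ge_at_top[of "t + 1"]
    proof eventually_elim
      case (elim n)
      define x where "x = \<tau> n * real n"
      have n: "0 < n" using elim(7) by simp
      have x: "0 < x" using \<tau>(1) n by (simp add: x_def)
      have "\<exists>cont. container_map {1..n} (edges (H i n)) (L i) (cs i * x) (\<epsilon> * real (card (edges (H i n)))) cont"
        (is "\<exists>cont. ?contains i cont") if i: "i \<in> {2..r}" for i
      proof -
        have Hi: "uniform_ordered_hypergraph (k i) (H i n)" "verts (H i n) = {1..n}" using H[of i n] i by auto
        have "\<exists>cont. container_map {1..n} (edges (H i n)) (L i) (cs i * \<tau> n * real (card {1..n}))
          (\<epsilon> * real (card (edges (H i n)))) cont"
        proof (rule containers[OF i])
          show "\<forall>e\<in>edges (H i n). e \<subseteq> {1..n} \<and> card e = k i"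
            using Hi unfolding uniform_ordered_hypergraph_def uniform_hypergraph_def by auto
          show "\<forall>l\<in>{1..<k i}. (\<Sum>v\<in>{1..n}. real (codegree {1..n} (edges (H i n)) l {v}))
              \<le> D i * \<tau> n ^ l * real (card (edges (H i n)))"
          proof
            fix l assume l: "l \<in> {1..<k i}"
            show "(\<Sum>v\<in>{1..n}. real (codegree {1..n} (edges (H i n)) l {v}))
              \<le> D i * \<tau> n ^ l * real (card (edges (H i n)))"
              unfolding D_def Hi(2)[symmetric]
              using kt[OF i] elim(6,7) i l \<tau>(1) by (intro codegree_sum_le_codeg[OF Hi(1)]) (auto simp: Hi(2))
          qed
        qed (use \<tau>(1) in auto)
        then show ?thesis by (simp add: x_def mult.assoc)
      qed
      then have "\<forall>i. \<exists>cont. i \<in> {2..r} \<longrightarrow> ?contains i cont" by simp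
      then obtain cont where cont: "\<forall>i. i \<in> {2..r} \<longrightarrow> ?contains i (cont i)" by (rule choice[THEN exE])
      define S where "S = nat \<lfloor>c * x\<rfloor>"
      have S: "real S \<le> c * x" "c * x < real S + 1"
        using c x by (simp_all add: S_def)
      let ?Bd = "real (card (SIGMA i:{2..r}. {..<L i})) * real (k 1) * (2 ^ (k 1 + 1) * K' * (C0 ^ k 1 * (C' * x)))"
      let ?ex = "exp (- (\<zeta>\<^sup>2 * (C0 * (c' * x)) / (2 ^ (k 1 + 1) * K')))"
      have "1 - (4 ^ k 1 * K' / (C0 * (c' * x)) + (\<Sum>i\<le>S. ?Bd ^ i / fact i) * ?ex) \<le> ?prob n"
        unfolding K'_def
      proof (rule non_ramsey_probability_le[where s = "\<lambda>i. cs i * x" and p = "p n" and w = w and container = cont and t = t])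
        show "\<exists>i\<in>{1..r}. \<zeta> * real (osize (H i n)) < real (osize (induced (k i) (H i n) (U i)))"
          if "is_partition r {1..n} U" for U using elim(2) that by blast
        show "container_map {1..n} (edges (H i n)) (L i) (cs i * x) (\<epsilon> * real (card (edges (H i n)))) (cont i)"
          if "i \<in> {2..r}" for i
          using cont that by simp
        show "c' * x \<le> min_weighted_size (k 1) (p n) w (H 1 n)"
          "min_weighted_size (k 1) (p n) w (H 1 n) \<le> C' * x"
          using elim(4) by (simp_all add: x_def mult.assoc)
        show "\<exists>W. minimiser (k 1) (p n) w (H 1 n) W \<and> i \<in> W" if "i \<in> {1..k 1}" for i
          using elim(5) that by blast
        show "(\<Sum>i\<in>{2..r}. cs i * x) < real S + 1"
          using S(2) by (simp add: c_def sum_distrib_right)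
        show "real (k 1) * (C0 * p n) \<le> q n" using q by (simp add: C_def mult.assoc)
      qed (use r k1 H kt \<epsilon> \<zeta>t elim(1,3) p(1) w x assms(11) C0(1) q in auto)
      moreover have "(\<Sum>i\<le>S. ?Bd ^ i / fact i) * ?ex \<le> exp (- x)"
      proof -
        have "(\<Sum>i\<le>S. ?Bd ^ i / fact i) \<le> exp (c * x * (1 + ln ((b * C0 ^ k 1 + c) / c)))"
        proof (rule exp_partial_sum_le)
          have "?Bd = (b - 1) * C0 ^ k 1 * x" by (simp add: b_def mult_ac)
          also have "\<dots> \<le> (b * C0 ^ k 1 + c) * x"
            using x C0 c by (intro mult_right_mono) (auto simp: algebra_simps add_increasing)
          finally show "?Bd \<le> (b * C0 ^ k 1 + c) * x" .
          show "0 \<le> ?Bd" using K' C0 x assms(12) by (intro mult_nonneg_nonneg of_nat_0_le_iff) auto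
        qed (use c b C0 x S in auto)
        then have "(\<Sum>i\<le>S. ?Bd ^ i / fact i) * ?ex \<le> exp (c * x * (1 + ln ((b * C0 ^ k 1 + c) / c))) * ?ex"
          by (intro mult_right_mono) auto
        also have "\<dots> = exp ((c * (1 + ln ((b * C0 ^ k 1 + c) / c)) - a * C0) * x)"
        proof -
          have ex: "?ex = exp (- (a * C0 * x))" by (simp add: a_def mult_ac)
          show ?thesis unfolding ex by (simp add: exp_add[symmetric] algebra_simps)
        qed
        also have "\<dots> \<le> exp ((- 1) * x)"
          using C0(2) x by (intro iffD2[OF exp_le_cancel_iff] mult_right_mono) auto
        finally show ?thesis unfolding mult_minus1 .
      qed
      ultimately show ?case unfolding x_def[symmetric] by linarith
    qed
    moreover have "\<forall>\<^sub>F n in sequentially. ?prob n \<le> 1" by simp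
    moreover have "(\<lambda>n. 1 - ?err n) \<longlonglongrightarrow> 1"
    proof -
      have main: "(\<lambda>n. 4 ^ k 1 * K' / (C0 * c') * inverse (?x n)) \<longlonglongrightarrow> 4 ^ k 1 * K' / (C0 * c') * 0"
        by (intro tendsto_mult_left filterlim_compose[OF tendsto_inverse_0_at_top[OF filterlim_ident] \<tau>(2)])
      have "(\<lambda>n. exp (- ?x n)) \<longlonglongrightarrow> 0"
        by (intro filterlim_compose[OF exp_at_bot] filterlim_compose[OF filterlim_uminus_at_bot_at_top \<tau>(2)])
      from tendsto_diff[OF tendsto_const[of 1] tendsto_add[OF main this]] show ?thesis
        by (simp add: divide_inverse mult_ac)
    qed
    ultimately show ?thesis by (rule real_tendsto_sandwich[rotated 2, OF _ tendsto_const, rotated])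
  qed
  ultimately show ?thesis by blast
qed

end
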